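(* Let $R$ and $S$ be Gorenstein rings and let $M={}_RM_S$ be an $R$-$S$-bimodule. Then the upper triangular matrix ring $\begin{pmatrix} R & M\\ 0 & S\end{pmatrix}$ is Gorenstein if and only if the following hold: both the left $R$-module ${}_RM$ and the right $S$-module $M_S$ are finitely-generated, ${\rm proj.dim}\,{}_RM<\infty$, and ${\rm proj.dim}\,M_S<\infty$.
   Context: Rings are associative with unit. A ring $A$ is called Gorenstein if $A$ is two-sided noetherian and the regular module $A$ has finite injective dimension both as a left $A$-module and as a right $A$-module. Rings are not assumed commutative. The upper triangular matrix ring $\begin{pmatrix} R & M\\ 0 & S\end{pmatrix}$ consists of matrices $\begin{pmatrix} r & m\\ 0 & s\end{pmatrix}$ with $r\in R$, $m\in M$, $s\in S$, with the usual matrix addition and multiplication (using the bimodule structure of $M$). ${\rm proj.dim}$ denotes projective dimension. *)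

theory Defs
  imports "HOL-Algebra.Module" "HOL-Library.Extended_Nat"
begin

section \<open>Modules over noncommutative rings\<close>

text \<open>
  The locale \<^emph>\<open>module\<close> of HOL-Algebra requires a commutative ring. The following is the same
  list of axioms over an arbitrary ring with unit. The record type of modules is reused; its
  (meaningless) ring multiplication and unit fields on the module are never consulted.
\<close>

locale lmodule = R?: ring R + M?: abelian_group M for R (structure) and M (structure) +
  assumes smult_closed [simp, intro]:
      "\<lbrakk>a \<in> carrier R; x \<in> carrier M\<rbrakk> \<Longrightarrow> a \<odot>\<^bsub>M\<^esub> x \<in> carrier M"
    and smult_l_distr:
      "\<lbrakk>a \<in> carrier R; b \<in> carrier R; x \<in> carrier M\<rbrakk> \<Longrightarrow>
        (a \<oplus> b) \<odot>\<^bsub>M\<^esub> x = a \<odot>\<^bsub>M\<^esub> x \<oplus>\<^bsub>M\<^esub> b \<odot>\<^bsub>M\<^esub> x"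
    and smult_r_distr:
      "\<lbrakk>a \<in> carrier R; x \<in> carrier M; y \<in> carrier M\<rbrakk> \<Longrightarrow>
        a \<odot>\<^bsub>M\<^esub> (x \<oplus>\<^bsub>M\<^esub> y) = a \<odot>\<^bsub>M\<^esub> x \<oplus>\<^bsub>M\<^esub> a \<odot>\<^bsub>M\<^esub> y"
    and smult_assoc1:
      "\<lbrakk>a \<in> carrier R; b \<in> carrier R; x \<in> carrier M\<rbrakk> \<Longrightarrow>
        (a \<otimes> b) \<odot>\<^bsub>M\<^esub> x = a \<odot>\<^bsub>M\<^esub> (b \<odot>\<^bsub>M\<^esub> x)"
    and smult_one [simp]:
      "x \<in> carrier M \<Longrightarrow> \<one> \<odot>\<^bsub>M\<^esub> x = x"

text \<open>A right \<open>A\<close>-module is a left module over the opposite ring of \<open>A\<close>.\<close>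

definition op_ring :: "'a ring \<Rightarrow> 'a ring" where
  "op_ring A = A\<lparr>mult := \<lambda>x y. y \<otimes>\<^bsub>A\<^esub> x\<rparr>"

text \<open>The regular left module; \<open>regular (op_ring A)\<close> is the regular right module.\<close>

definition regular :: "'a ring \<Rightarrow> ('a, 'a) module" where
  "regular A = \<lparr>carrier = carrier A, mult = mult A, one = \<one>\<^bsub>A\<^esub>, zero = \<zero>\<^bsub>A\<^esub>, add = add A,
     smult = mult A\<rparr>"

definition lmodule_hom ::
  "'a ring \<Rightarrow> ('a, 'm, 'c) module_scheme \<Rightarrow> ('a, 'n, 'd) module_scheme \<Rightarrow> ('m \<Rightarrow> 'n) set" where
  "lmodule_hom A M N =
     {f \<in> carrier M \<rightarrow> carrier N.
        (\<forall>x\<in>carrier M. \<forall>y\<in>carrier M. f (x \<oplus>\<^bsub>M\<^esub> y) = f x \<oplus>\<^bsub>N\<^esub> f y) \<and>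
        (\<forall>a\<in>carrier A. \<forall>x\<in>carrier M. f (a \<odot>\<^bsub>M\<^esub> x) = a \<odot>\<^bsub>N\<^esub> f x)}"

definition lmodule_ker ::
  "('a, 'm, 'c) module_scheme \<Rightarrow> ('a, 'n, 'd) module_scheme \<Rightarrow> ('m \<Rightarrow> 'n) \<Rightarrow> 'm set" where
  "lmodule_ker M N f = {x \<in> carrier M. f x = \<zero>\<^bsub>N\<^esub>}"

definition fg_lmodule :: "'a ring \<Rightarrow> ('a, 'm, 'c) module_scheme \<Rightarrow> bool" where
  "fg_lmodule A M \<longleftrightarrow>
     (\<exists>X. finite X \<and> X \<subseteq> carrier M \<and> (\<lambda>N. submodule N A M) hull X = carrier M)"

definition left_noetherian :: "'a ring \<Rightarrow> bool" where
  "left_noetherian A \<longleftrightarrow>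
     (\<forall>I. submodule I A (regular A) \<longrightarrow> fg_lmodule A ((regular A)\<lparr>carrier := I\<rparr>))"


section \<open>Projective and injective dimension\<close>

text \<open>
  HOL cannot quantify over the types of test modules inside a definition, so the two lifting
  properties below test against modules living in the same type \<open>'u\<close> as the module itself. They
  express projectivity and injectivity whenever \<open>'u\<close> is large enough. For injectivity it
  suffices that the ring embeds into \<open>'u\<close> (Baer's criterion); for projectivity, that \<open>'u\<close>
  contains some free module mapping onto the given one. Below they are only used at the type
  \<open>('a, 'm) univ\<close>, where this is the case.
\<close>

definition projective_lmodule :: "'a ring \<Rightarrow> ('a, 'u) module \<Rightarrow> bool" where
  "projective_lmodule A P \<longleftrightarrow> lmodule A P \<and>
     (\<forall>(Y :: ('a, 'u) module) (Z :: ('a, 'u) module) f g.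
        lmodule A Y \<and> lmodule A Z \<and>
        f \<in> lmodule_hom A Y Z \<and> f ` carrier Y = carrier Z \<and> g \<in> lmodule_hom A P Z \<longrightarrow>
        (\<exists>h \<in> lmodule_hom A P Y. \<forall>x\<in>carrier P. f (h x) = g x))"

definition injective_lmodule :: "'a ring \<Rightarrow> ('a, 'u) module \<Rightarrow> bool" where
  "injective_lmodule A I \<longleftrightarrow> lmodule A I \<and>
     (\<forall>(X :: ('a, 'u) module) (Y :: ('a, 'u) module) f g.
        lmodule A X \<and> lmodule A Y \<and>
        f \<in> lmodule_hom A X Y \<and> inj_on f (carrier X) \<and> g \<in> lmodule_hom A X I \<longrightarrow>
        (\<exists>h \<in> lmodule_hom A Y I. \<forall>x\<in>carrier X. h (f x) = g x))"

text \<open>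
  \<open>\<dots> \<rightarrow> P 2 \<rightarrow> P 1 \<rightarrow> P 0 \<rightarrow> M \<rightarrow> 0\<close> is exact with all \<open>P i\<close> projective; the maps are
  \<open>d i : P (i + 1) \<rightarrow> P i\<close> and \<open>e : P 0 \<rightarrow> M\<close>.
\<close>

definition projective_resolution ::
  "'a ring \<Rightarrow> ('a, 'm, 'c) module_scheme \<Rightarrow>
   (nat \<Rightarrow> ('a, 'u) module) \<Rightarrow> (nat \<Rightarrow> 'u \<Rightarrow> 'u) \<Rightarrow> ('u \<Rightarrow> 'm) \<Rightarrow> bool" where
  "projective_resolution A M P d e \<longleftrightarrow>
     (\<forall>i. projective_lmodule A (P i)) \<and>
     e \<in> lmodule_hom A (P 0) M \<and> (\<forall>i. d i \<in> lmodule_hom A (P (Suc i)) (P i)) \<and>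
     e ` carrier (P 0) = carrier M \<and>
     d 0 ` carrier (P 1) = lmodule_ker (P 0) M e \<and>
     (\<forall>i. d (Suc i) ` carrier (P (Suc (Suc i))) = lmodule_ker (P (Suc i)) (P i) (d i))"

text \<open>
  \<open>0 \<rightarrow> M \<rightarrow> I 0 \<rightarrow> I 1 \<rightarrow> I 2 \<rightarrow> \<dots>\<close> is exact with all \<open>I i\<close> injective; the maps are
  \<open>e : M \<rightarrow> I 0\<close> and \<open>d i : I i \<rightarrow> I (i + 1)\<close>.
\<close>

definition injective_resolution ::
  "'a ring \<Rightarrow> ('a, 'm, 'c) module_scheme \<Rightarrow>
   (nat \<Rightarrow> ('a, 'u) module) \<Rightarrow> (nat \<Rightarrow> 'u \<Rightarrow> 'u) \<Rightarrow> ('m \<Rightarrow> 'u) \<Rightarrow> bool" where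
  "injective_resolution A M I d e \<longleftrightarrow>
     (\<forall>i. injective_lmodule A (I i)) \<and>
     e \<in> lmodule_hom A M (I 0) \<and> (\<forall>i. d i \<in> lmodule_hom A (I i) (I (Suc i))) \<and>
     inj_on e (carrier M) \<and>
     e ` carrier M = lmodule_ker (I 0) (I 1) (d 0) \<and>
     (\<forall>i. d i ` carrier (I i) = lmodule_ker (I (Suc i)) (I (Suc (Suc i))) (d (Suc i)))"

text \<open>
  The type in which the terms of the resolutions of a module on \<open>'m\<close> over a ring on \<open>'a\<close> live.
  With \<open>\<kappa> = |'a| + |'m| + \<aleph>\<^sub>0\<close> it has cardinality \<open>2 ^ \<kappa>\<close>. This does not restrict
  the dimensions: over a ring of cardinality at most \<open>\<kappa>\<close>, a module of cardinality at most
  \<open>2 ^ \<kappa>\<close> is a quotient of a free module of cardinality at most \<open>2 ^ \<kappa>\<close>, and its injective hull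
  has cardinality at most \<open>(2 ^ \<kappa>) ^ \<kappa> = 2 ^ \<kappa>\<close>. Hence a module that has a projective
  (injective) resolution of length \<open>n\<close> in any universe has one in this type.
\<close>

type_synonym ('a, 'm) univ = "('a + 'm + nat) set"

text \<open>The infimum of the empty set is \<open>\<infinity>\<close>.\<close>

definition proj_dim :: "'a ring \<Rightarrow> ('a, 'm, 'c) module_scheme \<Rightarrow> enat" where
  "proj_dim A M = Inf {enat n | n.
     \<exists>(P :: nat \<Rightarrow> ('a, ('a, 'm) univ) module) d e.
       projective_resolution A M P d e \<and> (\<forall>i>n. carrier (P i) = {\<zero>\<^bsub>P i\<^esub>})}"

definition inj_dim :: "'a ring \<Rightarrow> ('a, 'm, 'c) module_scheme \<Rightarrow> enat" where
  "inj_dim A M = Inf {enat n | n.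
     \<exists>(I :: nat \<Rightarrow> ('a, ('a, 'm) univ) module) d e.
       injective_resolution A M I d e \<and> (\<forall>i>n. carrier (I i) = {\<zero>\<^bsub>I i\<^esub>})}"

definition gorenstein :: "'a ring \<Rightarrow> bool" where
  "gorenstein A \<longleftrightarrow> ring A \<and>
     left_noetherian A \<and> left_noetherian (op_ring A) \<and>
     inj_dim A (regular A) < \<infinity> \<and>
     inj_dim (op_ring A) (regular (op_ring A)) < \<infinity>"


section \<open>Bimodules and upper triangular matrix rings\<close>

text \<open>
  A bimodule extends a left module record by a right action, so that the bimodule itself is also
  its underlying left module.
\<close>

record ('r, 'm, 's) bimodule = "('r, 'm) module" +
  rsmult :: "'m \<Rightarrow> 's \<Rightarrow> 'm"

definition right_module :: "('r, 'm, 's) bimodule \<Rightarrow> ('s, 'm) module" where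
  "right_module M = \<lparr>carrier = carrier M, mult = mult M, one = \<one>\<^bsub>M\<^esub>, zero = \<zero>\<^bsub>M\<^esub>, add = add M,
     smult = (\<lambda>s x. rsmult M x s)\<rparr>"

definition is_bimodule :: "'r ring \<Rightarrow> 's ring \<Rightarrow> ('r, 'm, 's) bimodule \<Rightarrow> bool" where
  "is_bimodule R S M \<longleftrightarrow>
     lmodule R M \<and> lmodule (op_ring S) (right_module M) \<and>
     (\<forall>r\<in>carrier R. \<forall>x\<in>carrier M. \<forall>s\<in>carrier S.
        rsmult M (r \<odot>\<^bsub>M\<^esub> x) s = r \<odot>\<^bsub>M\<^esub> rsmult M x s)"

text \<open>The triple \<open>(r, m, s)\<close> stands for the matrix with rows \<open>(r m)\<close> and \<open>(0 s)\<close>.\<close>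

definition triangular_ring ::
  "'r ring \<Rightarrow> 's ring \<Rightarrow> ('r, 'm, 's) bimodule \<Rightarrow> ('r \<times> 'm \<times> 's) ring" where
  "triangular_ring R S M =
     \<lparr>carrier = carrier R \<times> carrier M \<times> carrier S,
      mult = (\<lambda>(r, m, s) (r', m', s').
                (r \<otimes>\<^bsub>R\<^esub> r', r \<odot>\<^bsub>M\<^esub> m' \<oplus>\<^bsub>M\<^esub> rsmult M m s', s \<otimes>\<^bsub>S\<^esub> s')),
      one = (\<one>\<^bsub>R\<^esub>, \<zero>\<^bsub>M\<^esub>, \<one>\<^bsub>S\<^esub>),
      zero = (\<zero>\<^bsub>R\<^esub>, \<zero>\<^bsub>M\<^esub>, \<zero>\<^bsub>S\<^esub>),
      add = (\<lambda>(r, m, s) (r', m', s'). (r \<oplus>\<^bsub>R\<^esub> r', m \<oplus>\<^bsub>M\<^esub> m', s \<oplus>\<^bsub>S\<^esub> s'))\<rparr>"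


section \<open>The constructions are rings and modules\<close>

lemma ring_op_ring:
  assumes "ring A" shows "ring (op_ring A)"
proof -
  interpret A: ring A by fact
  show ?thesis
    by (rule ringI, rule abelian_groupI, unfold_locales)
      (auto simp: op_ring_def A.m_assoc A.a_ac A.l_distr A.r_distr
        intro: A.l_neg bexI[of _ "\<ominus>\<^bsub>A\<^esub> x" for x])
qed

lemma lmodule_regular:
  assumes "ring A" shows "lmodule A (regular A)"
proof -
  interpret A: ring A by fact
  have "abelian_group (regular A)"
    by (rule abelian_groupI)
      (auto simp: regular_def A.a_ac intro: A.l_neg bexI[of _ "\<ominus>\<^bsub>A\<^esub> x" for x])
  then show ?thesis
    by (intro lmodule.intro lmodule_axioms.intro assms)
      (auto simp: regular_def A.m_assoc A.l_distr A.r_distr)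
qed

lemma ring_triangular_ring:
  assumes "ring R" "ring S" "is_bimodule R S M" shows "ring (triangular_ring R S M)"
proof -
  interpret R: ring R by fact
  interpret S: ring S by fact
  interpret L: lmodule R M using assms(3) by (simp add: is_bimodule_def)
  interpret N: lmodule "op_ring S" "right_module M" using assms(3) by (simp add: is_bimodule_def)
  have bim: "rsmult M (r \<odot>\<^bsub>M\<^esub> x) s = r \<odot>\<^bsub>M\<^esub> rsmult M x s"
    if "r \<in> carrier R" "x \<in> carrier M" "s \<in> carrier S" for r x s
    using assms(3) that by (simp add: is_bimodule_def)
  have cl: "rsmult M x s \<in> carrier M" if "x \<in> carrier M" "s \<in> carrier S" for x s
    using N.smult_closed[of s x] that by (simp add: op_ring_def right_module_def)
  have dl: "rsmult M x (s \<oplus>\<^bsub>S\<^esub> t) = rsmult M x s \<oplus>\<^bsub>M\<^esub> rsmult M x t"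
    if "x \<in> carrier M" "s \<in> carrier S" "t \<in> carrier S" for x s t
    using N.smult_l_distr[of s t x] that by (simp add: op_ring_def right_module_def)
  have dr: "rsmult M (x \<oplus>\<^bsub>M\<^esub> y) s = rsmult M x s \<oplus>\<^bsub>M\<^esub> rsmult M y s"
    if "x \<in> carrier M" "y \<in> carrier M" "s \<in> carrier S" for x y s
    using N.smult_r_distr[of s x y] that by (simp add: op_ring_def right_module_def)
  have as: "rsmult M x (s \<otimes>\<^bsub>S\<^esub> t) = rsmult M (rsmult M x s) t"
    if "x \<in> carrier M" "s \<in> carrier S" "t \<in> carrier S" for x s t
    using N.smult_assoc1[of t s x] that by (simp add: op_ring_def right_module_def)
  have un: "rsmult M x \<one>\<^bsub>S\<^esub> = x" if "x \<in> carrier M" for x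
    using N.smult_one[of x] that by (simp add: op_ring_def right_module_def)
  have rz: "rsmult M \<zero>\<^bsub>M\<^esub> s = \<zero>\<^bsub>M\<^esub>" if "s \<in> carrier S" for s
    using dr[of "\<zero>\<^bsub>M\<^esub>" "\<zero>\<^bsub>M\<^esub>" s] cl[of "\<zero>\<^bsub>M\<^esub>" s] that by (simp add: L.M.add.r_cancel_one')
  have lz: "r \<odot>\<^bsub>M\<^esub> \<zero>\<^bsub>M\<^esub> = \<zero>\<^bsub>M\<^esub>" if "r \<in> carrier R" for r
    using L.smult_r_distr[of r "\<zero>\<^bsub>M\<^esub>" "\<zero>\<^bsub>M\<^esub>"] L.smult_closed[of r "\<zero>\<^bsub>M\<^esub>"] that
    by (simp add: L.M.add.r_cancel_one')
  have "abelian_group (triangular_ring R S M)"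
  proof (rule abelian_groupI)
    fix x assume "x \<in> carrier (triangular_ring R S M)"
    then show "\<exists>y\<in>carrier (triangular_ring R S M).
        y \<oplus>\<^bsub>triangular_ring R S M\<^esub> x = \<zero>\<^bsub>triangular_ring R S M\<^esub>"
      by (intro bexI[of _ "(\<ominus>\<^bsub>R\<^esub> fst x, \<ominus>\<^bsub>M\<^esub> fst (snd x), \<ominus>\<^bsub>S\<^esub> snd (snd x))"])
        (auto simp: triangular_ring_def R.l_neg S.l_neg L.M.l_neg)
  qed (auto simp: triangular_ring_def R.a_ac S.a_ac L.M.a_ac)
  moreover have "monoid (triangular_ring R S M)"
    by (rule monoidI)
      (auto simp: triangular_ring_def R.m_assoc S.m_assoc cl rz lz un L.smult_assoc1
        L.smult_r_distr bim as dr L.M.a_ac)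
  ultimately show ?thesis
    by (rule ringI)
      (auto simp: triangular_ring_def R.l_distr R.r_distr S.l_distr S.r_distr cl dl dr
        L.smult_l_distr L.smult_r_distr L.M.a_ac)
qed

end

theory Submission
  imports Defs "HOL-Algebra.IntRing"
begin

text \<open>
  The idea is to express finite injective and finite projective dimension by exactness of matrices.
  Then the theorem becomes a computation with block matrices.

  Let \<open>A\<close> be a left noetherian ring. A finitely generated left module has a resolution by finitely
  generated free modules, that is, by matrices \<open>D 0, D 1, \<dots>\<close> over \<open>A\<close> that act on row vectors
  (\<open>free_res\<close>). The same matrices act on column vectors with entries in a left module \<open>N\<close>, and the
  homology of this complex of columns is \<open>Ext\<close> of the resolved module with values in \<open>N\<close>. So \<open>N\<close>
  has finite injective dimension if and only if there is an \<open>n\<close> such that for every \<open>D\<close> the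
  columns over \<open>N\<close> are exact from position \<open>n\<close> on (\<open>ext_vanishes\<close>). One direction
  (\<open>inj_dim_imp_ext_vanishes\<close>) is dimension shifting along an injective resolution. The other
  one (\<open>ext_vanishes_imp_inj_dim\<close>) embeds \<open>N\<close> and its cosyzygies into injective modules
  \<open>Hom(A, D)\<close>, with \<open>D\<close> a divisible group, until a cosyzygy is injective by Baer's criterion;
  this uses that the ideals of \<open>A\<close> are finitely generated. The condition on matrices mentions
  no universe of test modules, so it can be carried from one ring to another.

  Projective modules are flat: columns over a projective module are exact where columns over \<open>A\<close> are.
  Hence, if \<open>N\<close> has finite projective dimension, exactness over \<open>A\<close> in high degrees passes on to \<open>N\<close>
  (\<open>finite_projective_col_exact\<close>). For columns this gives the vanishing of \<open>Ext\<close>, and for rows, with a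
  right module \<open>N\<close>, the vanishing of \<open>Tor\<close>.
  Conversely, over a Gorenstein ring a finitely generated \<open>N\<close> with \<open>ext_vanishes\<close> has finite
  projective dimension (\<open>ext_vanishes_imp_proj_dim\<close>). Far out in a resolution of \<open>N\<close> the columns
  over \<open>A\<close> are exact too, and such a resolution, exact in rows and columns, can be continued
  arbitrarily far beyond its end. As \<open>Ext\<close> vanishes on the continued resolution, the syzygy at
  which it was continued is a direct summand of a free module.

  A matrix over the triangular ring \<open>T\<close> is a triple of matrices over \<open>R\<close>, \<open>M\<close> and \<open>S\<close>. Given a free
  resolution over \<open>T\<close>, its matrices over \<open>S\<close> form a free resolution, and since \<open>Tor\<close> over \<open>S\<close> with
  \<open>M\<close> vanishes in high degrees, its matrices over \<open>R\<close> eventually form one as well. An equation for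
  columns over \<open>T\<close> is now solved for the coordinates in \<open>S\<close>, in \<open>R\<close>, and at last in \<open>M\<close>; the last step
  needs \<open>ext_vanishes\<close> for the left module \<open>M\<close> (\<open>ext_vanishes_triangular\<close>). In the other direction, \<open>M\<close> is
  a left ideal of \<open>T\<close>, hence finitely generated, and multiplication by the first diagonal idempotent
  turns an injective resolution of \<open>T\<close> into a coresolution of \<open>R \<oplus> M\<close> over \<open>R\<close> that still computes \<open>Ext\<close>
  (\<open>ext_vanishes_of_inj_dim_triangular\<close>). The right-hand conditions are the left-hand ones for the opposite
  ring, which is triangular again (\<open>tri_ring.opposite\<close>).
\<close>

section \<open>Linear combinations, matrices and submodules\<close>

context lmodule
begin

lemma smult_zero_left [simp]: "x \<in> carrier M \<Longrightarrow> \<zero> \<odot>\<^bsub>M\<^esub> x = \<zero>\<^bsub>M\<^esub>"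
  using smult_l_distr[of \<zero> \<zero> x] by (metis M.add.r_cancel_one' R.zero_closed R.r_zero smult_closed)

lemma smult_zero_right [simp]: "a \<in> carrier R \<Longrightarrow> a \<odot>\<^bsub>M\<^esub> \<zero>\<^bsub>M\<^esub> = \<zero>\<^bsub>M\<^esub>"
  using smult_r_distr[of a "\<zero>\<^bsub>M\<^esub>" "\<zero>\<^bsub>M\<^esub>"]
  by (metis M.add.r_cancel_one' M.zero_closed M.r_zero smult_closed)

lemma smult_minus_left:
  "a \<in> carrier R \<Longrightarrow> x \<in> carrier M \<Longrightarrow> (\<ominus> a) \<odot>\<^bsub>M\<^esub> x = \<ominus>\<^bsub>M\<^esub> (a \<odot>\<^bsub>M\<^esub> x)"
  using smult_l_distr[of "\<ominus> a" a x] by (simp add: M.minus_equality R.l_neg)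

lemma smult_minus_right:
  "a \<in> carrier R \<Longrightarrow> x \<in> carrier M \<Longrightarrow> a \<odot>\<^bsub>M\<^esub> (\<ominus>\<^bsub>M\<^esub> x) = \<ominus>\<^bsub>M\<^esub> (a \<odot>\<^bsub>M\<^esub> x)"
  using smult_r_distr[of a "\<ominus>\<^bsub>M\<^esub> x" x] by (simp add: M.minus_equality M.l_neg)

lemma minus_zeroM [simp]: "\<ominus>\<^bsub>M\<^esub> \<zero>\<^bsub>M\<^esub> = \<zero>\<^bsub>M\<^esub>"
  by (rule M.minus_equality) simp_all

end

lemma op_ring_simps [simp]:
  "carrier (op_ring A) = carrier A" "zero (op_ring A) = zero A" "one (op_ring A) = one A"
  "add (op_ring A) = add A" "x \<otimes>\<^bsub>op_ring A\<^esub> y = y \<otimes>\<^bsub>A\<^esub> x" "op_ring (op_ring A) = A"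
  by (auto simp: op_ring_def)

lemma regular_simps [simp]:
  "carrier (regular A) = carrier A" "zero (regular A) = zero A"
  "add (regular A) = add A" "a \<odot>\<^bsub>regular A\<^esub> b = a \<otimes>\<^bsub>A\<^esub> b"
  by (auto simp: regular_def)

lemma a_inv_regular [simp]: "a_inv (regular A) = a_inv A"
  by (auto simp: regular_def a_inv_def m_inv_def fun_eq_iff)

primrec lin_comb :: "('a, 'm, 'c) module_scheme \<Rightarrow> nat \<Rightarrow> (nat \<Rightarrow> 'a) \<Rightarrow> (nat \<Rightarrow> 'm) \<Rightarrow> 'm" where
  "lin_comb N 0 a y = \<zero>\<^bsub>N\<^esub>"
| "lin_comb N (Suc p) a y = lin_comb N p a y \<oplus>\<^bsub>N\<^esub> a p \<odot>\<^bsub>N\<^esub> y p"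

lemma lin_comb_cong:
  "(\<And>i. i < p \<Longrightarrow> a i = b i) \<Longrightarrow> (\<And>i. i < p \<Longrightarrow> x i = y i) \<Longrightarrow> lin_comb N p a x = lin_comb N p b y"
  by (induction p) auto

abbreviation vecs :: "('a, 'b) ring_scheme \<Rightarrow> nat \<Rightarrow> (nat \<Rightarrow> 'a) set" where
  "vecs A p \<equiv> {..<p} \<rightarrow> carrier A"

abbreviation mats :: "('a, 'b) ring_scheme \<Rightarrow> nat \<Rightarrow> nat \<Rightarrow> (nat \<Rightarrow> nat \<Rightarrow> 'a) set" where
  "mats A q p \<equiv> {..<q} \<rightarrow> {..<p} \<rightarrow> carrier A"

lemma vecs_Suc: "x \<in> vecs A (Suc p) \<longleftrightarrow> x \<in> vecs A p \<and> x p \<in> carrier A"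
  by (auto simp: less_Suc_eq)

definition unit_vec :: "('a, 'b) ring_scheme \<Rightarrow> nat \<Rightarrow> nat \<Rightarrow> 'a" where
  "unit_vec A i = (\<lambda>j. if j = i then \<one>\<^bsub>A\<^esub> else \<zero>\<^bsub>A\<^esub>)"

context lmodule
begin

lemma lin_comb_closed [simp, intro]: "a \<in> vecs R p \<Longrightarrow> y \<in> vecs M p \<Longrightarrow> lin_comb M p a y \<in> carrier M"
  by (induction p) (auto simp: vecs_Suc)

lemma lin_comb_add_left:
  "\<lbrakk>a \<in> vecs R p; b \<in> vecs R p; y \<in> vecs M p\<rbrakk> \<Longrightarrow>
     lin_comb M p (\<lambda>i. a i \<oplus> b i) y = lin_comb M p a y \<oplus>\<^bsub>M\<^esub> lin_comb M p b y"
  by (induction p) (auto simp: vecs_Suc smult_l_distr M.a_ac)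

lemma lin_comb_add_right:
  "\<lbrakk>a \<in> vecs R p; x \<in> vecs M p; y \<in> vecs M p\<rbrakk> \<Longrightarrow>
     lin_comb M p a (\<lambda>i. x i \<oplus>\<^bsub>M\<^esub> y i) = lin_comb M p a x \<oplus>\<^bsub>M\<^esub> lin_comb M p a y"
  by (induction p) (auto simp: vecs_Suc smult_r_distr M.a_ac)

lemma lin_comb_minus_right:
  "\<lbrakk>a \<in> vecs R p; y \<in> vecs M p\<rbrakk> \<Longrightarrow> lin_comb M p a (\<lambda>i. \<ominus>\<^bsub>M\<^esub> y i) = \<ominus>\<^bsub>M\<^esub> lin_comb M p a y"
  by (induction p) (auto simp: vecs_Suc smult_minus_right M.minus_add)

lemma lin_comb_diff_right:
  "\<lbrakk>a \<in> vecs R p; x \<in> vecs M p; y \<in> vecs M p\<rbrakk> \<Longrightarrow>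
     lin_comb M p a (\<lambda>i. x i \<ominus>\<^bsub>M\<^esub> y i) = lin_comb M p a x \<ominus>\<^bsub>M\<^esub> lin_comb M p a y"
  unfolding a_minus_def by (subst lin_comb_add_right) (auto simp: lin_comb_minus_right)

lemma lin_comb_smult:
  "\<lbrakk>c \<in> carrier R; a \<in> vecs R p; y \<in> vecs M p\<rbrakk> \<Longrightarrow>
     lin_comb M p (\<lambda>i. c \<otimes> a i) y = c \<odot>\<^bsub>M\<^esub> lin_comb M p a y"
  by (induction p) (auto simp: vecs_Suc smult_r_distr smult_assoc1)

lemma lin_comb_zero_left [simp]: "y \<in> vecs M p \<Longrightarrow> lin_comb M p (\<lambda>i. \<zero>) y = \<zero>\<^bsub>M\<^esub>"
  by (induction p) (auto simp: vecs_Suc)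

lemma lin_comb_zero_right [simp]: "a \<in> vecs R p \<Longrightarrow> lin_comb M p a (\<lambda>i. \<zero>\<^bsub>M\<^esub>) = \<zero>\<^bsub>M\<^esub>"
  by (induction p) (auto simp: vecs_Suc)

lemma lin_comb_zero_left':
  assumes "\<And>i. i < p \<Longrightarrow> a i = \<zero>" "y \<in> vecs M p" shows "lin_comb M p a y = \<zero>\<^bsub>M\<^esub>"
  using lin_comb_zero_left[of y p] lin_comb_cong[of p a "\<lambda>i. \<zero>" y y M] assms by auto

lemma lin_comb_zero_right':
  assumes "\<And>i. i < p \<Longrightarrow> y i = \<zero>\<^bsub>M\<^esub>" "a \<in> vecs R p" shows "lin_comb M p a y = \<zero>\<^bsub>M\<^esub>"
  using lin_comb_zero_right[of a p] lin_comb_cong[of p a a y "\<lambda>i. \<zero>\<^bsub>M\<^esub>" M] assms by auto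

lemma unit_vec_closed [simp]: "unit_vec R i j \<in> carrier R"
  by (auto simp: unit_vec_def)

lemma lin_comb_unit_vec: "i < p \<Longrightarrow> y \<in> vecs M p \<Longrightarrow> lin_comb M p (unit_vec R i) y = y i"
proof (induction p)
  case (Suc p)
  have "lin_comb M p (unit_vec R i) y = (if i < p then y i else \<zero>\<^bsub>M\<^esub>)"
    using Suc by (auto simp: vecs_Suc unit_vec_def intro!: lin_comb_zero_left')
  then show ?case using Suc.prems
    by (cases "i = p") (auto simp: vecs_Suc unit_vec_def Pi_def)
qed auto

end

text \<open>
  A row vector over \<open>A\<close> is a column vector over the opposite ring. Through this identity every statement
  about columns has a counterpart about rows.
\<close>

lemma lin_comb_op: "lin_comb (regular (op_ring A)) p a x = lin_comb (regular A) p x a"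
  by (induction p) auto

lemma lin_comb_regular_closed [simp, intro]:
  assumes "ring A" "a \<in> vecs A p" "b \<in> vecs A p" shows "lin_comb (regular A) p a b \<in> carrier A"
  using lmodule.lin_comb_closed[OF lmodule_regular[OF assms(1)], of a p b] assms by (simp add: Pi_def)

text \<open>
  A row times a matrix times a column, with the column in a module: moving the brackets is what makes
  the action of \<open>A\<close>-matrices on rows and on columns dual to each other.
\<close>

lemma lin_comb_assoc:
  assumes "lmodule A N" "x \<in> vecs A q" "E \<in> mats A q p" "y \<in> vecs N p"
  shows "lin_comb N q x (\<lambda>i. lin_comb N p (E i) y) = lin_comb N p (\<lambda>j. lin_comb (regular A) q x (\<lambda>i. E i j)) y"
  using assms(2,3)
proof (induction q)
  case 0
  interpret N: lmodule A N by fact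
  show ?case using assms(4) by simp
next
  case (Suc q)
  interpret N: lmodule A N by fact
  have E: "E \<in> mats A q p" "E q \<in> vecs A p" using Suc.prems by (auto simp: Pi_def)
  have "lin_comb N p (\<lambda>j. x q \<otimes>\<^bsub>A\<^esub> E q j) y = x q \<odot>\<^bsub>N\<^esub> lin_comb N p (E q) y"
    using Suc.prems E assms by (intro N.lin_comb_smult) (auto simp: vecs_Suc)
  moreover have "(\<lambda>j. x q \<otimes>\<^bsub>A\<^esub> E q j) \<in> vecs A p" using E Suc.prems by (auto simp: Pi_def)
  moreover have "(\<lambda>j. lin_comb (regular A) q x (\<lambda>i. E i j)) \<in> vecs A p"
    using E Suc.prems N.R.ring_axioms by (auto simp: Pi_def intro!: lin_comb_regular_closed)
  ultimately show ?case using Suc E assms(4)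
    by (simp add: vecs_Suc N.lin_comb_add_left)
qed

lemma lmodule_homD:
  assumes "f \<in> lmodule_hom A M N"
  shows lmodule_hom_closed: "x \<in> carrier M \<Longrightarrow> f x \<in> carrier N"
    and lmodule_hom_add: "x \<in> carrier M \<Longrightarrow> y \<in> carrier M \<Longrightarrow> f (x \<oplus>\<^bsub>M\<^esub> y) = f x \<oplus>\<^bsub>N\<^esub> f y"
    and lmodule_hom_smult: "a \<in> carrier A \<Longrightarrow> x \<in> carrier M \<Longrightarrow> f (a \<odot>\<^bsub>M\<^esub> x) = a \<odot>\<^bsub>N\<^esub> f x"
  using assms by (auto simp: lmodule_hom_def)

lemma lmodule_homI:
  assumes "\<And>x. x \<in> carrier M \<Longrightarrow> f x \<in> carrier N"
    and "\<And>x y. x \<in> carrier M \<Longrightarrow> y \<in> carrier M \<Longrightarrow> f (x \<oplus>\<^bsub>M\<^esub> y) = f x \<oplus>\<^bsub>N\<^esub> f y"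
    and "\<And>a x. a \<in> carrier A \<Longrightarrow> x \<in> carrier M \<Longrightarrow> f (a \<odot>\<^bsub>M\<^esub> x) = a \<odot>\<^bsub>N\<^esub> f x"
  shows "f \<in> lmodule_hom A M N"
  using assms by (auto simp: lmodule_hom_def)

lemma lmodule_hom_comp:
  assumes "f \<in> lmodule_hom A M N" "g \<in> lmodule_hom A N L"
  shows "(\<lambda>x. g (f x)) \<in> lmodule_hom A M L"
  using assms by (intro lmodule_homI) (simp_all add: lmodule_homD)

lemma (in abelian_group) minus_eq_zeroD: "x \<in> carrier G \<Longrightarrow> y \<in> carrier G \<Longrightarrow> x \<ominus> y = \<zero> \<Longrightarrow> x = y"
  by (metis a_minus_def add.inv_closed add.inv_inv minus_equality)

locale lmodule_homo = M: lmodule A M + N: lmodule A N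
  for A (structure) and M (structure) and N (structure) and f +
  assumes hom: "f \<in> lmodule_hom A M N"
begin

lemma closed [simp, intro]: "x \<in> carrier M \<Longrightarrow> f x \<in> carrier N"
  using hom by (rule lmodule_homD)

lemma add: "x \<in> carrier M \<Longrightarrow> y \<in> carrier M \<Longrightarrow> f (x \<oplus>\<^bsub>M\<^esub> y) = f x \<oplus>\<^bsub>N\<^esub> f y"
  using hom by (rule lmodule_homD)

lemma smult: "a \<in> carrier A \<Longrightarrow> x \<in> carrier M \<Longrightarrow> f (a \<odot>\<^bsub>M\<^esub> x) = a \<odot>\<^bsub>N\<^esub> f x"
  using hom by (rule lmodule_homD)

lemma zero [simp]: "f \<zero>\<^bsub>M\<^esub> = \<zero>\<^bsub>N\<^esub>"
  using add[of "\<zero>\<^bsub>M\<^esub>" "\<zero>\<^bsub>M\<^esub>"] by (metis M.M.zero_closed M.M.l_zero N.M.add.r_cancel_one' closed)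

lemma minus: "x \<in> carrier M \<Longrightarrow> f (\<ominus>\<^bsub>M\<^esub> x) = \<ominus>\<^bsub>N\<^esub> f x"
  using add[of "\<ominus>\<^bsub>M\<^esub> x" x] by (simp add: M.M.l_neg N.M.minus_equality)

lemma diff: "x \<in> carrier M \<Longrightarrow> y \<in> carrier M \<Longrightarrow> f (x \<ominus>\<^bsub>M\<^esub> y) = f x \<ominus>\<^bsub>N\<^esub> f y"
  by (simp add: a_minus_def add minus)

lemma map_lin_comb: "a \<in> vecs A p \<Longrightarrow> y \<in> vecs M p \<Longrightarrow> f (lin_comb M p a y) = lin_comb N p a (\<lambda>i. f (y i))"
  by (induction p) (simp_all add: vecs_Suc add smult)

lemma eq_iff: "inj_on f (carrier M) \<Longrightarrow> x \<in> carrier M \<Longrightarrow> f x = \<zero>\<^bsub>N\<^esub> \<Longrightarrow> x = \<zero>\<^bsub>M\<^esub>"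
  using inj_onD[of f "carrier M" x "\<zero>\<^bsub>M\<^esub>"] by auto

end

lemmas lmodule_homoI = lmodule_homo.intro[OF _ _ lmodule_homo_axioms.intro]

text \<open>
  The homomorphism theorem, with the image in place of the quotient by the kernel.
\<close>

lemma (in lmodule_homo) factor_through_image:
  assumes L: "lmodule A L" and g: "g \<in> lmodule_hom A M L"
    and ker: "\<And>x. x \<in> carrier M \<Longrightarrow> f x = \<zero>\<^bsub>N\<^esub> \<Longrightarrow> g x = \<zero>\<^bsub>L\<^esub>"
  shows "\<exists>h\<in>lmodule_hom A (N\<lparr>carrier := f ` carrier M\<rparr>) L. \<forall>x\<in>carrier M. h (f x) = g x"
proof -
  interpret g: lmodule_homo A M L g by (rule lmodule_homoI[OF M.lmodule_axioms L g])
  define h where "h = (\<lambda>u. g (SOME x. x \<in> carrier M \<and> f x = u))"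
  have h: "h (f x) = g x" if x: "x \<in> carrier M" for x
  proof -
    define y where "y = (SOME y. y \<in> carrier M \<and> f y = f x)"
    have y: "y \<in> carrier M \<and> f y = f x" unfolding y_def by (rule someI[of _ x]) (use x in simp)
    have "g (y \<ominus>\<^bsub>M\<^esub> x) = \<zero>\<^bsub>L\<^esub>" using x y by (intro ker) (simp_all add: diff, simp add: a_minus_def N.M.r_neg)
    then have "g y = g x" using x y g.N.M.minus_eq_zeroD by (simp add: g.diff)
    then show ?thesis by (simp add: h_def y_def)
  qed
  have "h \<in> lmodule_hom A (N\<lparr>carrier := f ` carrier M\<rparr>) L"
    by (rule lmodule_homI) (auto simp: h add[symmetric] smult[symmetric] g.add g.smult)
  then show ?thesis using h by (intro bexI ballI)
qed

lemma submodule_iff: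
  assumes "lmodule A N"
  shows "submodule K A N \<longleftrightarrow> K \<subseteq> carrier N \<and> \<zero>\<^bsub>N\<^esub> \<in> K \<and>
    (\<forall>x\<in>K. \<forall>y\<in>K. x \<oplus>\<^bsub>N\<^esub> y \<in> K) \<and> (\<forall>a\<in>carrier A. \<forall>x\<in>K. a \<odot>\<^bsub>N\<^esub> x \<in> K)" (is "_ \<longleftrightarrow> ?r")
proof -
  interpret N: lmodule A N by fact
  show ?thesis
  proof
    assume "submodule K A N"
    then interpret K: submodule K A N .
    show ?r using K.subset K.m_closed K.one_closed K.smult_closed by auto
  next
    assume r: ?r
    have "\<ominus>\<^bsub>N\<^esub> x \<in> K" if "x \<in> K" for x
    proof -
      have "\<ominus>\<^bsub>N\<^esub> x = (\<ominus>\<^bsub>A\<^esub> \<one>\<^bsub>A\<^esub>) \<odot>\<^bsub>N\<^esub> x" using that r by (subst N.smult_minus_left) auto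
      then show ?thesis using that r by auto
    qed
    then have "subgroup K (add_monoid N)" using r
      by (intro subgroup.intro) (auto simp: a_inv_def[symmetric])
    then show "submodule K A N" using r
      by (auto simp: submodule_def submodule_axioms_def)
  qed
qed

locale lsubmodule = lmodule A N + sub: submodule K A N for A N K
begin

lemma sub_closed:
  shows "x \<in> K \<Longrightarrow> x \<in> carrier N" "\<zero>\<^bsub>N\<^esub> \<in> K" "x \<in> K \<Longrightarrow> y \<in> K \<Longrightarrow> x \<oplus>\<^bsub>N\<^esub> y \<in> K"
    "a \<in> carrier A \<Longrightarrow> x \<in> K \<Longrightarrow> a \<odot>\<^bsub>N\<^esub> x \<in> K"
  using submodule_iff[OF lmodule_axioms, of K] sub.submodule_axioms by auto

lemma minus_closed: "x \<in> K \<Longrightarrow> \<ominus>\<^bsub>N\<^esub> x \<in> K"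
  using sub.m_inv_closed by (auto simp: a_inv_def)

lemma diff_closed: "x \<in> K \<Longrightarrow> y \<in> K \<Longrightarrow> x \<ominus>\<^bsub>N\<^esub> y \<in> K"
  by (simp add: a_minus_def minus_closed sub_closed)

lemma lin_comb_in: "a \<in> vecs A p \<Longrightarrow> (\<And>i. i < p \<Longrightarrow> y i \<in> K) \<Longrightarrow> lin_comb N p a y \<in> K"
  by (induction p) (auto simp: vecs_Suc sub_closed)

lemma lmodule_sub: "lmodule A (N\<lparr>carrier := K\<rparr>)"
proof -
  have "abelian_group (N\<lparr>carrier := K\<rparr>)"
    by (rule abelian_groupI)
      (auto simp: M.a_ac sub_closed intro!: bexI[of _ "\<ominus>\<^bsub>N\<^esub> x" for x] minus_closed M.r_neg)
  then show ?thesis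
    by (intro lmodule.intro lmodule_axioms.intro R.ring_axioms)
      (auto simp: sub_closed smult_l_distr smult_r_distr smult_assoc1)
qed

end

lemma lsubmoduleI: "lmodule A N \<Longrightarrow> submodule K A N \<Longrightarrow> lsubmodule A N K"
  by (simp add: lsubmodule_def)

lemma lin_comb_restrict [simp]: "lin_comb (N\<lparr>carrier := K\<rparr>) p a y = lin_comb N p a y"
  by (induction p) auto

lemma lmodule_submodule: "lmodule A N \<Longrightarrow> submodule K A N \<Longrightarrow> lmodule A (N\<lparr>carrier := K\<rparr>)"
  by (rule lsubmodule.lmodule_sub) (rule lsubmoduleI)

lemma submodule_restrict_iff:
  assumes "lmodule A N" "submodule K A N"
  shows "submodule H A (N\<lparr>carrier := K\<rparr>) \<longleftrightarrow> submodule H A N \<and> H \<subseteq> K"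
proof -
  interpret lsubmodule A N K using assms by (rule lsubmoduleI)
  show ?thesis
    by (auto simp: submodule_iff[OF assms(1)] submodule_iff[OF lmodule_sub] sub_closed)
qed

lemma submodule_carrier: "lmodule A N \<Longrightarrow> submodule (carrier N) A N"
  by (auto simp: submodule_iff lmodule.smult_closed lmodule_def abelian_group_def
      abelian_monoid.zero_closed abelian_monoid.a_closed)

lemma submodule_zero: "lmodule A N \<Longrightarrow> submodule {\<zero>\<^bsub>N\<^esub>} A N"
  by (auto simp: submodule_iff lmodule.smult_zero_right lmodule_def abelian_group_def
      abelian_monoid.zero_closed abelian_monoid.l_zero)

lemma submodule_Int:
  "lmodule A N \<Longrightarrow> submodule K A N \<Longrightarrow> submodule L A N \<Longrightarrow> submodule (K \<inter> L) A N"
  by (auto simp: submodule_iff)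

context lmodule_homo
begin

lemma submodule_image: assumes "submodule K A M" shows "submodule (f ` K) A N"
proof -
  interpret K: lsubmodule A M K by (rule lsubmoduleI) (fact M.lmodule_axioms assms)+
  show ?thesis unfolding submodule_iff[OF N.lmodule_axioms]
    by (auto simp: add[symmetric] smult[symmetric] K.sub_closed intro!: imageI)
      (metis K.sub_closed(2) imageI zero)
qed

lemma submodule_vimage: assumes "submodule K A N" shows "submodule {x \<in> carrier M. f x \<in> K} A M"
proof -
  interpret K: lsubmodule A N K by (rule lsubmoduleI) (fact N.lmodule_axioms assms)+
  show ?thesis unfolding submodule_iff[OF M.lmodule_axioms]
    by (auto simp: add smult K.sub_closed)
qed

lemma submodule_ker: "submodule (lmodule_ker M N f) A M"
  using submodule_vimage[OF submodule_zero[OF N.lmodule_axioms]]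
  by (simp add: lmodule_ker_def)

end

section \<open>Finitely generated modules and noetherian rings\<close>

definition fg_sub :: "'a ring \<Rightarrow> ('a, 'm, 'c) module_scheme \<Rightarrow> 'm set \<Rightarrow> bool" where
  "fg_sub A N K \<longleftrightarrow> (\<exists>X. finite X \<and> X \<subseteq> K \<and> (\<forall>H. submodule H A N \<longrightarrow> X \<subseteq> H \<longrightarrow> K \<subseteq> H))"

text \<open>
  Submodules of the submodule \<open>K\<close> are submodules of \<open>N\<close>, so finite generation can be tested by all
  submodules of the ambient module. This form needs no linear combinations, which makes the lemmas on
  extensions and on triangular rings below short.
\<close>

lemma fg_lmodule_restrict_iff:
  assumes "lmodule A N" "submodule K A N"
  shows "fg_lmodule A (N\<lparr>carrier := K\<rparr>) \<longleftrightarrow> fg_sub A N K"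
proof -
  have "(\<lambda>H. submodule H A N \<and> H \<subseteq> K) hull X = K \<longleftrightarrow> (\<forall>H. submodule H A N \<longrightarrow> X \<subseteq> H \<longrightarrow> K \<subseteq> H)"
    if "X \<subseteq> K" for X
  proof -
    have "(\<forall>H. submodule H A N \<longrightarrow> X \<subseteq> H \<longrightarrow> K \<subseteq> H) \<longleftrightarrow>
      (\<forall>H. submodule H A N \<longrightarrow> H \<subseteq> K \<longrightarrow> X \<subseteq> H \<longrightarrow> K \<subseteq> H)"
      using submodule_Int[OF assms(1) _ assms(2)] that by (metis Int_subset_iff Int_lower2)
    then show ?thesis using that assms(2) unfolding hull_def by blast
  qed
  then show ?thesis
    unfolding fg_lmodule_def fg_sub_def submodule_restrict_iff[OF assms]
    by auto
qed

lemma fg_sub_restrict_iff: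
  assumes "lmodule A N" "submodule K A N" "submodule L A N" "L \<subseteq> K"
  shows "fg_sub A (N\<lparr>carrier := K\<rparr>) L \<longleftrightarrow> fg_sub A N L"
proof -
  have "submodule L A (N\<lparr>carrier := K\<rparr>)" using assms by (simp add: submodule_restrict_iff)
  then show ?thesis
    using fg_lmodule_restrict_iff[OF lmodule_submodule[OF assms(1,2)], of L]
      fg_lmodule_restrict_iff[OF assms(1,3)] by simp
qed

lemma fg_lmodule_iff: "lmodule A N \<Longrightarrow> fg_lmodule A N \<longleftrightarrow> fg_sub A N (carrier N)"
  using fg_lmodule_restrict_iff[OF _ submodule_carrier, of A N] by simp

lemma left_noetherian_iff:
  "ring A \<Longrightarrow> left_noetherian A \<longleftrightarrow> (\<forall>I. submodule I A (regular A) \<longrightarrow> fg_sub A (regular A) I)"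
  by (auto simp: left_noetherian_def fg_lmodule_restrict_iff lmodule_regular)

lemma (in lmodule) submodule_span:
  assumes "g \<in> vecs M p" shows "submodule ((\<lambda>a. lin_comb M p a g) ` vecs R p) R M"
  unfolding submodule_iff[OF lmodule_axioms]
proof (intro conjI ballI)
  show "\<zero>\<^bsub>M\<^esub> \<in> (\<lambda>a. lin_comb M p a g) ` vecs R p" using lin_comb_zero_left[OF assms]
    by (metis (mono_tags, lifting) Pi_I R.zero_closed imageI)
next
  fix x y assume "x \<in> (\<lambda>a. lin_comb M p a g) ` vecs R p" "y \<in> (\<lambda>a. lin_comb M p a g) ` vecs R p"
  then obtain a b where ab: "a \<in> vecs R p" "b \<in> vecs R p" "x = lin_comb M p a g" "y = lin_comb M p b g" by blast
  then have "x \<oplus>\<^bsub>M\<^esub> y = lin_comb M p (\<lambda>i. a i \<oplus> b i) g" using assms by (simp add: lin_comb_add_left)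
  moreover have "(\<lambda>i. a i \<oplus> b i) \<in> vecs R p" using ab by (auto simp: Pi_def)
  ultimately show "x \<oplus>\<^bsub>M\<^esub> y \<in> (\<lambda>a. lin_comb M p a g) ` vecs R p" by blast
next
  fix c x assume c: "c \<in> carrier R" "x \<in> (\<lambda>a. lin_comb M p a g) ` vecs R p"
  then obtain a where a: "a \<in> vecs R p" "x = lin_comb M p a g" by blast
  then have "c \<odot>\<^bsub>M\<^esub> x = lin_comb M p (\<lambda>i. c \<otimes> a i) g" using assms c by (simp add: lin_comb_smult)
  moreover have "(\<lambda>i. c \<otimes> a i) \<in> vecs R p" using a c by (auto simp: Pi_def)
  ultimately show "c \<odot>\<^bsub>M\<^esub> x \<in> (\<lambda>a. lin_comb M p a g) ` vecs R p" by blast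
qed (use assms in auto)

lemma fg_sub_span:
  assumes "lmodule A N" "submodule K A N" "fg_sub A N K"
  obtains p g where "\<And>i. i < p \<Longrightarrow> g i \<in> K" "K = (\<lambda>a. lin_comb N p a g) ` vecs A p"
proof -
  interpret lsubmodule A N K using assms by (intro lsubmoduleI)
  obtain X where X: "finite X" "X \<subseteq> K" "\<And>H. submodule H A N \<Longrightarrow> X \<subseteq> H \<Longrightarrow> K \<subseteq> H"
    using assms(3) unfolding fg_sub_def by blast
  obtain g and p :: nat where g: "X = g ` {i. i < p}"
    using finite_imp_nat_seg_image_inj_on[OF X(1)] by metis
  have gK: "\<And>i. i < p \<Longrightarrow> g i \<in> K" using g X(2) by auto
  then have gN: "g \<in> vecs N p" using sub_closed(1) by blast
  have "X \<subseteq> (\<lambda>a. lin_comb N p a g) ` vecs A p"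
  proof
    fix x assume "x \<in> X"
    then obtain i where i: "i < p" "x = g i" using g by auto
    then have "x = lin_comb N p (unit_vec A i) g" using gN by (simp add: lin_comb_unit_vec)
    then show "x \<in> (\<lambda>a. lin_comb N p a g) ` vecs A p" by auto
  qed
  then have "K \<subseteq> (\<lambda>a. lin_comb N p a g) ` vecs A p" using X(3)[OF submodule_span[OF gN]] by blast
  moreover have "(\<lambda>a. lin_comb N p a g) ` vecs A p \<subseteq> K" using gK by (auto intro: lin_comb_in)
  ultimately show ?thesis using that gK by blast
qed

lemma fg_sub_span_ex:
  assumes "lmodule A N" "submodule K A N" "fg_sub A N K"
  shows "\<exists>p g. (\<forall>i<p. g i \<in> K) \<and> K = (\<lambda>a. lin_comb N p a g) ` vecs A p"
proof (rule fg_sub_span[OF assms])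
  fix p g assume "\<And>i. i < p \<Longrightarrow> g i \<in> K" and K: "K = (\<lambda>a. lin_comb N p a g) ` vecs A p"
  then have "\<forall>i<p. g i \<in> K" by (intro allI impI)
  with K show ?thesis by (intro exI conjI)
qed

definition noetherian_lmodule :: "'a ring \<Rightarrow> ('a, 'm, 'c) module_scheme \<Rightarrow> bool" where
  "noetherian_lmodule A N \<longleftrightarrow> (\<forall>K. submodule K A N \<longrightarrow> fg_sub A N K)"

text \<open>
  Generators of the kernel part together with preimages of generators of the image: an element of \<open>K\<close>
  differs from a combination of the latter by an element of the kernel.
\<close>

lemma (in lmodule_homo) fg_sub_extension:
  assumes K: "submodule K A M" and "fg_sub A N (f ` K)" "fg_sub A M (K \<inter> lmodule_ker M N f)"
  shows "fg_sub A M K"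
proof -
  interpret K: lsubmodule A M K by (rule lsubmoduleI) (fact M.lmodule_axioms assms)+
  obtain X where X: "finite X" "X \<subseteq> f ` K" "\<And>H. submodule H A N \<Longrightarrow> X \<subseteq> H \<Longrightarrow> f ` K \<subseteq> H"
    using assms(2) unfolding fg_sub_def by blast
  obtain Y where Y: "finite Y" "Y \<subseteq> K \<inter> lmodule_ker M N f"
    "\<And>H. submodule H A M \<Longrightarrow> Y \<subseteq> H \<Longrightarrow> K \<inter> lmodule_ker M N f \<subseteq> H"
    using assms(3) unfolding fg_sub_def by blast
  obtain X' where X': "X' \<subseteq> K" "finite X'" "X = f ` X'"
    using finite_subset_image[OF X(1,2)] by blast
  show ?thesis unfolding fg_sub_def
  proof (intro exI[of _ "X' \<union> Y"] conjI allI impI subsetI)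
    fix H x assume H: "submodule H A M" "X' \<union> Y \<subseteq> H" and x: "x \<in> K"
    have sub: "submodule (H \<inter> K) A M" by (rule submodule_Int) (fact M.lmodule_axioms H K)+
    interpret H: lsubmodule A M "H \<inter> K" by (rule lsubmoduleI) (fact M.lmodule_axioms sub)+
    have "f ` K \<subseteq> f ` (H \<inter> K)" using X(3)[OF submodule_image[OF sub]] X' H by blast
    then obtain h where h: "h \<in> H" "h \<in> K" "f x = f h" using x by blast
    then have "x \<ominus>\<^bsub>M\<^esub> h \<in> K \<inter> lmodule_ker M N f"
      using x K.sub_closed(1) K.diff_closed[of x h]
      by (simp add: lmodule_ker_def diff) (simp add: a_minus_def N.M.r_neg)
    then have "x \<ominus>\<^bsub>M\<^esub> h \<in> H \<inter> K" using Y(3)[OF sub] Y(2) H by blast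
    then have "(x \<ominus>\<^bsub>M\<^esub> h) \<oplus>\<^bsub>M\<^esub> h \<in> H \<inter> K" using h H.sub_closed(3) by blast
    moreover have "(x \<ominus>\<^bsub>M\<^esub> h) \<oplus>\<^bsub>M\<^esub> h = x"
      using x h K.sub_closed(1) by (simp add: a_minus_def M.M.a_assoc M.M.l_neg)
    ultimately show "x \<in> H" by simp
  qed (use X' Y in auto)
qed

lemma (in lmodule_homo) fg_sub_image:
  assumes "submodule K A M" "fg_sub A M K" shows "fg_sub A N (f ` K)"
proof -
  obtain X where X: "finite X" "X \<subseteq> K" "\<And>H. submodule H A M \<Longrightarrow> X \<subseteq> H \<Longrightarrow> K \<subseteq> H"
    using assms(2) unfolding fg_sub_def by blast
  have "K \<subseteq> carrier M" using assms(1) by (simp add: submodule_iff[OF M.lmodule_axioms])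
  show ?thesis unfolding fg_sub_def
  proof (intro exI[of _ "f ` X"] conjI allI impI)
    fix H assume H: "submodule H A N" "f ` X \<subseteq> H"
    have "K \<subseteq> {x \<in> carrier M. f x \<in> H}"
      using X(3)[OF submodule_vimage[OF H(1)]] X(2) H(2) \<open>K \<subseteq> carrier M\<close> by blast
    then show "f ` K \<subseteq> H" by blast
  qed (use X in auto)
qed

text \<open>
  For \<open>V = regular A\<close> this is the free module on \<open>X\<close>; with \<open>X = {..<p}\<close> it is the module of row vectors.
  Functions vanish off \<open>X\<close>, so that equality of elements is equality of functions.
\<close>

definition fsupp :: "'x set \<Rightarrow> ('a, 'v) module \<Rightarrow> ('a, 'x \<Rightarrow> 'v) module" where
  "fsupp X V = \<lparr>carrier = {f. (\<forall>x. f x \<in> carrier V) \<and> finite {x. f x \<noteq> \<zero>\<^bsub>V\<^esub>} \<and> (\<forall>x. x \<notin> X \<longrightarrow> f x = \<zero>\<^bsub>V\<^esub>)},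
     monoid.mult = undefined, one = undefined, zero = (\<lambda>x. \<zero>\<^bsub>V\<^esub>), add = (\<lambda>f g x. f x \<oplus>\<^bsub>V\<^esub> g x),
     smult = (\<lambda>a f x. a \<odot>\<^bsub>V\<^esub> f x)\<rparr>"

lemma fsupp_simps [simp]:
  "zero (fsupp X V) = (\<lambda>x. \<zero>\<^bsub>V\<^esub>)" "f \<oplus>\<^bsub>fsupp X V\<^esub> g = (\<lambda>x. f x \<oplus>\<^bsub>V\<^esub> g x)"
  "a \<odot>\<^bsub>fsupp X V\<^esub> f = (\<lambda>x. a \<odot>\<^bsub>V\<^esub> f x)"
  by (auto simp: fsupp_def)

lemma fsupp_carrier:
  "f \<in> carrier (fsupp X V) \<longleftrightarrow>
     (\<forall>x. f x \<in> carrier V) \<and> finite {x. f x \<noteq> \<zero>\<^bsub>V\<^esub>} \<and> (\<forall>x. x \<notin> X \<longrightarrow> f x = \<zero>\<^bsub>V\<^esub>)"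
  by (auto simp: fsupp_def)

lemma lmodule_fsupp:
  assumes "lmodule A V" shows "lmodule A (fsupp X V)"
proof -
  interpret V: lmodule A V by fact
  have fin: "finite {x. f x \<oplus>\<^bsub>V\<^esub> g x \<noteq> \<zero>\<^bsub>V\<^esub>}"
    if "finite {x. f x \<noteq> \<zero>\<^bsub>V\<^esub>}" "finite {x. g x \<noteq> \<zero>\<^bsub>V\<^esub>}" for f g
    using that by (rule_tac finite_subset[of _ "{x. f x \<noteq> \<zero>\<^bsub>V\<^esub>} \<union> {x. g x \<noteq> \<zero>\<^bsub>V\<^esub>}"]) auto
  have fin': "finite {x. h (f x) \<noteq> \<zero>\<^bsub>V\<^esub>}"
    if "finite {x. f x \<noteq> \<zero>\<^bsub>V\<^esub>}" "h \<zero>\<^bsub>V\<^esub> = \<zero>\<^bsub>V\<^esub>" for f h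
    using that by (rule_tac finite_subset[of _ "{x. f x \<noteq> \<zero>\<^bsub>V\<^esub>}"]) auto
  have "abelian_group (fsupp X V)"
  proof (rule abelian_groupI)
    fix f assume "f \<in> carrier (fsupp X V)"
    then show "\<exists>y\<in>carrier (fsupp X V). y \<oplus>\<^bsub>fsupp X V\<^esub> f = \<zero>\<^bsub>fsupp X V\<^esub>"
      by (intro bexI[of _ "\<lambda>x. \<ominus>\<^bsub>V\<^esub> f x"]) (auto simp: fsupp_carrier V.M.l_neg fin')
  next
    fix f g assume "f \<in> carrier (fsupp X V)" "g \<in> carrier (fsupp X V)"
    then show "f \<oplus>\<^bsub>fsupp X V\<^esub> g \<in> carrier (fsupp X V)" by (simp add: fsupp_carrier fin)
  qed (auto simp: fsupp_carrier V.M.a_ac)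
  then show ?thesis
    by (intro lmodule.intro lmodule_axioms.intro V.R.ring_axioms)
      (auto simp: fsupp_carrier V.smult_l_distr V.smult_r_distr V.smult_assoc1 fin')
qed

abbreviation free_mod :: "'a ring \<Rightarrow> nat \<Rightarrow> ('a, nat \<Rightarrow> 'a) module" where
  "free_mod A p \<equiv> fsupp {..<p} (regular A)"

lemma free_mod_carrier: "x \<in> carrier (free_mod A p) \<longleftrightarrow> (\<forall>i. x i \<in> carrier A) \<and> (\<forall>i\<ge>p. x i = \<zero>\<^bsub>A\<^esub>)"
proof -
  have "finite {i. x i \<noteq> \<zero>\<^bsub>A\<^esub>}" if "\<forall>i\<ge>p. x i = \<zero>\<^bsub>A\<^esub>"
  proof (rule finite_subset)
    show "{i. x i \<noteq> \<zero>\<^bsub>A\<^esub>} \<subseteq> {..<p}" using that not_le_imp_less by auto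
  qed simp
  then show ?thesis by (auto simp: fsupp_carrier)
qed

lemma lmodule_free_mod: "ring A \<Longrightarrow> lmodule A (free_mod A p)"
  by (simp add: lmodule_fsupp lmodule_regular)

definition cut_vec :: "'a ring \<Rightarrow> nat \<Rightarrow> (nat \<Rightarrow> 'a) \<Rightarrow> nat \<Rightarrow> 'a" where
  "cut_vec A p x = (\<lambda>i. if i < p then x i else \<zero>\<^bsub>A\<^esub>)"

lemma cut_vec_closed: "ring A \<Longrightarrow> x \<in> vecs A p \<Longrightarrow> cut_vec A p x \<in> carrier (free_mod A p)"
  by (auto simp: free_mod_carrier cut_vec_def ring.ring_simprules)

text \<open>
  Induction on the rank: the last coordinate is a homomorphism to \<open>A\<close> whose kernel is the free module of
  one rank less.
\<close>

lemma noetherian_free_mod: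
  assumes "ring A" "left_noetherian A" shows "noetherian_lmodule A (free_mod A p)"
proof (induction p)
  case 0
  interpret lmodule A "free_mod A 0" by (rule lmodule_free_mod) fact
  have "carrier (free_mod A 0) = {\<zero>\<^bsub>free_mod A 0\<^esub>}"
    using assms(1) by (auto simp: fsupp_carrier ring.ring_simprules)
  then show ?case unfolding noetherian_lmodule_def fg_sub_def submodule_iff[OF lmodule_axioms]
    by (metis empty_iff empty_subsetI finite.emptyI order_trans singletonD subsetI)
next
  case (Suc p)
  interpret A: ring A by fact
  let ?F = "free_mod A (Suc p)"
  interpret h: lmodule_homo A ?F "regular A" "\<lambda>x. x p"
    by (intro lmodule_homoI lmodule_free_mod lmodule_regular assms lmodule_homI)
      (auto simp: free_mod_carrier)
  have ker: "lmodule_ker ?F (regular A) (\<lambda>x. x p) = carrier (free_mod A p)"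
    by (auto simp: lmodule_ker_def free_mod_carrier)
      (metis le_antisym not_less_eq_eq)
  have eq: "free_mod A p = ?F\<lparr>carrier := carrier (free_mod A p)\<rparr>" by (simp add: fsupp_def)
  have sub: "submodule (carrier (free_mod A p)) A ?F" using h.submodule_ker unfolding ker .
  have "fg_sub A ?F K" if K: "submodule K A ?F" for K
  proof (rule h.fg_sub_extension[OF K])
    show "fg_sub A (regular A) ((\<lambda>x. x p) ` K)"
      using assms h.submodule_image[OF K] by (simp add: left_noetherian_iff)
    let ?L = "K \<inter> lmodule_ker ?F (regular A) (\<lambda>x. x p)"
    have L: "submodule ?L A ?F" by (intro submodule_Int h.M.lmodule_axioms K h.submodule_ker)
    moreover have "?L \<subseteq> carrier (free_mod A p)" using ker by blast
    ultimately have "submodule ?L A (free_mod A p)"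
      using submodule_restrict_iff[OF h.M.lmodule_axioms sub] eq by metis
    then have "fg_sub A (free_mod A p) ?L" using Suc unfolding noetherian_lmodule_def by blast
    then show "fg_sub A ?F ?L"
      using fg_sub_restrict_iff[OF h.M.lmodule_axioms sub L \<open>?L \<subseteq> _\<close>] eq by metis
  qed
  then show ?case unfolding noetherian_lmodule_def by blast
qed

lemma unit_vec_free_mod: "ring A \<Longrightarrow> i < p \<Longrightarrow> unit_vec A i \<in> carrier (free_mod A p)"
  by (auto simp: free_mod_carrier unit_vec_def ring.ring_simprules)

lemma lin_comb_hom:
  assumes "lmodule A N" "g \<in> vecs N p" shows "(\<lambda>x. lin_comb N p x g) \<in> lmodule_hom A (free_mod A p) N"
proof -
  interpret N: lmodule A N by fact
  show ?thesis using assms(2)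
    by (intro lmodule_homI)
      (auto simp: free_mod_carrier N.lin_comb_add_left N.lin_comb_smult)
qed

lemma free_mod_expand:
  assumes "ring A" "x \<in> carrier (free_mod A p)"
  shows "lin_comb (free_mod A p) p x (unit_vec A) = x"
proof -
  interpret A: ring A by fact
  have "lin_comb (free_mod A p) m x (unit_vec A) = cut_vec A m x" for m
  proof (induction m)
    case (Suc m)
    then show ?case using assms(2)
      by (auto simp: cut_vec_def unit_vec_def fun_eq_iff less_Suc_eq free_mod_carrier)
  qed (simp add: cut_vec_def)
  then show ?thesis using assms(2)
    by (auto simp: cut_vec_def fun_eq_iff free_mod_carrier)
qed

lemma free_mod_lin_comb_eval:
  assumes A: "ring A" and x: "x \<in> vecs A q" and E: "\<And>i. i < q \<Longrightarrow> E i \<in> carrier (free_mod A p)"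
  shows "lin_comb (free_mod A p) q x E = (\<lambda>j. if j < p then lin_comb (regular A) q x (\<lambda>i. E i j) else \<zero>\<^bsub>A\<^esub>)"
proof -
  interpret Free: lmodule A "free_mod A p" by (rule lmodule_free_mod[OF A])
  have ev: "lin_comb (free_mod A p) m x E j = lin_comb (regular A) m x (\<lambda>i. E i j)" for m j by (induction m) auto
  have "lin_comb (free_mod A p) q x E \<in> carrier (free_mod A p)" by (rule Free.lin_comb_closed[OF x]) (use E in auto)
  then show ?thesis by (auto simp: fun_eq_iff free_mod_carrier ev[symmetric])
qed

lemma lin_comb_cut_vec [simp]: "lin_comb N p (cut_vec A p x) y = lin_comb N p x y"
  by (rule lin_comb_cong) (auto simp: cut_vec_def)

lemma fg_imp_noetherian:
  assumes "ring A" "left_noetherian A" "lmodule A N" "fg_sub A N (carrier N)"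
  shows "noetherian_lmodule A N"
  unfolding noetherian_lmodule_def
proof (intro allI impI)
  fix K assume K: "submodule K A N"
  interpret N: lmodule A N by fact
  obtain p g where g: "\<And>i. i < p \<Longrightarrow> g i \<in> carrier N" "carrier N = (\<lambda>a. lin_comb N p a g) ` vecs A p"
    using fg_sub_span[OF assms(3) submodule_carrier[OF assms(3)] assms(4)] by blast
  interpret h: lmodule_homo A "free_mod A p" N "\<lambda>x. lin_comb N p x g"
    using g(1) by (intro lmodule_homoI lmodule_free_mod assms lin_comb_hom) auto
  let ?H = "{x \<in> carrier (free_mod A p). lin_comb N p x g \<in> K}"
  have "fg_sub A N ((\<lambda>x. lin_comb N p x g) ` ?H)"
    using noetherian_free_mod[OF assms(1,2)]
    by (intro h.fg_sub_image h.submodule_vimage K) (auto simp: noetherian_lmodule_def h.submodule_vimage K)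
  moreover have "(\<lambda>x. lin_comb N p x g) ` ?H = K"
  proof -
    have "\<exists>x\<in>carrier (free_mod A p). y = lin_comb N p x g" if "y \<in> K" for y
    proof -
      have "y \<in> carrier N" using that K by (auto simp: submodule_iff[OF assms(3)])
      then obtain a where a: "a \<in> vecs A p" "y = lin_comb N p a g" using g(2) by auto
      then have "y = lin_comb N p (cut_vec A p a) g" by (auto simp: cut_vec_def intro: lin_comb_cong)
      then show ?thesis using cut_vec_closed[OF assms(1) a(1)] by blast
    qed
    then show ?thesis by blast
  qed
  ultimately show "fg_sub A N K" by simp
qed

section \<open>Exactness of matrices\<close>

text \<open>
  The matrices \<open>E\<close> of size \<open>q \<times> p\<close> and \<open>F\<close> of size \<open>r \<times> q\<close> act on columns \<open>N\<^sup>p \<rightarrow> N\<^sup>q \<rightarrow> N\<^sup>r\<close>. Only the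
  inclusion of the kernel in the image is recorded here; the other one is \<open>prod_zero\<close>, which does not
  depend on \<open>N\<close>.
\<close>

definition col_exact :: "('a, 'm, 'c) module_scheme \<Rightarrow> nat \<Rightarrow> nat \<Rightarrow> nat \<Rightarrow> (nat \<Rightarrow> nat \<Rightarrow> 'a) \<Rightarrow> (nat \<Rightarrow> nat \<Rightarrow> 'a) \<Rightarrow> bool" where
  "col_exact N p q r E F \<longleftrightarrow> (\<forall>y\<in>vecs N q. (\<forall>i<r. lin_comb N q (F i) y = \<zero>\<^bsub>N\<^esub>) \<longrightarrow>
     (\<exists>z\<in>vecs N p. \<forall>i<q. y i = lin_comb N p (E i) z))"

definition transp :: "(nat \<Rightarrow> nat \<Rightarrow> 'a) \<Rightarrow> nat \<Rightarrow> nat \<Rightarrow> 'a" where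
  "transp E = (\<lambda>i j. E j i)"

lemma transp_transp [simp]: "transp (transp E) = E" by (simp add: transp_def)

lemma transp_mats: "E \<in> mats A q p \<Longrightarrow> transp E \<in> mats A p q" by (auto simp: transp_def)

text \<open>
  Exactness of \<open>A\<^sup>r \<rightarrow> A\<^sup>q \<rightarrow> A\<^sup>p\<close> on row vectors, defined as exactness of the transposed matrices on columns
  over the opposite ring.
\<close>

definition row_exact :: "'a ring \<Rightarrow> nat \<Rightarrow> nat \<Rightarrow> nat \<Rightarrow> (nat \<Rightarrow> nat \<Rightarrow> 'a) \<Rightarrow> (nat \<Rightarrow> nat \<Rightarrow> 'a) \<Rightarrow> bool" where
  "row_exact A r q p F E \<longleftrightarrow> col_exact (regular (op_ring A)) r q p (transp F) (transp E)"

lemma row_exact_iff: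
  "row_exact A r q p F E \<longleftrightarrow> (\<forall>x\<in>vecs A q. (\<forall>j<p. lin_comb (regular A) q x (\<lambda>i. E i j) = \<zero>\<^bsub>A\<^esub>) \<longrightarrow>
     (\<exists>w\<in>vecs A r. \<forall>i<q. x i = lin_comb (regular A) r w (\<lambda>l. F l i)))"
  by (simp add: row_exact_def col_exact_def lin_comb_op transp_def)

definition prod_zero :: "'a ring \<Rightarrow> nat \<Rightarrow> nat \<Rightarrow> nat \<Rightarrow> (nat \<Rightarrow> nat \<Rightarrow> 'a) \<Rightarrow> (nat \<Rightarrow> nat \<Rightarrow> 'a) \<Rightarrow> bool" where
  "prod_zero A r q p F E \<longleftrightarrow> (\<forall>i<r. \<forall>j<p. lin_comb (regular A) q (F i) (\<lambda>l. E l j) = \<zero>\<^bsub>A\<^esub>)"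

abbreviation col_exact_at :: "('a, 'm, 'c) module_scheme \<Rightarrow> (nat \<Rightarrow> nat) \<Rightarrow> (nat \<Rightarrow> nat \<Rightarrow> nat \<Rightarrow> 'a) \<Rightarrow> nat \<Rightarrow> bool" where
  "col_exact_at N k D i \<equiv> col_exact N (k i) (k (Suc i)) (k (Suc (Suc i))) (D i) (D (Suc i))"

lemma prod_zero_op: "prod_zero (op_ring A) p q r (transp E) (transp F) \<longleftrightarrow> prod_zero A r q p F E"
  by (auto simp: prod_zero_def transp_def lin_comb_op)

lemma matsD: "E \<in> mats A q p \<Longrightarrow> i < q \<Longrightarrow> E i \<in> vecs A p"
  by (auto simp: Pi_def)

lemma mats_col: "E \<in> mats A q p \<Longrightarrow> j < p \<Longrightarrow> (\<lambda>i. E i j) \<in> vecs A q"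
  by (auto simp: Pi_def)

lemma prod_zero_apply:
  assumes "lmodule A N" "prod_zero A r q p F E" "F \<in> mats A r q" "E \<in> mats A q p" "z \<in> vecs N p" "i < r"
  shows "lin_comb N q (F i) (\<lambda>l. lin_comb N p (E l) z) = \<zero>\<^bsub>N\<^esub>"
proof -
  interpret N: lmodule A N by fact
  have "lin_comb N q (F i) (\<lambda>l. lin_comb N p (E l) z) = lin_comb N p (\<lambda>j. lin_comb (regular A) q (F i) (\<lambda>l. E l j)) z"
    using assms matsD[OF assms(3,6)] by (intro lin_comb_assoc) auto
  also have "\<dots> = \<zero>\<^bsub>N\<^esub>" using assms by (intro N.lin_comb_zero_left') (auto simp: prod_zero_def)
  finally show ?thesis .
qed

lemma col_exactD:
  assumes "col_exact N p q r E F" "y \<in> vecs N q" "\<And>i. i < r \<Longrightarrow> lin_comb N q (F i) y = \<zero>\<^bsub>N\<^esub>"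
  obtains z where "z \<in> vecs N p" "\<And>i. i < q \<Longrightarrow> y i = lin_comb N p (E i) z"
  using assms unfolding col_exact_def by blast

lemma row_exactD:
  assumes "row_exact A r q p F E" "x \<in> vecs A q" "\<And>j. j < p \<Longrightarrow> lin_comb (regular A) q x (\<lambda>i. E i j) = \<zero>\<^bsub>A\<^esub>"
  obtains w where "w \<in> vecs A r" "\<And>i. i < q \<Longrightarrow> x i = lin_comb (regular A) r w (\<lambda>l. F l i)"
  using assms unfolding row_exact_iff by blast

text \<open>
  Rows of length \<open>k (n + 1)\<close> are sent to rows of length \<open>k n\<close> by multiplication with \<open>D n\<close> from the right. These
  homomorphisms of left modules resolve the cokernel of \<open>D 0\<close>.
\<close>

definition free_res :: "'a ring \<Rightarrow> (nat \<Rightarrow> nat) \<Rightarrow> (nat \<Rightarrow> nat \<Rightarrow> nat \<Rightarrow> 'a) \<Rightarrow> bool" where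
  "free_res A k D \<longleftrightarrow> (\<forall>n. D n \<in> mats A (k (Suc n)) (k n) \<and>
     prod_zero A (k (Suc (Suc n))) (k (Suc n)) (k n) (D (Suc n)) (D n) \<and>
     row_exact A (k (Suc (Suc n))) (k (Suc n)) (k n) (D (Suc n)) (D n))"

lemma free_resD:
  assumes "free_res A k D"
  shows "D n \<in> mats A (k (Suc n)) (k n)"
    "prod_zero A (k (Suc (Suc n))) (k (Suc n)) (k n) (D (Suc n)) (D n)"
    "row_exact A (k (Suc (Suc n))) (k (Suc n)) (k n) (D (Suc n)) (D n)"
  using assms by (auto simp: free_res_def)

lemma free_res_shift: "free_res A k D \<Longrightarrow> free_res A (\<lambda>i. k (i + m)) (\<lambda>i. D (i + m))"
  by (simp add: free_res_def)

text \<open>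
  Applying \<open>Hom(-, N)\<close> to a free resolution of \<open>X\<close> gives the complex of columns over \<open>N\<close>, whose homology
  between \<open>D i\<close> and \<open>D (i + 1)\<close> is \<open>Ext(X, N)\<close> in degree \<open>i + 1\<close>. So over a left noetherian ring this says that the injective dimension of
  \<open>N\<close> is at most \<open>n\<close>.
\<close>

definition ext_vanishes :: "'a ring \<Rightarrow> ('a, 'm, 'c) module_scheme \<Rightarrow> nat \<Rightarrow> bool" where
  "ext_vanishes A N n \<longleftrightarrow> (\<forall>k D i. free_res A k D \<longrightarrow> i \<ge> n \<longrightarrow>
     col_exact_at N k D i)"

lemma ext_vanishesD: "ext_vanishes A N n \<Longrightarrow> free_res A k D \<Longrightarrow> i \<ge> n \<Longrightarrow>
   col_exact_at N k D i"
  by (simp add: ext_vanishes_def)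

lemma ext_vanishes_mono: "ext_vanishes A N n \<Longrightarrow> n \<le> m \<Longrightarrow> ext_vanishes A N m"
  by (simp add: ext_vanishes_def)

lemma row_kernel_fg:
  assumes "ring A" "left_noetherian A" "E \<in> mats A q p"
  obtains r F where "F \<in> mats A r q" "prod_zero A r q p F E" "row_exact A r q p F E"
proof -
  interpret A: ring A by fact
  interpret Reg: lmodule A "regular A" by (rule lmodule_regular) fact
  interpret Free: lmodule A "free_mod A q" by (rule lmodule_free_mod) fact
  let ?K = "{x \<in> carrier (free_mod A q). \<forall>j<p. lin_comb (regular A) q x (\<lambda>i. E i j) = \<zero>\<^bsub>A\<^esub>}"
  have col: "(\<lambda>i. E i j) \<in> vecs (regular A) q" if "j < p" for j using mats_col[OF assms(3) that] by simp
  have K: "submodule ?K A (free_mod A q)" unfolding submodule_iff[OF Free.lmodule_axioms]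
    using col Reg.lin_comb_zero_left Reg.lin_comb_add_left Reg.lin_comb_smult
    by (auto simp: free_mod_carrier)
  obtain r F where F: "\<And>i. i < r \<Longrightarrow> F i \<in> ?K" "?K = (\<lambda>a. lin_comb (free_mod A q) r a F) ` vecs A r"
    using fg_sub_span[OF Free.lmodule_axioms K] noetherian_free_mod[OF assms(1,2)] K
    unfolding noetherian_lmodule_def by (smt (verit, best))
  have ev: "lin_comb (free_mod A q) r a F i = lin_comb (regular A) r a (\<lambda>l. F l i)" for a i r
    by (induction r) auto
  show ?thesis
  proof
    show "F \<in> mats A r q" "prod_zero A r q p F E"
      using F(1) by (auto simp: free_mod_carrier prod_zero_def)
    show "row_exact A r q p F E" unfolding row_exact_iff
    proof (intro ballI impI)
      fix x assume x: "x \<in> vecs A q" "\<forall>j<p. lin_comb (regular A) q x (\<lambda>i. E i j) = \<zero>\<^bsub>A\<^esub>"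
      have "lin_comb (regular A) q (cut_vec A q x) (\<lambda>i. E i j) = lin_comb (regular A) q x (\<lambda>i. E i j)" for j
        by (rule lin_comb_cong) (auto simp: cut_vec_def)
      then have "cut_vec A q x \<in> ?K" using x cut_vec_closed[OF assms(1)] by auto
      then obtain w where w: "w \<in> vecs A r" "cut_vec A q x = lin_comb (free_mod A q) r w F" using F(2) by blast
      have "x i = lin_comb (regular A) r w (\<lambda>l. F l i)" if "i < q" for i
        using that fun_cong[OF w(2), of i] by (simp add: ev cut_vec_def)
      then show "\<exists>w\<in>vecs A r. \<forall>i<q. x i = lin_comb (regular A) r w (\<lambda>l. F l i)" using w by blast
    qed
  qed
qed

lemma free_res_exists:
  assumes "ring A" "left_noetherian A" "E \<in> mats A q p"
  obtains k D where "free_res A k D" "k 0 = p" "k 1 = q" "D 0 = E"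
proof -
  define P where "P = (\<lambda>(n::nat) (p', q', E'). E' \<in> mats A q' p' \<and> (n = 0 \<longrightarrow> (p', q', E') = (p, q, E)))"
  define Q where "Q = (\<lambda>(n::nat) (p::nat, q::nat, E) (p'::nat, r::nat, F). p' = q \<and> prod_zero A r q p F E \<and> row_exact A r q p F E)"
  have "\<exists>f. \<forall>n. P n (f n) \<and> Q n (f n) (f (Suc n))"
  proof (rule dependent_nat_choice)
    show "\<exists>x. P 0 x" using assms(3) by (auto simp: P_def)
  next
    fix x and n :: nat
    assume Pn: "P n x"
    obtain p' q' E' where x: "x = (p', q', E')" by (cases x)
    have E': "E' \<in> mats A q' p'" using Pn unfolding P_def x by simp
    obtain r F where F: "F \<in> mats A r q'" "prod_zero A r q' p' F E'" "row_exact A r q' p' F E'"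
      by (rule row_kernel_fg[OF assms(1,2) E'])
    show "\<exists>y. P (Suc n) y \<and> Q n x y"
      unfolding P_def Q_def x prod.case using F by (intro exI[of _ "(q', r, F)"]) simp
  qed
  then obtain f where f: "\<And>n. P n (f n)" "\<And>n. Q n (f n) (f (Suc n))" by blast
  define k where "k = (\<lambda>n. fst (f n))"
  define D where "D = (\<lambda>n. snd (snd (f n)))"
  have k1: "fst (snd (f n)) = k (Suc n)" for n
    using f(2)[of n] by (auto simp: Q_def k_def split: prod.splits)
  have eq: "f n = (k n, k (Suc n), D n)" for n
    using k1[of n] by (simp add: k_def D_def prod_eq_iff)
  have "free_res A k D" unfolding free_res_def
    using f by (simp add: eq P_def Q_def)
  moreover have "k 0 = p" "k 1 = q" "D 0 = E" using eq[of 0] f(1)[of 0] by (auto simp: P_def)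
  ultimately show ?thesis using that by blast
qed

section \<open>Short exact sequences\<close>

locale short_exact = i: lmodule_homo A N' N \<alpha> + p: lmodule_homo A N N'' \<pi>
  for A N' N N'' \<alpha> \<pi> +
  assumes inj: "inj_on \<alpha> (carrier N')"
    and surj: "\<pi> ` carrier N = carrier N''"
    and exact: "\<alpha> ` carrier N' = lmodule_ker N N'' \<pi>"

lemma short_exactI:
  assumes "lmodule A N'" "lmodule A N" "lmodule A N''" "\<alpha> \<in> lmodule_hom A N' N" "\<pi> \<in> lmodule_hom A N N''"
    and "inj_on \<alpha> (carrier N')" "\<pi> ` carrier N = carrier N''" "\<alpha> ` carrier N' = lmodule_ker N N'' \<pi>"
  shows "short_exact A N' N N'' \<alpha> \<pi>"
  using assms by (intro short_exact.intro short_exact_axioms.intro lmodule_homoI)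

context short_exact
begin

lemma lift_vec:
  assumes "c \<in> vecs N'' q" obtains b where "b \<in> vecs N q" "\<And>i. i < q \<Longrightarrow> \<pi> (b i) = c i"
proof -
  have ex: "\<exists>b. b \<in> carrier N \<and> \<pi> b = c i" if "i < q" for i
  proof -
    have "c i \<in> \<pi> ` carrier N" using assms that surj by auto
    then show ?thesis by auto
  qed
  have *: "(SOME b. b \<in> carrier N \<and> \<pi> b = c i) \<in> carrier N \<and> \<pi> (SOME b. b \<in> carrier N \<and> \<pi> b = c i) = c i"
    if "i < q" for i by (rule someI_ex[OF ex[OF that]])
  show ?thesis by (rule that[of "\<lambda>i. SOME b. b \<in> carrier N \<and> \<pi> b = c i"]) (use * in auto)
qed

lemma ker_vec:
  assumes "b \<in> vecs N q" "\<And>i. i < q \<Longrightarrow> \<pi> (b i) = \<zero>\<^bsub>N''\<^esub>"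
  obtains a where "a \<in> vecs N' q" "\<And>i. i < q \<Longrightarrow> \<alpha> (a i) = b i"
proof -
  have ex: "\<exists>a. a \<in> carrier N' \<and> \<alpha> a = b i" if "i < q" for i
  proof -
    have "b i \<in> lmodule_ker N N'' \<pi>" using assms that by (auto simp: lmodule_ker_def)
    then have "b i \<in> \<alpha> ` carrier N'" unfolding exact .
    then show ?thesis by auto
  qed
  have *: "(SOME a. a \<in> carrier N' \<and> \<alpha> a = b i) \<in> carrier N' \<and> \<alpha> (SOME a. a \<in> carrier N' \<and> \<alpha> a = b i) = b i"
    if "i < q" for i by (rule someI_ex[OF ex[OF that]])
  show ?thesis by (rule that[of "\<lambda>i. SOME a. a \<in> carrier N' \<and> \<alpha> a = b i"]) (use * in auto)
qed

lemma comp_zero [simp]: "x \<in> carrier N' \<Longrightarrow> \<pi> (\<alpha> x) = \<zero>\<^bsub>N''\<^esub>"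
  using exact by (auto simp: lmodule_ker_def)

text \<open>
  A diagram chase, the part of the long exact sequence from \<open>N''\<close> in one degree to \<open>N'\<close> in the next. A solution
  over \<open>N\<close> maps to a cycle over \<open>N''\<close>; lifting a preimage of this cycle and subtracting its image moves the
  solution into \<open>N'\<close>.
\<close>

lemma col_exact_sub:
  assumes E: "E \<in> mats A p n" and F: "F \<in> mats A q p" and G: "G \<in> mats A r q"
    and z: "prod_zero A q p n F E" and "col_exact N p q r F G" "col_exact N'' n p q E F"
  shows "col_exact N' p q r F G"
  unfolding col_exact_def
proof (intro ballI impI)
  fix y assume y: "y \<in> vecs N' q" "\<forall>i<r. lin_comb N' q (G i) y = \<zero>\<^bsub>N'\<^esub>"
  have y': "(\<lambda>i. \<alpha> (y i)) \<in> vecs N q" using y by auto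
  have "lin_comb N q (G i) (\<lambda>i. \<alpha> (y i)) = \<zero>\<^bsub>N\<^esub>" if "i < r" for i
    using y that matsD[OF G that] by (simp flip: i.map_lin_comb)
  then obtain b where b: "b \<in> vecs N p" "\<And>i. i < q \<Longrightarrow> \<alpha> (y i) = lin_comb N p (F i) b"
    using col_exactD[OF assms(5) y'] by blast
  have b': "(\<lambda>i. \<pi> (b i)) \<in> vecs N'' p" using b by auto
  have "lin_comb N'' p (F i) (\<lambda>i. \<pi> (b i)) = \<zero>\<^bsub>N''\<^esub>" if "i < q" for i
  proof -
    have "lin_comb N'' p (F i) (\<lambda>i. \<pi> (b i)) = \<pi> (lin_comb N p (F i) b)"
      using matsD[OF F that] b by (simp add: p.map_lin_comb)
    also have "\<dots> = \<zero>\<^bsub>N''\<^esub>" using b(2)[OF that, symmetric] y that by (simp add: Pi_def)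
    finally show ?thesis .
  qed
  then obtain c where c: "c \<in> vecs N'' n" "\<And>i. i < p \<Longrightarrow> \<pi> (b i) = lin_comb N'' n (E i) c"
    using col_exactD[OF assms(6) b'] by blast
  obtain d where d: "d \<in> vecs N n" "\<And>i. i < n \<Longrightarrow> \<pi> (d i) = c i" using lift_vec[OF c(1)] by blast
  define e where "e = (\<lambda>i. b i \<ominus>\<^bsub>N\<^esub> lin_comb N n (E i) d)"
  have Ed: "(\<lambda>i. lin_comb N n (E i) d) \<in> vecs N p" using d matsD[OF E] by auto
  have e: "e \<in> vecs N p" using b Ed by (auto simp: e_def Pi_def)
  have "\<pi> (e i) = \<zero>\<^bsub>N''\<^esub>" if "i < p" for i
  proof -
    have "\<pi> (lin_comb N n (E i) d) = lin_comb N'' n (E i) (\<lambda>j. \<pi> (d j))"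
      using matsD[OF E that] d by (simp add: p.map_lin_comb)
    also have "\<dots> = lin_comb N'' n (E i) c" using d by (intro lin_comb_cong) auto
    finally have "\<pi> (e i) = lin_comb N'' n (E i) c \<ominus>\<^bsub>N''\<^esub> lin_comb N'' n (E i) c"
      using c(2)[OF that] b Ed that by (simp add: e_def p.diff Pi_def)
    moreover have "lin_comb N'' n (E i) c \<in> carrier N''" using c matsD[OF E that] by auto
    ultimately show ?thesis by (simp add: a_minus_def p.N.M.r_neg)
  qed
  then obtain a where a: "a \<in> vecs N' p" "\<And>i. i < p \<Longrightarrow> \<alpha> (a i) = e i" using ker_vec[OF e] by blast
  have "y i = lin_comb N' p (F i) a" if i: "i < q" for i
  proof -
    have "\<alpha> (lin_comb N' p (F i) a) = lin_comb N p (F i) (\<lambda>j. \<alpha> (a j))"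
      using matsD[OF F i] a by (simp add: i.map_lin_comb)
    also have "\<dots> = lin_comb N p (F i) e" using a by (intro lin_comb_cong) auto
    also have "\<dots> = lin_comb N p (F i) b \<ominus>\<^bsub>N\<^esub> lin_comb N p (F i) (\<lambda>i. lin_comb N n (E i) d)"
      unfolding e_def by (rule i.N.lin_comb_diff_right[OF matsD[OF F i] b(1) Ed])
    also have "lin_comb N p (F i) (\<lambda>i. lin_comb N n (E i) d) = \<zero>\<^bsub>N\<^esub>"
      by (rule prod_zero_apply[OF i.N.lmodule_axioms z F E d(1) i])
    finally have "\<alpha> (lin_comb N' p (F i) a) = \<alpha> (y i)"
      using b(2)[OF i] b(1) matsD[OF F i] by (simp add: a_minus_def)
    moreover have "lin_comb N' p (F i) a \<in> carrier N'" using matsD[OF F i] a by auto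
    ultimately show ?thesis using inj_onD[OF inj] y i by (auto simp: Pi_def)
  qed
  then show "\<exists>z\<in>vecs N' p. \<forall>i<q. y i = lin_comb N' p (F i) z" using a by blast
qed

text \<open>
  The dual chase: the image under \<open>F\<close> of a lifted cycle lies in \<open>N'\<close> and is a cycle there; correcting the lift by
  a solution over \<open>N'\<close> turns it into a cycle over \<open>N\<close>.
\<close>

lemma col_exact_quot:
  assumes E: "E \<in> mats A q p" and F: "F \<in> mats A r q" and G: "G \<in> mats A s r"
    and z: "prod_zero A s r q G F" and "col_exact N' q r s F G" "col_exact N p q r E F"
  shows "col_exact N'' p q r E F"
  unfolding col_exact_def
proof (intro ballI impI)
  fix c assume c: "c \<in> vecs N'' q" "\<forall>i<r. lin_comb N'' q (F i) c = \<zero>\<^bsub>N''\<^esub>"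
  obtain b where b: "b \<in> vecs N q" "\<And>i. i < q \<Longrightarrow> \<pi> (b i) = c i" using lift_vec[OF c(1)] by blast
  have Fb: "(\<lambda>i. lin_comb N q (F i) b) \<in> vecs N r" using b matsD[OF F] by auto
  have "\<pi> (lin_comb N q (F i) b) = \<zero>\<^bsub>N''\<^esub>" if "i < r" for i
  proof -
    have "\<pi> (lin_comb N q (F i) b) = lin_comb N'' q (F i) (\<lambda>i. \<pi> (b i))"
      using matsD[OF F that] b by (simp add: p.map_lin_comb)
    also have "\<dots> = lin_comb N'' q (F i) c" using b by (intro lin_comb_cong) auto
    finally show ?thesis using c that by simp
  qed
  then obtain a where a: "a \<in> vecs N' r" "\<And>i. i < r \<Longrightarrow> \<alpha> (a i) = lin_comb N q (F i) b"
    using ker_vec[OF Fb] by blast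
  have "lin_comb N' r (G i) a = \<zero>\<^bsub>N'\<^esub>" if "i < s" for i
  proof -
    have "\<alpha> (lin_comb N' r (G i) a) = lin_comb N r (G i) (\<lambda>j. \<alpha> (a j))"
      using matsD[OF G that] a by (simp add: i.map_lin_comb)
    also have "\<dots> = lin_comb N r (G i) (\<lambda>i. lin_comb N q (F i) b)" using a by (intro lin_comb_cong) auto
    also have "\<dots> = \<zero>\<^bsub>N\<^esub>" by (rule prod_zero_apply[OF i.N.lmodule_axioms z G F b(1) that])
    finally show ?thesis using i.eq_iff[OF inj] matsD[OF G that] a by auto
  qed
  then obtain d where d: "d \<in> vecs N' q" "\<And>i. i < r \<Longrightarrow> a i = lin_comb N' q (F i) d"
    using col_exactD[OF assms(5) a(1)] by blast
  define e where "e = (\<lambda>i. b i \<ominus>\<^bsub>N\<^esub> \<alpha> (d i))"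
  have ad: "(\<lambda>i. \<alpha> (d i)) \<in> vecs N q" using d by auto
  have e: "e \<in> vecs N q" using b ad by (auto simp: e_def Pi_def)
  have "lin_comb N q (F i) e = \<zero>\<^bsub>N\<^esub>" if i: "i < r" for i
  proof -
    have "lin_comb N q (F i) e = lin_comb N q (F i) b \<ominus>\<^bsub>N\<^esub> lin_comb N q (F i) (\<lambda>j. \<alpha> (d j))"
      unfolding e_def by (rule i.N.lin_comb_diff_right[OF matsD[OF F i] b(1) ad])
    also have "lin_comb N q (F i) (\<lambda>j. \<alpha> (d j)) = lin_comb N q (F i) b"
      using matsD[OF F i] d a(2)[OF i] i by (simp flip: i.map_lin_comb)
    finally show ?thesis using Fb i by (simp add: a_minus_def i.N.M.r_neg Pi_def)
  qed
  then obtain f where f: "f \<in> vecs N p" "\<And>i. i < q \<Longrightarrow> e i = lin_comb N p (E i) f"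
    using col_exactD[OF assms(6) e] by blast
  have "c i = lin_comb N'' p (E i) (\<lambda>j. \<pi> (f j))" if i: "i < q" for i
  proof -
    have "lin_comb N'' p (E i) (\<lambda>j. \<pi> (f j)) = \<pi> (e i)"
      using matsD[OF E i] f i by (simp add: p.map_lin_comb)
    also have "\<dots> = \<pi> (b i) \<ominus>\<^bsub>N''\<^esub> \<pi> (\<alpha> (d i))" unfolding e_def using b ad i
      by (intro p.diff) (auto simp: Pi_def)
    also have "\<dots> = c i" using b d i c by (simp add: Pi_def a_minus_def)
    finally show ?thesis by simp
  qed
  moreover have "(\<lambda>j. \<pi> (f j)) \<in> vecs N'' p" using f by auto
  ultimately show "\<exists>z\<in>vecs N'' p. \<forall>i<q. c i = lin_comb N'' p (E i) z" by blast
qed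

lemma ext_vanishes_sub:
  assumes "ext_vanishes A N n" "ext_vanishes A N'' n" shows "ext_vanishes A N' (Suc n)"
  unfolding ext_vanishes_def
proof (intro allI impI)
  fix k D i assume D: "free_res A k D" and "Suc n \<le> i"
  then obtain j where i: "i = Suc j" "n \<le> j" by (metis Suc_le_D Suc_le_mono)
  show "col_exact_at N' k D i"
    unfolding i(1) using i(2)
    by (intro col_exact_sub[OF free_resD(1)[OF D] free_resD(1)[OF D] free_resD(1)[OF D] free_resD(2)[OF D]]
        ext_vanishesD[OF assms(1) D] ext_vanishesD[OF assms(2) D]) auto
qed

lemma ext_vanishes_quot:
  assumes "ext_vanishes A N n" "ext_vanishes A N' (Suc n)" shows "ext_vanishes A N'' n"
  unfolding ext_vanishes_def
proof (intro allI impI)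
  fix k D i assume D: "free_res A k D" and "n \<le> i"
  then show "col_exact_at N'' k D i"
    by (intro col_exact_quot[OF free_resD(1)[OF D] free_resD(1)[OF D] free_resD(1)[OF D] free_resD(2)[OF D]]
        ext_vanishesD[OF assms(1) D] ext_vanishesD[OF assms(2) D]) auto
qed

end

lemma col_exact_retract:
  assumes "lmodule_homo A N L \<alpha>" "lmodule_homo A L N \<beta>" "\<And>x. x \<in> carrier N \<Longrightarrow> \<beta> (\<alpha> x) = x"
    and E: "E \<in> mats A q p" and F: "F \<in> mats A r q" and "col_exact L p q r E F"
  shows "col_exact N p q r E F"
  unfolding col_exact_def
proof (intro ballI impI)
  interpret a: lmodule_homo A N L \<alpha> by fact
  interpret b: lmodule_homo A L N \<beta> by fact
  fix y assume y: "y \<in> vecs N q" "\<forall>i<r. lin_comb N q (F i) y = \<zero>\<^bsub>N\<^esub>"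
  have y': "(\<lambda>i. \<alpha> (y i)) \<in> vecs L q" using y by auto
  have "lin_comb L q (F i) (\<lambda>i. \<alpha> (y i)) = \<zero>\<^bsub>L\<^esub>" if "i < r" for i
    using y that matsD[OF F that] by (simp flip: a.map_lin_comb)
  then obtain z where z: "z \<in> vecs L p" "\<And>i. i < q \<Longrightarrow> \<alpha> (y i) = lin_comb L p (E i) z"
    using col_exactD[OF assms(6) y'] by blast
  have "y i = lin_comb N p (E i) (\<lambda>j. \<beta> (z j))" if i: "i < q" for i
  proof -
    have "y i = \<beta> (\<alpha> (y i))" using assms(3) y i by (auto simp: Pi_def)
    then show ?thesis using z i matsD[OF E i] by (simp add: b.map_lin_comb)
  qed
  moreover have "(\<lambda>j. \<beta> (z j)) \<in> vecs N p" using z by auto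
  ultimately show "\<exists>z\<in>vecs N p. \<forall>i<q. y i = lin_comb N p (E i) z" by blast
qed

lemma ext_vanishes_retract:
  assumes "lmodule_homo A N L \<alpha>" "lmodule_homo A L N \<beta>" "\<And>x. x \<in> carrier N \<Longrightarrow> \<beta> (\<alpha> x) = x" "ext_vanishes A L n"
  shows "ext_vanishes A N n"
  unfolding ext_vanishes_def
proof (intro allI impI)
  fix k D i assume D: "free_res A k D" and "n \<le> i"
  then show "col_exact_at N k D i"
    by (intro col_exact_retract[OF assms(1,2,3) free_resD(1)[OF D] free_resD(1)[OF D]] ext_vanishesD[OF assms(4) D])
qed

section \<open>Extending homomorphisms from submodules of free modules\<close>

text \<open>
  Injectivity with respect to submodules of finitely generated free modules. A homomorphism from \<open>A\<^sup>p\<close> is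
  given by the images \<open>z\<close> of the unit vectors.
\<close>

definition extends_homs :: "'a ring \<Rightarrow> ('a, 'm, 'c) module_scheme \<Rightarrow> bool" where
  "extends_homs A I \<longleftrightarrow> (\<forall>p K f. submodule K A (free_mod A p) \<longrightarrow>
      f \<in> lmodule_hom A ((free_mod A p)\<lparr>carrier := K\<rparr>) I \<longrightarrow>
      (\<exists>z\<in>vecs I p. \<forall>x\<in>K. f x = lin_comb I p x z))"

text \<open>
  A cycle \<open>y\<close> over \<open>I\<close> defines a homomorphism \<open>x E \<mapsto> x y\<close> on the row space of \<open>E\<close>, well defined because
  the rows are exact and \<open>y\<close> is a cycle. The images of the unit vectors under an extension to \<open>A\<^sup>p\<close> are a
  preimage of \<open>y\<close>.
\<close>

lemma extends_homs_imp_ext_vanishes: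
  assumes A: "ring A" and I: "lmodule A I" and ext: "extends_homs A I"
  shows "ext_vanishes A I 0"
  unfolding ext_vanishes_def
proof (intro allI impI)
  fix k D i assume D: "free_res A k D"
  let ?p = "k i" and ?q = "k (Suc i)" and ?r = "k (Suc (Suc i))" and ?E = "D i" and ?F = "D (Suc i)"
  note E = free_resD(1)[OF D, of i] and F = free_resD(1)[OF D, of "Suc i"] and ex = free_resD(3)[OF D, of i]
  interpret I: lmodule A I by fact
  show "col_exact I ?p ?q ?r ?E ?F" unfolding col_exact_def
  proof (intro ballI impI)
    fix y assume y: "y \<in> vecs I ?q" "\<forall>i<?r. lin_comb I ?q (?F i) y = \<zero>\<^bsub>I\<^esub>"
    define g where "g = (\<lambda>i. cut_vec A ?p (?E i))"
    have g: "g i \<in> carrier (free_mod A ?p)" if "i < ?q" for i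
      unfolding g_def by (rule cut_vec_closed[OF A matsD[OF E that]])
    define \<phi> where "\<phi> = (\<lambda>x. lin_comb (free_mod A ?p) ?q x g)"
    have gv: "g \<in> vecs (free_mod A ?p) ?q" using g by auto
    interpret \<phi>: lmodule_homo A "free_mod A ?q" "free_mod A ?p" \<phi>
      unfolding \<phi>_def by (intro lmodule_homoI lmodule_free_mod A lin_comb_hom gv)
    have "\<exists>h\<in>lmodule_hom A ((free_mod A ?p)\<lparr>carrier := \<phi> ` carrier (free_mod A ?q)\<rparr>) I.
        \<forall>x\<in>carrier (free_mod A ?q). h (\<phi> x) = lin_comb I ?q x y"
    proof (rule \<phi>.factor_through_image[OF I lin_comb_hom[OF I y(1)]])
      fix x assume x: "x \<in> carrier (free_mod A ?q)" "\<phi> x = \<zero>\<^bsub>free_mod A ?p\<^esub>"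
      have xv: "x \<in> vecs A ?q" using x(1) by (auto simp: free_mod_carrier)
      have "lin_comb (regular A) ?q x (\<lambda>i. ?E i j) = \<zero>\<^bsub>A\<^esub>" if j: "j < ?p" for j
      proof -
        have "lin_comb (regular A) ?q x (\<lambda>i. ?E i j) = lin_comb (regular A) ?q x (\<lambda>i. g i j)"
          by (rule lin_comb_cong) (use j in \<open>simp_all add: g_def cut_vec_def\<close>)
        also have "\<dots> = \<phi> x j" unfolding \<phi>_def using free_mod_lin_comb_eval[OF A xv g] j by simp
        finally show ?thesis using x(2) by simp
      qed
      then obtain w where w: "w \<in> vecs A ?r" "\<And>i. i < ?q \<Longrightarrow> x i = lin_comb (regular A) ?r w (\<lambda>l. ?F l i)"
        using row_exactD[OF ex xv] by blast
      have "lin_comb I ?q x y = lin_comb I ?q (\<lambda>i. lin_comb (regular A) ?r w (\<lambda>l. ?F l i)) y"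
        using w by (intro lin_comb_cong) auto
      also have "\<dots> = lin_comb I ?r w (\<lambda>l. lin_comb I ?q (?F l) y)"
        by (rule lin_comb_assoc[symmetric, OF I w(1) F y(1)])
      also have "\<dots> = \<zero>\<^bsub>I\<^esub>" using y w by (simp add: I.lin_comb_zero_right')
      finally show "lin_comb I ?q x y = \<zero>\<^bsub>I\<^esub>" .
    qed
    then obtain h where h: "h \<in> lmodule_hom A ((free_mod A ?p)\<lparr>carrier := \<phi> ` carrier (free_mod A ?q)\<rparr>) I"
      "\<forall>x\<in>carrier (free_mod A ?q). h (\<phi> x) = lin_comb I ?q x y" by (elim bexE)
    have K: "submodule (\<phi> ` carrier (free_mod A ?q)) A (free_mod A ?p)"
      by (rule \<phi>.submodule_image[OF submodule_carrier[OF \<phi>.M.lmodule_axioms]])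
    obtain z where z: "z \<in> vecs I ?p" and zK: "\<forall>x\<in>\<phi> ` carrier (free_mod A ?q). h x = lin_comb I ?p x z"
      using ext[unfolded extends_homs_def, rule_format, OF K h(1)] by (elim bexE)
    have "y i = lin_comb I ?p (?E i) z" if i: "i < ?q" for i
    proof -
      have u: "unit_vec A i \<in> carrier (free_mod A ?q)" by (rule unit_vec_free_mod[OF A i])
      have gi: "\<phi> (unit_vec A i) = g i" unfolding \<phi>_def by (rule \<phi>.N.lin_comb_unit_vec[OF i gv])
      have "y i = h (g i)" using h(2) u y(1) i by (simp add: I.lin_comb_unit_vec flip: gi)
      also have "\<dots> = lin_comb I ?p (g i) z" using zK imageI[OF u, of \<phi>] unfolding gi by blast
      finally show ?thesis by (simp add: g_def)
    qed
    then show "\<exists>z\<in>vecs I ?p. \<forall>i<?q. y i = lin_comb I ?p (?E i) z" using z by blast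
  qed
qed

section \<open>Images, transport and quotients of modules\<close>

lemma lmodule_image:
  assumes "lmodule A N" and car: "carrier Q = \<pi> ` carrier N"
    and add: "\<And>x y. x \<in> carrier N \<Longrightarrow> y \<in> carrier N \<Longrightarrow> \<pi> (x \<oplus>\<^bsub>N\<^esub> y) = \<pi> x \<oplus>\<^bsub>Q\<^esub> \<pi> y"
    and smult: "\<And>a x. a \<in> carrier A \<Longrightarrow> x \<in> carrier N \<Longrightarrow> \<pi> (a \<odot>\<^bsub>N\<^esub> x) = a \<odot>\<^bsub>Q\<^esub> \<pi> x"
    and zero: "\<pi> \<zero>\<^bsub>N\<^esub> = \<zero>\<^bsub>Q\<^esub>"
  shows "lmodule A Q" "lmodule_homo A N Q \<pi>"
proof -
  interpret N: lmodule A N by fact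
  have "abelian_group Q"
  proof (rule abelian_groupI)
    fix x assume "x \<in> carrier Q"
    then obtain a where a: "a \<in> carrier N" "x = \<pi> a" using car by auto
    then have "\<pi> (\<ominus>\<^bsub>N\<^esub> a) \<oplus>\<^bsub>Q\<^esub> x = \<zero>\<^bsub>Q\<^esub>" by (simp add: N.M.l_neg zero flip: add)
    then show "\<exists>y\<in>carrier Q. y \<oplus>\<^bsub>Q\<^esub> x = \<zero>\<^bsub>Q\<^esub>" using a car by (metis N.M.a_inv_closed imageI)
  qed (auto simp: car N.M.a_ac simp flip: add zero)
  then show Q: "lmodule A Q"
    by (intro lmodule.intro lmodule_axioms.intro N.R.ring_axioms)
      (auto simp: car N.smult_l_distr N.smult_r_distr N.smult_assoc1 simp flip: add smult)
  show "lmodule_homo A N Q \<pi>"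
    by (intro lmodule_homoI Q assms(1) lmodule_homI)
      (auto simp: car add smult)
qed

text \<open>
  The copy of \<open>N\<close> along an injection \<open>g\<close>, used to move a module into the universe of a resolution.
\<close>

definition transport :: "('n \<Rightarrow> 'u) \<Rightarrow> ('a, 'n, 'c) module_scheme \<Rightarrow> ('a, 'u) module" where
  "transport g N = \<lparr>carrier = g ` carrier N, monoid.mult = undefined, one = undefined, zero = g \<zero>\<^bsub>N\<^esub>,
     add = (\<lambda>x y. g (inv_into (carrier N) g x \<oplus>\<^bsub>N\<^esub> inv_into (carrier N) g y)),
     smult = (\<lambda>a x. g (a \<odot>\<^bsub>N\<^esub> inv_into (carrier N) g x))\<rparr>"

lemma transport_carrier [simp]: "carrier (transport g N) = g ` carrier N"
  by (simp add: transport_def)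

lemma transport_hom:
  assumes "lmodule A N" "inj_on g (carrier N)"
  shows "lmodule_homo A N (transport g N) g" (is ?a)
    and "lmodule_homo A (transport g N) N (inv_into (carrier N) g)" (is ?b)
proof -
  show a: ?a by (rule lmodule_image(2)[OF assms(1)]) (auto simp: transport_def assms(2))
  then interpret a: lmodule_homo A N "transport g N" g .
  have "inv_into (carrier N) g \<in> lmodule_hom A (transport g N) N"
    using assms(2) by (intro lmodule_homI) (auto simp flip: a.add a.smult)
  then show ?b by (intro lmodule_homoI assms a.N.lmodule_axioms)
qed

text \<open>
  Choosing a representative of each coset keeps the quotient in the type of \<open>N\<close>, so cosyzygies do not
  leave the universe.
\<close>

lemma quotient_exists:
  fixes N :: "('a, 'n) module"
  assumes "lmodule A N" "submodule K A N"
  obtains Q :: "('a, 'n) module" and \<pi> where "lmodule_homo A N Q \<pi>" "\<pi> ` carrier N = carrier Q"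
    "lmodule_ker N Q \<pi> = K" "carrier Q \<subseteq> carrier N"
proof -
  interpret K: lsubmodule A N K using assms by (rule lsubmoduleI)
  define \<pi> where "\<pi> = (\<lambda>x. SOME y. y \<in> carrier N \<and> x \<ominus>\<^bsub>N\<^esub> y \<in> K)"
  have \<pi>: "\<pi> x \<in> carrier N" "x \<ominus>\<^bsub>N\<^esub> \<pi> x \<in> K" if "x \<in> carrier N" for x
  proof -
    have "x \<in> carrier N \<and> x \<ominus>\<^bsub>N\<^esub> x \<in> K" using that K.sub_closed by (simp add: a_minus_def K.M.r_neg)
    from someI[of "\<lambda>y. y \<in> carrier N \<and> x \<ominus>\<^bsub>N\<^esub> y \<in> K", OF this]
    show "\<pi> x \<in> carrier N" "x \<ominus>\<^bsub>N\<^esub> \<pi> x \<in> K" unfolding \<pi>_def by auto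
  qed
  have sum: "(x \<ominus>\<^bsub>N\<^esub> y) \<oplus>\<^bsub>N\<^esub> (y \<ominus>\<^bsub>N\<^esub> z) = x \<ominus>\<^bsub>N\<^esub> z"
    if "x \<in> carrier N" "y \<in> carrier N" "z \<in> carrier N" for x y z
    using that by (simp add: a_minus_def K.M.a_ac K.M.r_neg1 K.M.r_neg2)
  have neg: "\<ominus>\<^bsub>N\<^esub> (x \<ominus>\<^bsub>N\<^esub> y) = y \<ominus>\<^bsub>N\<^esub> x" if "x \<in> carrier N" "y \<in> carrier N" for x y
    using that by (simp add: a_minus_def K.M.minus_add K.M.a_ac)
  have eq: "\<pi> x = \<pi> y \<longleftrightarrow> x \<ominus>\<^bsub>N\<^esub> y \<in> K" if xy: "x \<in> carrier N" "y \<in> carrier N" for x y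
  proof
    assume "\<pi> x = \<pi> y"
    then have "x \<ominus>\<^bsub>N\<^esub> \<pi> y \<in> K" "\<pi> y \<ominus>\<^bsub>N\<^esub> y \<in> K"
      using \<pi>[OF xy(1)] \<pi>[OF xy(2)] K.minus_closed[of "y \<ominus>\<^bsub>N\<^esub> \<pi> y"] neg[of y "\<pi> y"] xy by auto
    then show "x \<ominus>\<^bsub>N\<^esub> y \<in> K" using sum[of x "\<pi> y" y] xy \<pi> K.sub_closed(3) by metis
  next
    assume k: "x \<ominus>\<^bsub>N\<^esub> y \<in> K"
    then have k': "y \<ominus>\<^bsub>N\<^esub> x \<in> K" using K.minus_closed[OF k] neg[OF xy] by simp
    have "x \<ominus>\<^bsub>N\<^esub> z \<in> K \<longleftrightarrow> y \<ominus>\<^bsub>N\<^esub> z \<in> K" if "z \<in> carrier N" for z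
      using sum[of x y z] sum[of y x z] k k' K.sub_closed(3) that xy by metis
    then have "(\<lambda>z. z \<in> carrier N \<and> x \<ominus>\<^bsub>N\<^esub> z \<in> K) = (\<lambda>z. z \<in> carrier N \<and> y \<ominus>\<^bsub>N\<^esub> z \<in> K)" by blast
    then show "\<pi> x = \<pi> y" unfolding \<pi>_def by (rule arg_cong)
  qed
  have \<pi>\<pi>: "\<pi> x \<ominus>\<^bsub>N\<^esub> x \<in> K" if "x \<in> carrier N" for x
    using \<pi>[OF that] K.minus_closed[of "x \<ominus>\<^bsub>N\<^esub> \<pi> x"] neg[OF that \<pi>(1)[OF that]] by simp
  define Q :: "('a, 'n) module" where "Q = \<lparr>carrier = \<pi> ` carrier N, monoid.mult = undefined, one = undefined, zero = \<pi> \<zero>\<^bsub>N\<^esub>,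
     add = (\<lambda>x y. \<pi> (x \<oplus>\<^bsub>N\<^esub> y)), smult = (\<lambda>a x. \<pi> (a \<odot>\<^bsub>N\<^esub> x))\<rparr>"
  have hom: "lmodule_homo A N Q \<pi>"
  proof (rule lmodule_image(2)[OF assms(1)])
    fix x y assume xy: "x \<in> carrier N" "y \<in> carrier N"
    have "(x \<oplus>\<^bsub>N\<^esub> y) \<ominus>\<^bsub>N\<^esub> (\<pi> x \<oplus>\<^bsub>N\<^esub> \<pi> y) = (x \<ominus>\<^bsub>N\<^esub> \<pi> x) \<oplus>\<^bsub>N\<^esub> (y \<ominus>\<^bsub>N\<^esub> \<pi> y)"
      using xy \<pi>(1) by (simp add: a_minus_def K.M.a_ac K.M.minus_add)
    then show "\<pi> (x \<oplus>\<^bsub>N\<^esub> y) = \<pi> x \<oplus>\<^bsub>Q\<^esub> \<pi> y"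
      using xy \<pi> K.sub_closed(3) by (simp add: Q_def eq)
  next
    fix a x assume ax: "a \<in> carrier A" "x \<in> carrier N"
    have "(a \<odot>\<^bsub>N\<^esub> x) \<ominus>\<^bsub>N\<^esub> (a \<odot>\<^bsub>N\<^esub> \<pi> x) = a \<odot>\<^bsub>N\<^esub> (x \<ominus>\<^bsub>N\<^esub> \<pi> x)"
      using ax \<pi>(1) by (simp add: a_minus_def K.smult_r_distr K.smult_minus_right)
    then show "\<pi> (a \<odot>\<^bsub>N\<^esub> x) = a \<odot>\<^bsub>Q\<^esub> \<pi> x"
      using ax \<pi> K.sub_closed(4) by (simp add: Q_def eq)
  qed (auto simp: Q_def)
  moreover have "lmodule_ker N Q \<pi> = K"
    using eq[of _ "\<zero>\<^bsub>N\<^esub>"] K.sub_closed(1) by (auto simp: lmodule_ker_def Q_def a_minus_def)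
  moreover have "\<pi> ` carrier N = carrier Q" by (simp add: Q_def)
  moreover have "carrier Q \<subseteq> carrier N" using \<pi>(1) by (auto simp: Q_def)
  ultimately show ?thesis by (intro that)
qed

section \<open>Lifting properties against modules on other types\<close>

text \<open>
  The definition of injectivity quantifies over modules on the type \<open>'u\<close> only; transport gives the
  extension property for modules on every type that embeds into \<open>'u\<close>.
\<close>

lemma injective_extend:
  fixes I :: "('a, 'u) module" and g :: "'x \<Rightarrow> 'u" and h :: "'y \<Rightarrow> 'u"
  assumes I: "injective_lmodule A I" and X: "lmodule A X" "inj_on g (carrier X)"
    and Y: "lmodule A Y" "inj_on h (carrier Y)"
    and f: "f \<in> lmodule_hom A X Y" "inj_on f (carrier X)" and u: "u \<in> lmodule_hom A X I"
  obtains v where "v \<in> lmodule_hom A Y I" "\<And>x. x \<in> carrier X \<Longrightarrow> v (f x) = u x"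
proof -
  let ?gi = "inv_into (carrier X) g"
  note gX = transport_hom[OF X] and hY = transport_hom[OF Y]
  interpret g: lmodule_homo A X "transport g X" g by (rule gX)
  interpret gi: lmodule_homo A "transport g X" X ?gi by (rule gX)
  interpret h: lmodule_homo A Y "transport h Y" h by (rule hY)
  have "inj_on (\<lambda>x. h (f (?gi x))) (carrier (transport g X))"
  proof (rule inj_onI)
    fix a b assume ab: "a \<in> carrier (transport g X)" "b \<in> carrier (transport g X)" "h (f (?gi a)) = h (f (?gi b))"
    have "f (?gi a) = f (?gi b)"
      by (rule inj_onD[OF Y(2) ab(3)]) (use ab lmodule_hom_closed[OF f(1)] gi.closed in blast)+
    then have "?gi a = ?gi b" by (rule inj_onD[OF f(2)]) (use ab gi.closed in blast)+
    then show "a = b" by (rule inv_into_injective) (use ab in auto)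
  qed
  moreover have "(\<lambda>x. h (f (?gi x))) \<in> lmodule_hom A (transport g X) (transport h Y)"
    using lmodule_hom_comp[OF lmodule_hom_comp[OF gi.hom f(1)] h.hom] .
  moreover have "(\<lambda>x. u (?gi x)) \<in> lmodule_hom A (transport g X) I"
    using lmodule_hom_comp[OF gi.hom u] .
  ultimately obtain v where v: "v \<in> lmodule_hom A (transport h Y) I"
    "\<forall>x\<in>carrier (transport g X). v (h (f (?gi x))) = u (?gi x)"
    using I g.N.lmodule_axioms h.N.lmodule_axioms unfolding injective_lmodule_def by blast
  show ?thesis
  proof
    show "(\<lambda>y. v (h y)) \<in> lmodule_hom A Y I" using lmodule_hom_comp[OF h.hom v(1)] .
    show "v (h (f x)) = u x" if "x \<in> carrier X" for x using v(2) that X(2) by auto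
  qed
qed

lemma projective_lift:
  fixes P :: "('a, 'u) module" and g :: "'x \<Rightarrow> 'u" and h :: "'y \<Rightarrow> 'u"
  assumes P: "projective_lmodule A P" and X: "lmodule A X" "inj_on g (carrier X)"
    and Y: "lmodule A Y" "inj_on h (carrier Y)"
    and f: "f \<in> lmodule_hom A X Y" "f ` carrier X = carrier Y" and u: "u \<in> lmodule_hom A P Y"
  obtains v where "v \<in> lmodule_hom A P X" "\<And>x. x \<in> carrier P \<Longrightarrow> f (v x) = u x"
proof -
  let ?gi = "inv_into (carrier X) g"
  note gX = transport_hom[OF X] and hY = transport_hom[OF Y]
  interpret g: lmodule_homo A X "transport g X" g by (rule gX)
  interpret gi: lmodule_homo A "transport g X" X ?gi by (rule gX)
  interpret h: lmodule_homo A Y "transport h Y" h by (rule hY)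
  have "(\<lambda>x. h (f (?gi x))) \<in> lmodule_hom A (transport g X) (transport h Y)"
    using lmodule_hom_comp[OF lmodule_hom_comp[OF gi.hom f(1)] h.hom] .
  moreover have "(\<lambda>x. h (f (?gi x))) ` carrier (transport g X) = carrier (transport h Y)"
    using X(2) by (simp add: image_image flip: f(2))
  moreover have "(\<lambda>x. h (u x)) \<in> lmodule_hom A P (transport h Y)"
    using lmodule_hom_comp[OF u h.hom] .
  ultimately obtain v where v: "v \<in> lmodule_hom A P (transport g X)"
    "\<forall>x\<in>carrier P. h (f (?gi (v x))) = h (u x)"
    using P g.N.lmodule_axioms h.N.lmodule_axioms unfolding projective_lmodule_def by blast
  show ?thesis
  proof
    show "(\<lambda>x. ?gi (v x)) \<in> lmodule_hom A P X" using lmodule_hom_comp[OF v(1) gi.hom] .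
    fix x assume x: "x \<in> carrier P"
    have "f (?gi (v x)) \<in> carrier Y"
      by (intro lmodule_hom_closed[OF f(1)] gi.closed lmodule_hom_closed[OF v(1)] x)
    then show "f (?gi (v x)) = u x" using v(2) x Y(2) lmodule_hom_closed[OF u x] by (metis inj_on_def)
  qed
qed

lemma injective_imp_extends_homs:
  fixes I :: "('a, 'u) module" and g :: "(nat \<Rightarrow> 'a) \<Rightarrow> 'u"
  assumes I: "injective_lmodule A I" and g: "inj g"
  shows "extends_homs A I"
  unfolding extends_homs_def
proof (intro allI impI)
  fix p K f assume K: "submodule K A (free_mod A p)"
    and f: "f \<in> lmodule_hom A ((free_mod A p)\<lparr>carrier := K\<rparr>) I"
  have lI: "lmodule A I" using I by (simp add: injective_lmodule_def)
  then interpret I: lmodule A I .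
  have A: "ring A" by (rule I.R.ring_axioms)
  have F: "lmodule A (free_mod A p)" by (rule lmodule_free_mod[OF A])
  have KF: "K \<subseteq> carrier (free_mod A p)" using K unfolding submodule_iff[OF F] by (elim conjE)
  have inc: "(\<lambda>x. x) \<in> lmodule_hom A ((free_mod A p)\<lparr>carrier := K\<rparr>) (free_mod A p)"
    using KF by (intro lmodule_homI) auto
  obtain v where v: "v \<in> lmodule_hom A (free_mod A p) I"
    "\<And>x. x \<in> carrier ((free_mod A p)\<lparr>carrier := K\<rparr>) \<Longrightarrow> v x = f x"
    by (rule injective_extend[OF I lmodule_submodule[OF F K] inj_on_subset[OF g subset_UNIV]
          F inj_on_subset[OF g subset_UNIV] inc inj_on_id2 f]) (rule that)
  interpret v: lmodule_homo A "free_mod A p" I v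
    by (intro lmodule_homoI F lI v)
  have U: "unit_vec A \<in> vecs (free_mod A p) p" using unit_vec_free_mod[OF A] by blast
  show "\<exists>z\<in>vecs I p. \<forall>x\<in>K. f x = lin_comb I p x z"
  proof (intro bexI ballI)
    fix x assume x: "x \<in> K"
    have "x \<in> vecs A p" using x KF by (auto simp: free_mod_carrier)
    then have "v (lin_comb (free_mod A p) p x (unit_vec A)) = lin_comb I p x (\<lambda>i. v (unit_vec A i))"
      using U by (rule v.map_lin_comb)
    then show "f x = lin_comb I p x (\<lambda>i. v (unit_vec A i))"
      using x v(2)[of x] free_mod_expand[OF A, of x p] KF by auto
  qed (use U in auto)
qed

text \<open>
  Dimension shifting: the coresolution is cut into short exact sequences of its cosyzygies \<open>C j\<close>. Starting from
  \<open>C (n + 1) = 0\<close>, each step down costs one degree. The hypothesis on the terms is the extension property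
  instead of injectivity because the former is preserved by \<open>corner\<close> below.
\<close>

lemma finite_coresolution_ext_vanishes:
  assumes N: "lmodule A N" and J: "\<And>j. lmodule A (J j)" "\<And>j. extends_homs A (J j)"
    and e: "e \<in> lmodule_hom A N (J 0)" "inj_on e (carrier N)"
    and d: "\<And>j. d j \<in> lmodule_hom A (J j) (J (Suc j))"
    and ex0: "e ` carrier N = lmodule_ker (J 0) (J 1) (d 0)"
    and ex: "\<And>j. d j ` carrier (J j) = lmodule_ker (J (Suc j)) (J (Suc (Suc j))) (d (Suc j))"
    and fin: "\<And>j. j > n \<Longrightarrow> carrier (J j) = {\<zero>\<^bsub>J j\<^esub>}"
  shows "ext_vanishes A N (Suc n)"
proof -
  interpret N: lmodule A N by fact
  have A: "ring A" by (rule N.R.ring_axioms)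
  have hd: "lmodule_homo A (J j) (J (Suc j)) (d j)" for j
    by (intro lmodule_homoI J d)
  have FJ: "ext_vanishes A (J j) m" for j m
    using ext_vanishes_mono[OF extends_homs_imp_ext_vanishes[OF A J]] by simp
  define C where "C = (\<lambda>j. (J j)\<lparr>carrier := lmodule_ker (J j) (J (Suc j)) (d j)\<rparr>)"
  have C: "lmodule A (C j)" for j
    unfolding C_def by (intro lmodule_submodule J lmodule_homo.submodule_ker[OF hd])
  have cC: "carrier (C j) = lmodule_ker (J j) (J (Suc j)) (d j)" for j by (simp add: C_def)
  have dC: "d j \<in> lmodule_hom A (J j) (C (Suc j))" for j
    using d[of j] ex[of j] by (auto simp: lmodule_hom_def C_def)
  have ker: "lmodule_ker (J j) (C (Suc j)) (d j) = carrier (C j)" for j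
    by (simp add: C_def lmodule_ker_def)
  have ses: "short_exact A (C j) (J j) (C (Suc j)) (\<lambda>x. x) (d j)" for j
  proof (intro short_exactI C J dC)
    show "(\<lambda>x. x) \<in> lmodule_hom A (C j) (J j)"
      by (intro lmodule_homI) (auto simp: C_def lmodule_ker_def)
  qed (use ex ker cC in auto)
  have ses0: "short_exact A N (J 0) (C 1) e (d 0)"
    unfolding One_nat_def
    by (intro short_exactI C J dC N e)
      (use ex0 ex ker cC in auto)
  have "ext_vanishes A (C (Suc n - m)) m" if "m \<le> n" for m using that
  proof (induction m)
    case 0
    have "C (Suc n) = (J (Suc n))\<lparr>carrier := {\<zero>\<^bsub>J (Suc n)\<^esub>}\<rparr>"
      using fin[of "Suc n"] submodule_iff[OF J(1)] lmodule_homo.submodule_ker[OF hd, of "Suc n"]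
      unfolding C_def by (metis lessI order_antisym singletonD subsetI)
    then have "\<And>x. x \<in> carrier (C (Suc n)) \<Longrightarrow> x = \<zero>\<^bsub>C (Suc n)\<^esub>" by simp
    interpret C: lmodule A "C (Suc n)" by (rule C)
    have "col_exact (C (Suc n)) p q r E F" if "E \<in> mats A q p" for p q r E F
      unfolding col_exact_def
    proof (intro ballI impI)
      fix y assume y: "y \<in> vecs (C (Suc n)) q"
      have "y i = lin_comb (C (Suc n)) p (E i) (\<lambda>j. \<zero>\<^bsub>C (Suc n)\<^esub>)" if "i < q" for i
        using y that \<open>\<And>x. x \<in> carrier (C (Suc n)) \<Longrightarrow> x = \<zero>\<^bsub>C (Suc n)\<^esub>\<close>[of "y i"] matsD[OF \<open>E \<in> _\<close>]
        by (auto simp: Pi_def)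
      then show "\<exists>z\<in>vecs (C (Suc n)) p. \<forall>i<q. y i = lin_comb (C (Suc n)) p (E i) z"
        by (intro bexI[of _ "\<lambda>j. \<zero>\<^bsub>C (Suc n)\<^esub>"]) auto
    qed
    then show ?case by (simp add: ext_vanishes_def free_resD)
  next
    case (Suc m)
    then have "Suc n - m = Suc (Suc n - Suc m)" by simp
    then show ?case using short_exact.ext_vanishes_sub[OF ses FJ, of "Suc n - Suc m" m] Suc by simp
  qed
  from this[of n] have "ext_vanishes A (C 1) n" by simp
  then show ?thesis by (rule short_exact.ext_vanishes_sub[OF ses0 FJ])
qed

section \<open>The size of the universe\<close>

lemma ex_inj_pair:
  assumes "infinite (UNIV :: 'b set)" shows "\<exists>f :: 'b \<times> 'b \<Rightarrow> 'b. inj f"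
proof -
  have "(card_of (UNIV \<times> UNIV :: ('b \<times> 'b) set), card_of (UNIV :: 'b set)) \<in> ordLeq"
    using card_of_Times_same_infinite[OF assms] ordIso_iff_ordLeq by blast
  then show ?thesis unfolding card_of_ordLeq[symmetric] by auto
qed

text \<open>
  The sets over an infinite type \<open>'b\<close> are closed under powers with exponents that embed into \<open>'b\<close>: a family of
  sets is coded by its graph, as a set of pairs.
\<close>

lemma ex_inj_fun:
  fixes c :: "'c \<Rightarrow> 'b" and d :: "'d \<Rightarrow> 'b set"
  assumes "infinite (UNIV :: 'b set)" "inj c" "inj d"
  shows "\<exists>g :: ('c \<Rightarrow> 'd) \<Rightarrow> 'b set. inj g"
proof -
  obtain f :: "'b \<times> 'b \<Rightarrow> 'b" where f: "inj f" using ex_inj_pair[OF assms(1)] by blast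
  define g where "g = (\<lambda>h. {f (c x, y) | x y. y \<in> d (h x)})"
  have "y \<in> d (h x) \<longleftrightarrow> f (c x, y) \<in> g h" for x y h
    by (auto simp: g_def inj_eq[OF f] inj_eq[OF assms(2)])
  then have d: "d (h x) = {y. f (c x, y) \<in> g h}" for h x by auto
  have "inj g"
  proof (rule injI, rule ext)
    fix h h' x assume "g h = g h'"
    then have "d (h x) = d (h' x)" by (simp add: d)
    then show "h x = h' x" by (rule injD[OF assms(3)])
  qed
  then show ?thesis by blast
qed

lemma ex_inj_list:
  fixes d :: "'d \<Rightarrow> 'b set"
  assumes "infinite (UNIV :: 'b set)" "inj d"
  shows "\<exists>g :: 'd list \<Rightarrow> 'b set. inj g"
proof -
  obtain c :: "nat \<Rightarrow> 'b" where c: "inj c"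
    using infinite_countable_subset[OF assms(1)] by (elim exE conjE)
  obtain g :: "(nat \<Rightarrow> 'b set) \<Rightarrow> 'b set" where g: "inj g"
    using ex_inj_fun[OF assms(1) c inj_on_id2[of UNIV]] by (elim exE)
  define h where "h = (\<lambda>xs. g (case_nat {c (length xs)} (\<lambda>i. if i < length xs then d (xs ! i) else {})))"
  have "xs = ys" if "h xs = h ys" for xs ys
  proof -
    have eq: "case_nat {c (length xs)} (\<lambda>i. if i < length xs then d (xs ! i) else {}) =
        case_nat {c (length ys)} (\<lambda>i. if i < length ys then d (ys ! i) else {})"
      using that g unfolding h_def by (meson injD)
    from fun_cong[OF this, of 0] have l: "length xs = length ys" using c by (simp add: inj_eq)
    show ?thesis
    proof (rule nth_equalityI[OF l])
      fix i assume "i < length xs"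
      then show "xs ! i = ys ! i" using fun_cong[OF eq, of "Suc i"] l assms(2) by (simp add: inj_eq)
    qed
  qed
  then show ?thesis by (metis injI)
qed

text \<open>
  Unlike \<open>ex_inj_fun\<close> this allows a domain as large as the sets over \<open>'b\<close>. A function of finite support is
  determined by a list of its nonzero values with their arguments.
\<close>

lemma ex_inj_fsupp:
  fixes c :: "'x \<Rightarrow> 'b set" and d :: "'v \<Rightarrow> 'b set"
  assumes inf: "infinite (UNIV :: 'b set)" and "inj c" "inj d"
  shows "\<exists>g :: ('x \<Rightarrow> 'v) \<Rightarrow> 'b set. inj_on g {f. finite {x. f x \<noteq> z}}"
proof -
  obtain b :: "nat \<Rightarrow> 'b" where b: "inj b"
    using infinite_countable_subset[OF inf] by (elim exE conjE)
  obtain h :: "(nat \<Rightarrow> 'b set) \<Rightarrow> 'b set" where h: "inj h"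
    using ex_inj_fun[OF inf b inj_on_id2[of UNIV]] by (elim exE)
  define pr where "pr = (\<lambda>(x, v). h (case_nat (c x) (\<lambda>_. d v)))"
  have "inj pr"
  proof (rule injI, clarify)
    fix x v x' v' assume "pr (x, v) = pr (x', v')"
    then have eq: "case_nat (c x) (\<lambda>_. d v) = case_nat (c x') (\<lambda>_. d v')" using h by (auto simp: pr_def inj_eq)
    show "x = x' \<and> v = v'" using fun_cong[OF eq, of 0] fun_cong[OF eq, of 1] assms by (simp add: inj_eq)
  qed
  then obtain l :: "('x \<times> 'v) list \<Rightarrow> 'b set" where l: "inj l" using ex_inj_list[OF inf] by blast
  define gr :: "('x \<Rightarrow> 'v) \<Rightarrow> ('x \<times> 'v) set" where "gr = (\<lambda>f. (\<lambda>x. (x, f x)) ` {x. f x \<noteq> z})"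
  define g where "g = (\<lambda>f. l (SOME xs. set xs = gr f))"
  have "f = f'" if "finite {x. f x \<noteq> z}" "finite {x. f' x \<noteq> z}" "g f = g f'" for f f'
  proof -
    have s: "set (SOME xs. set xs = gr k) = gr k" if "finite {x. k x \<noteq> z}" for k
      using someI_ex[OF finite_list[of "gr k"]] that by (simp add: gr_def)
    have "(SOME xs. set xs = gr f) = (SOME xs. set xs = gr f')" using that l by (simp add: g_def inj_eq)
    then have "gr f = gr f'" using s that by metis
    then have "\<And>x v. v \<noteq> z \<Longrightarrow> f x = v \<longleftrightarrow> f' x = v" unfolding gr_def by (auto simp: image_iff set_eq_iff)
    then show ?thesis by (metis ext)
  qed
  then show ?thesis by (intro exI[of _ g] inj_onI) auto
qed

section \<open>Baer's criterion\<close>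

definition extends_from_ideals :: "'a ring \<Rightarrow> ('a, 'm, 'c) module_scheme \<Rightarrow> bool" where
  "extends_from_ideals A I \<longleftrightarrow> (\<forall>J f. submodule J A (regular A) \<longrightarrow> f \<in> lmodule_hom A ((regular A)\<lparr>carrier := J\<rparr>) I \<longrightarrow>
     (\<exists>z\<in>carrier I. \<forall>x\<in>J. f x = x \<odot>\<^bsub>I\<^esub> z))"

text \<open>
  Partial homomorphisms from \<open>Y\<close> to \<open>I\<close>, represented by their graphs so that Zorn's lemma applies to
  inclusion. For a submodule of \<open>Y \<times> I\<close>, being single-valued at \<open>0\<close> is enough.
\<close>

definition hom_graph :: "'a ring \<Rightarrow> ('a, 'y, 'c) module_scheme \<Rightarrow> ('a, 'i, 'd) module_scheme \<Rightarrow> ('y \<times> 'i) set \<Rightarrow> bool" where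
  "hom_graph A Y I G \<longleftrightarrow> G \<subseteq> carrier Y \<times> carrier I \<and> (\<zero>\<^bsub>Y\<^esub>, \<zero>\<^bsub>I\<^esub>) \<in> G \<and>
     (\<forall>p q p' q'. (p, q) \<in> G \<longrightarrow> (p', q') \<in> G \<longrightarrow> (p \<oplus>\<^bsub>Y\<^esub> p', q \<oplus>\<^bsub>I\<^esub> q') \<in> G) \<and>
     (\<forall>a p q. a \<in> carrier A \<longrightarrow> (p, q) \<in> G \<longrightarrow> (a \<odot>\<^bsub>Y\<^esub> p, a \<odot>\<^bsub>I\<^esub> q) \<in> G) \<and>
     (\<forall>q. (\<zero>\<^bsub>Y\<^esub>, q) \<in> G \<longrightarrow> q = \<zero>\<^bsub>I\<^esub>)"

lemma hom_graphD:
  assumes "hom_graph A Y I G"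
  shows "(p, q) \<in> G \<Longrightarrow> p \<in> carrier Y" "(p, q) \<in> G \<Longrightarrow> q \<in> carrier I" "(\<zero>\<^bsub>Y\<^esub>, \<zero>\<^bsub>I\<^esub>) \<in> G"
    "(p, q) \<in> G \<Longrightarrow> (p', q') \<in> G \<Longrightarrow> (p \<oplus>\<^bsub>Y\<^esub> p', q \<oplus>\<^bsub>I\<^esub> q') \<in> G"
    "a \<in> carrier A \<Longrightarrow> (p, q) \<in> G \<Longrightarrow> (a \<odot>\<^bsub>Y\<^esub> p, a \<odot>\<^bsub>I\<^esub> q) \<in> G"
    "(\<zero>\<^bsub>Y\<^esub>, q) \<in> G \<Longrightarrow> q = \<zero>\<^bsub>I\<^esub>"
  using assms unfolding hom_graph_def by blast+

lemma hom_graph_unique: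
  assumes "lmodule A Y" "lmodule A I" "hom_graph A Y I G" "(p, q) \<in> G" "(p, q') \<in> G"
  shows "q = q'"
proof -
  interpret Y: lmodule A Y by fact
  interpret I: lmodule A I by fact
  note G = hom_graphD[OF assms(3)]
  have c: "p \<in> carrier Y" "q \<in> carrier I" "q' \<in> carrier I" using G(1,2) assms(4,5) by blast+
  have "((\<ominus>\<^bsub>A\<^esub> \<one>\<^bsub>A\<^esub>) \<odot>\<^bsub>Y\<^esub> p, (\<ominus>\<^bsub>A\<^esub> \<one>\<^bsub>A\<^esub>) \<odot>\<^bsub>I\<^esub> q') \<in> G" by (rule G(5)) (use assms in auto)
  from G(4)[OF assms(4) this] have "(\<zero>\<^bsub>Y\<^esub>, q \<ominus>\<^bsub>I\<^esub> q') \<in> G"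
    using c by (simp add: Y.smult_minus_left I.smult_minus_left a_minus_def Y.M.r_neg)
  from G(6)[OF this] show ?thesis using c I.M.minus_eq_zeroD by blast
qed

lemma hom_graph_Union_chain:
  assumes "C \<noteq> {}" "subset.chain {G. hom_graph A Y I G} C"
  shows "hom_graph A Y I (\<Union>C)"
proof -
  have g: "hom_graph A Y I G" if "G \<in> C" for G using assms(2) that by (auto simp: subset.chain_def)
  have c: "G \<subseteq> H \<or> H \<subseteq> G" if "G \<in> C" "H \<in> C" for G H
    using assms(2) that unfolding subset_chain_def by blast
  show ?thesis unfolding hom_graph_def
  proof (intro conjI allI impI)
    show "\<Union>C \<subseteq> carrier Y \<times> carrier I" using hom_graphD(1,2)[OF g] by auto
    show "(\<zero>\<^bsub>Y\<^esub>, \<zero>\<^bsub>I\<^esub>) \<in> \<Union>C" using hom_graphD(3)[OF g] assms(1) by blast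
  next
    fix p q p' q' assume "(p, q) \<in> \<Union>C" "(p', q') \<in> \<Union>C"
    then obtain G H where "G \<in> C" "(p, q) \<in> G" "H \<in> C" "(p', q') \<in> H" by blast
    then obtain K where "K \<in> C" "(p, q) \<in> K" "(p', q') \<in> K" using c[of G H] by blast
    then show "(p \<oplus>\<^bsub>Y\<^esub> p', q \<oplus>\<^bsub>I\<^esub> q') \<in> \<Union>C" using hom_graphD(4)[OF g] by blast
  next
    fix a p q assume "a \<in> carrier A" "(p, q) \<in> \<Union>C"
    then show "(a \<odot>\<^bsub>Y\<^esub> p, a \<odot>\<^bsub>I\<^esub> q) \<in> \<Union>C" using hom_graphD(5)[OF g] by blast
  next
    fix q assume "(\<zero>\<^bsub>Y\<^esub>, q) \<in> \<Union>C"
    then show "q = \<zero>\<^bsub>I\<^esub>" using hom_graphD(6)[OF g] by blast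
  qed
qed

text \<open>
  Take a maximal graph \<open>G\<close> that contains the graph of the given partial homomorphism. If \<open>y\<close> is an element
  of \<open>Y\<close>, the scalars \<open>a\<close> with \<open>a y\<close> in the domain of \<open>G\<close> form an ideal \<open>J\<close>, and \<open>a \<mapsto> G (a y)\<close> is multiplication
  with some \<open>z\<close> by assumption. Then \<open>G\<close> extends by \<open>y \<mapsto> z\<close>, so \<open>y\<close> was in the domain already. The lemma is used
  for \<open>A\<close> and for the integers.
\<close>

lemma baer:
  assumes Y: "lmodule A Y" and I: "lmodule A I" and ext: "extends_from_ideals A I"
    and X: "lmodule A X" and f: "f \<in> lmodule_hom A X Y" "inj_on f (carrier X)" and u: "u \<in> lmodule_hom A X I"
  obtains v where "v \<in> lmodule_hom A Y I" "\<And>x. x \<in> carrier X \<Longrightarrow> v (f x) = u x"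
proof -
  interpret Y: lmodule A Y by fact
  interpret I: lmodule A I by fact
  interpret Reg: lmodule A "regular A" by (rule lmodule_regular) (rule Y.R.ring_axioms)
  interpret f: lmodule_homo A X Y f by (intro lmodule_homoI X Y f)
  interpret u: lmodule_homo A X I u by (intro lmodule_homoI X I u)
  define G0 where "G0 = (\<lambda>x. (f x, u x)) ` carrier X"
  have G0: "hom_graph A Y I G0" unfolding hom_graph_def
  proof (intro conjI allI impI)
    show "(\<zero>\<^bsub>Y\<^esub>, \<zero>\<^bsub>I\<^esub>) \<in> G0" unfolding G0_def by (intro image_eqI[of _ _ "\<zero>\<^bsub>X\<^esub>"]) auto
  next
    fix p q p' q' assume "(p, q) \<in> G0" "(p', q') \<in> G0"
    then show "(p \<oplus>\<^bsub>Y\<^esub> p', q \<oplus>\<^bsub>I\<^esub> q') \<in> G0"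
      by (auto simp: G0_def f.add[symmetric] u.add[symmetric])
  next
    fix a p q assume "a \<in> carrier A" "(p, q) \<in> G0"
    then show "(a \<odot>\<^bsub>Y\<^esub> p, a \<odot>\<^bsub>I\<^esub> q) \<in> G0"
      by (auto simp: G0_def f.smult[symmetric] u.smult[symmetric])
  next
    fix q assume "(\<zero>\<^bsub>Y\<^esub>, q) \<in> G0"
    then obtain x where x: "x \<in> carrier X" "f x = \<zero>\<^bsub>Y\<^esub>" "q = u x" by (auto simp: G0_def)
    then have "x = \<zero>\<^bsub>X\<^esub>" by (intro f.eq_iff f)
    then show "q = \<zero>\<^bsub>I\<^esub>" using x by simp
  qed (auto simp: G0_def)
  have "\<exists>M\<in>{G. hom_graph A Y I G \<and> G0 \<subseteq> G}. \<forall>G\<in>{G. hom_graph A Y I G \<and> G0 \<subseteq> G}. M \<subseteq> G \<longrightarrow> G = M"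
  proof (rule subset_Zorn_nonempty)
    show "{G. hom_graph A Y I G \<and> G0 \<subseteq> G} \<noteq> {}" using G0 by blast
    fix C assume C: "C \<noteq> {}" "subset.chain {G. hom_graph A Y I G \<and> G0 \<subseteq> G} C"
    then have "subset.chain {G. hom_graph A Y I G} C" by (auto simp: subset_chain_def)
    moreover have "G0 \<subseteq> \<Union>C" using C unfolding subset_chain_def by blast
    ultimately show "\<Union>C \<in> {G. hom_graph A Y I G \<and> G0 \<subseteq> G}"
      using hom_graph_Union_chain[OF C(1)] by blast
  qed
  then obtain G where G': "G \<in> {G. hom_graph A Y I G \<and> G0 \<subseteq> G}"
    and max': "\<forall>H\<in>{G. hom_graph A Y I G \<and> G0 \<subseteq> G}. G \<subseteq> H \<longrightarrow> H = G" by (elim bexE)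
  have G: "hom_graph A Y I G" "G0 \<subseteq> G" using G' by simp_all
  have max: "H = G" if "hom_graph A Y I H" "G \<subseteq> H" for H
    using max' that order_trans[OF G(2) that(2)] by simp
  note GD = hom_graphD[OF G(1)]
  note Gu = hom_graph_unique[OF Y I G(1)]
  have dom: "\<exists>w. (y, w) \<in> G" if y: "y \<in> carrier Y" for y
  proof -
    define J where "J = {a \<in> carrier A. \<exists>w. (a \<odot>\<^bsub>Y\<^esub> y, w) \<in> G}"
    define h where "h = (\<lambda>a. THE w. (a \<odot>\<^bsub>Y\<^esub> y, w) \<in> G)"
    have h: "(a \<odot>\<^bsub>Y\<^esub> y, h a) \<in> G" if "a \<in> J" for a
    proof -
      obtain w where w: "(a \<odot>\<^bsub>Y\<^esub> y, w) \<in> G" using \<open>a \<in> J\<close> by (auto simp: J_def)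
      show ?thesis unfolding h_def by (rule theI[of _ w]) (use w Gu in auto)
    qed
    have J: "submodule J A (regular A)" unfolding submodule_iff[OF Reg.lmodule_axioms]
    proof (intro conjI ballI)
      show "\<zero>\<^bsub>regular A\<^esub> \<in> J" using GD(3) y by (auto simp: J_def)
      show "a \<oplus>\<^bsub>regular A\<^esub> b \<in> J" if "a \<in> J" "b \<in> J" for a b
        using GD(4)[OF h[OF that(1)] h[OF that(2)]] that y by (auto simp: J_def Y.smult_l_distr)
      show "c \<odot>\<^bsub>regular A\<^esub> a \<in> J" if "c \<in> carrier A" "a \<in> J" for a c
        using GD(5)[OF that(1) h[OF that(2)]] that y by (auto simp: J_def Y.smult_assoc1)
    qed (auto simp: J_def)
    have JA: "a \<in> carrier A" if "a \<in> J" for a using that by (simp add: J_def)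
    have "h \<in> lmodule_hom A ((regular A)\<lparr>carrier := J\<rparr>) I"
    proof (rule lmodule_homI)
      fix a b assume "a \<in> carrier ((regular A)\<lparr>carrier := J\<rparr>)" "b \<in> carrier ((regular A)\<lparr>carrier := J\<rparr>)"
      then have ab: "a \<in> J" "b \<in> J" "a \<oplus>\<^bsub>A\<^esub> b \<in> J" using J submodule_iff[OF Reg.lmodule_axioms] by auto
      have "((a \<oplus>\<^bsub>A\<^esub> b) \<odot>\<^bsub>Y\<^esub> y, h a \<oplus>\<^bsub>I\<^esub> h b) \<in> G"
        using GD(4)[OF h[OF ab(1)] h[OF ab(2)]] ab JA y by (simp add: Y.smult_l_distr)
      then show "h (a \<oplus>\<^bsub>(regular A)\<lparr>carrier := J\<rparr>\<^esub> b) = h a \<oplus>\<^bsub>I\<^esub> h b"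
        using Gu[OF _ h[OF ab(3)]] by simp
    next
      fix c a assume "c \<in> carrier A" "a \<in> carrier ((regular A)\<lparr>carrier := J\<rparr>)"
      then have ab: "c \<in> carrier A" "a \<in> J" "c \<otimes>\<^bsub>A\<^esub> a \<in> J" using J submodule_iff[OF Reg.lmodule_axioms] by auto
      have "((c \<otimes>\<^bsub>A\<^esub> a) \<odot>\<^bsub>Y\<^esub> y, c \<odot>\<^bsub>I\<^esub> h a) \<in> G"
        using GD(5)[OF ab(1) h[OF ab(2)]] ab JA y by (simp add: Y.smult_assoc1)
      then show "h (c \<odot>\<^bsub>(regular A)\<lparr>carrier := J\<rparr>\<^esub> a) = c \<odot>\<^bsub>I\<^esub> h a"
        using Gu[OF _ h[OF ab(3)]] by simp
    qed (use h GD(2) in auto)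
    then obtain z where z: "z \<in> carrier I" "\<And>x. x \<in> J \<Longrightarrow> h x = x \<odot>\<^bsub>I\<^esub> z"
      using ext J unfolding extends_from_ideals_def by meson
    define H where "H = {(p \<oplus>\<^bsub>Y\<^esub> a \<odot>\<^bsub>Y\<^esub> y, q \<oplus>\<^bsub>I\<^esub> a \<odot>\<^bsub>I\<^esub> z) | p q a. (p, q) \<in> G \<and> a \<in> carrier A}"
    have "hom_graph A Y I H" unfolding hom_graph_def
    proof (intro conjI allI impI)
      show "H \<subseteq> carrier Y \<times> carrier I" using GD(1,2) y z(1) by (auto simp: H_def)
      show "(\<zero>\<^bsub>Y\<^esub>, \<zero>\<^bsub>I\<^esub>) \<in> H" unfolding H_def mem_Collect_eq
        by (rule exI[of _ "\<zero>\<^bsub>Y\<^esub>"], rule exI[of _ "\<zero>\<^bsub>I\<^esub>"], rule exI[of _ "\<zero>\<^bsub>A\<^esub>"]) (use GD(3) y z(1) in simp)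
    next
      fix p q p' q' assume "(p, q) \<in> H" "(p', q') \<in> H"
      then obtain r s a r' s' a' where e: "p = r \<oplus>\<^bsub>Y\<^esub> a \<odot>\<^bsub>Y\<^esub> y" "q = s \<oplus>\<^bsub>I\<^esub> a \<odot>\<^bsub>I\<^esub> z"
        "p' = r' \<oplus>\<^bsub>Y\<^esub> a' \<odot>\<^bsub>Y\<^esub> y" "q' = s' \<oplus>\<^bsub>I\<^esub> a' \<odot>\<^bsub>I\<^esub> z"
        and G': "(r, s) \<in> G" "(r', s') \<in> G" "a \<in> carrier A" "a' \<in> carrier A"
        unfolding H_def by blast
      note c = GD(1)[OF G'(1)] GD(1)[OF G'(2)] GD(2)[OF G'(1)] GD(2)[OF G'(2)]
      have "p \<oplus>\<^bsub>Y\<^esub> p' = (r \<oplus>\<^bsub>Y\<^esub> r') \<oplus>\<^bsub>Y\<^esub> (a \<oplus>\<^bsub>A\<^esub> a') \<odot>\<^bsub>Y\<^esub> y"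
        using c G'(3,4) y by (simp add: e Y.smult_l_distr Y.M.a_ac)
      moreover have "q \<oplus>\<^bsub>I\<^esub> q' = (s \<oplus>\<^bsub>I\<^esub> s') \<oplus>\<^bsub>I\<^esub> (a \<oplus>\<^bsub>A\<^esub> a') \<odot>\<^bsub>I\<^esub> z"
        using c G'(3,4) z(1) by (simp add: e I.smult_l_distr I.M.a_ac)
      ultimately show "(p \<oplus>\<^bsub>Y\<^esub> p', q \<oplus>\<^bsub>I\<^esub> q') \<in> H"
        using GD(4)[OF G'(1,2)] G'(3,4) unfolding H_def by blast
    next
      fix b p q assume b: "b \<in> carrier A" and "(p, q) \<in> H"
      then obtain r s a where e: "p = r \<oplus>\<^bsub>Y\<^esub> a \<odot>\<^bsub>Y\<^esub> y" "q = s \<oplus>\<^bsub>I\<^esub> a \<odot>\<^bsub>I\<^esub> z"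
        and G': "(r, s) \<in> G" "a \<in> carrier A"
        unfolding H_def by blast
      note c = GD(1)[OF G'(1)] GD(2)[OF G'(1)]
      have "b \<odot>\<^bsub>Y\<^esub> p = b \<odot>\<^bsub>Y\<^esub> r \<oplus>\<^bsub>Y\<^esub> (b \<otimes>\<^bsub>A\<^esub> a) \<odot>\<^bsub>Y\<^esub> y"
        using c G'(2) y b by (simp add: e Y.smult_r_distr Y.smult_assoc1)
      moreover have "b \<odot>\<^bsub>I\<^esub> q = b \<odot>\<^bsub>I\<^esub> s \<oplus>\<^bsub>I\<^esub> (b \<otimes>\<^bsub>A\<^esub> a) \<odot>\<^bsub>I\<^esub> z"
        using c G'(2) z(1) b by (simp add: e I.smult_r_distr I.smult_assoc1)
      ultimately show "(b \<odot>\<^bsub>Y\<^esub> p, b \<odot>\<^bsub>I\<^esub> q) \<in> H"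
        using GD(5)[OF b G'(1)] G'(2) b unfolding H_def by blast
    next
      fix q assume "(\<zero>\<^bsub>Y\<^esub>, q) \<in> H"
      then obtain r s a where e: "\<zero>\<^bsub>Y\<^esub> = r \<oplus>\<^bsub>Y\<^esub> a \<odot>\<^bsub>Y\<^esub> y" "q = s \<oplus>\<^bsub>I\<^esub> a \<odot>\<^bsub>I\<^esub> z"
        and G': "(r, s) \<in> G" "a \<in> carrier A"
        unfolding H_def by blast
      note c = GD(1)[OF G'(1)] GD(2)[OF G'(1)]
      have "a \<odot>\<^bsub>Y\<^esub> y = \<ominus>\<^bsub>Y\<^esub> r" using c e(1) G'(2) y
        by (metis Y.M.add.inv_unique' Y.M.a_comm Y.smult_closed Y.M.minus_equality)
      also have "\<dots> = (\<ominus>\<^bsub>A\<^esub> \<one>\<^bsub>A\<^esub>) \<odot>\<^bsub>Y\<^esub> r" using c by (simp add: Y.smult_minus_left)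
      finally have "(a \<odot>\<^bsub>Y\<^esub> y, (\<ominus>\<^bsub>A\<^esub> \<one>\<^bsub>A\<^esub>) \<odot>\<^bsub>I\<^esub> s) \<in> G" using GD(5)[OF _ G'(1)] by simp
      then have aJ: "a \<in> J" using G'(2) by (auto simp: J_def)
      then have "(r \<oplus>\<^bsub>Y\<^esub> a \<odot>\<^bsub>Y\<^esub> y, s \<oplus>\<^bsub>I\<^esub> a \<odot>\<^bsub>I\<^esub> z) \<in> G" using GD(4)[OF G'(1) h] z(2) by simp
      then show "q = \<zero>\<^bsub>I\<^esub>" using GD(6) e by simp
    qed
    moreover have "G \<subseteq> H"
    proof clarify
      fix p q assume pq: "(p, q) \<in> G"
      then show "(p, q) \<in> H" unfolding H_def mem_Collect_eq
        by (intro exI[of _ p] exI[of _ q] exI[of _ "\<zero>\<^bsub>A\<^esub>"]) (use GD(1,2)[OF pq] y z(1) in simp)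
    qed
    moreover have "(y, z) \<in> H" unfolding H_def mem_Collect_eq
      by (rule exI[of _ "\<zero>\<^bsub>Y\<^esub>"], rule exI[of _ "\<zero>\<^bsub>I\<^esub>"], rule exI[of _ "\<one>\<^bsub>A\<^esub>"]) (use GD(3) y z(1) in simp)
    ultimately show ?thesis using max[of H] by blast
  qed
  define v where "v = (\<lambda>y. THE w. (y, w) \<in> G)"
  have v: "(y, v y) \<in> G" if y: "y \<in> carrier Y" for y
  proof -
    obtain w where w: "(y, w) \<in> G" using dom[OF y] by auto
    show ?thesis unfolding v_def by (rule theI[of _ w]) (use w Gu in auto)
  qed
  show ?thesis
  proof
    show "v \<in> lmodule_hom A Y I"
    proof (rule lmodule_homI)
      show "v x \<in> carrier I" if "x \<in> carrier Y" for x using v[OF that] GD(2) by blast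
      show "v (x \<oplus>\<^bsub>Y\<^esub> y) = v x \<oplus>\<^bsub>I\<^esub> v y" if "x \<in> carrier Y" "y \<in> carrier Y" for x y
        by (rule Gu[OF v GD(4)[OF v v]]) (use that in auto)
      show "v (a \<odot>\<^bsub>Y\<^esub> y) = a \<odot>\<^bsub>I\<^esub> v y" if "a \<in> carrier A" "y \<in> carrier Y" for a y
        by (rule Gu[OF v GD(5)[OF _ v]]) (use that in auto)
    qed
    show "v (f x) = u x" if "x \<in> carrier X" for x
      by (rule Gu[OF v]) (use that G(2) in \<open>auto simp: G0_def\<close>)
  qed
qed

section \<open>Divisible groups\<close>

lemma ring_int: "ring int_ring"
  using int_is_cring by (simp add: cring_def)

definition divisible :: "(int, 'm, 'c) module_scheme \<Rightarrow> bool" where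
  "divisible D \<longleftrightarrow> (\<forall>x\<in>carrier D. \<forall>n. n \<noteq> 0 \<longrightarrow> (\<exists>y\<in>carrier D. n \<odot>\<^bsub>D\<^esub> y = x))"

text \<open>
  A nonzero ideal of the integers is generated by its least positive element \<open>n\<close>, and \<open>f\<close> is multiplication
  with any \<open>z\<close> that satisfies \<open>n z = f n\<close>.
\<close>

lemma divisible_imp_extends_from_ideals:
  assumes "lmodule int_ring D" "divisible D" shows "extends_from_ideals int_ring D"
  unfolding extends_from_ideals_def
proof (intro allI impI)
  fix J f assume J: "submodule J int_ring (regular int_ring)"
    and f: "f \<in> lmodule_hom int_ring ((regular int_ring)\<lparr>carrier := J\<rparr>) D"
  interpret D: lmodule int_ring D by fact
  interpret J: lsubmodule int_ring "regular int_ring" J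
    by (rule lsubmoduleI[OF lmodule_regular[OF ring_int] J])
  have J0: "0 \<in> J" and Ja: "\<And>x y. x \<in> J \<Longrightarrow> y \<in> J \<Longrightarrow> x + y \<in> J" and Jm: "\<And>a x. x \<in> J \<Longrightarrow> a * x \<in> J"
    using J.sub_closed by auto
  interpret f: lmodule_homo int_ring "(regular int_ring)\<lparr>carrier := J\<rparr>" D f
    by (intro lmodule_homoI J.lmodule_sub assms f)
  show "\<exists>z\<in>carrier D. \<forall>x\<in>J. f x = x \<odot>\<^bsub>D\<^esub> z"
  proof (cases "J = {0}")
    case True
    then show ?thesis using f.zero by (intro bexI[of _ "\<zero>\<^bsub>D\<^esub>"]) auto
  next
    case False
    then obtain x where x: "x \<in> J" "x \<noteq> 0" using J0 by blast
    then have "int (nat \<bar>x\<bar>) \<in> J \<and> nat \<bar>x\<bar> > 0" using Jm[of x "-1"] by (auto simp: abs_if)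
    define n where "n = (LEAST n. int n \<in> J \<and> n > 0)"
    have n: "int n \<in> J" "n > 0" unfolding n_def by (rule LeastI2[of _ "nat \<bar>x\<bar>"], fact, simp)+
    have least: "m \<ge> n" if "int m \<in> J" "m > 0" for m unfolding n_def using that by (intro Least_le) auto
    have "f (int n) \<in> carrier D" using f.closed[of "int n"] n by simp
    then obtain z where z: "z \<in> carrier D" "int n \<odot>\<^bsub>D\<^esub> z = f (int n)"
      using assms(2)[unfolded divisible_def, rule_format, of "f (int n)" "int n"] n by auto
    have "f x = x \<odot>\<^bsub>D\<^esub> z" if x: "x \<in> J" for x
    proof -
      have "x mod int n = x + (- (x div int n)) * int n" by (simp add: minus_div_mult_eq_mod[symmetric])
      then have "x mod int n \<in> J" using x n Ja Jm by metis
      moreover have pos: "0 \<le> x mod int n" "x mod int n < int n" using n by simp_all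
      ultimately have "\<not> 0 < x mod int n" using least[of "nat (x mod int n)"] by fastforce
      then have "x mod int n = 0" using pos by linarith
      then have x': "x = (x div int n) * int n" by (metis add.right_neutral div_mult_mod_eq)
      have "f x = (x div int n) \<odot>\<^bsub>D\<^esub> f (int n)"
        using f.smult[of "x div int n" "int n"] n x' by simp
      also have "\<dots> = ((x div int n) \<otimes>\<^bsub>int_ring\<^esub> int n) \<odot>\<^bsub>D\<^esub> z"
        using z D.smult_assoc1[of "x div int n" "int n" z] by simp
      finally show ?thesis using x' by simp
    qed
    then show ?thesis using z by blast
  qed
qed

definition int_module :: "('a, 'm, 'c) module_scheme \<Rightarrow> (int, 'm) module" where
  "int_module N = \<lparr>carrier = carrier N, monoid.mult = undefined, one = undefined, zero = \<zero>\<^bsub>N\<^esub>, add = add N,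
     smult = (\<lambda>k x. add_pow N k x)\<rparr>"

lemma int_module_simps [simp]: "carrier (int_module N) = carrier N" "\<zero>\<^bsub>int_module N\<^esub> = \<zero>\<^bsub>N\<^esub>" "add (int_module N) = add N"
  by (auto simp: int_module_def)

lemma lmodule_int_module: assumes "lmodule A N" shows "lmodule int_ring (int_module N)"
proof -
  interpret N: lmodule A N by fact
  have "abelian_group (int_module N)"
    by (rule abelian_groupI)
      (auto simp: N.M.a_ac intro!: bexI[of _ "\<ominus>\<^bsub>N\<^esub> x" for x] N.M.r_neg)
  then show ?thesis
    by (intro lmodule.intro lmodule_axioms.intro ring_int)
      (auto simp: int_module_def N.M.add.int_pow_mult N.M.add.int_pow_distrib N.M.add.int_pow_pow mult.commute)
qed

lemma additive_imp_int_hom: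
  assumes M: "lmodule int_ring M" and N: "lmodule int_ring N"
    and c: "\<And>x. x \<in> carrier M \<Longrightarrow> f x \<in> carrier N"
    and add: "\<And>x y. x \<in> carrier M \<Longrightarrow> y \<in> carrier M \<Longrightarrow> f (x \<oplus>\<^bsub>M\<^esub> y) = f x \<oplus>\<^bsub>N\<^esub> f y"
  shows "f \<in> lmodule_hom int_ring M N"
proof (rule lmodule_homI)
  interpret M: lmodule int_ring M by fact
  interpret N: lmodule int_ring N by fact
  fix a x assume x: "x \<in> carrier M"
  have f0: "f \<zero>\<^bsub>M\<^esub> = \<zero>\<^bsub>N\<^esub>"
    using add[of "\<zero>\<^bsub>M\<^esub>" "\<zero>\<^bsub>M\<^esub>"] c by (metis M.M.zero_closed M.M.l_zero N.M.add.r_cancel_one')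
  have nn: "f (int n \<odot>\<^bsub>M\<^esub> x) = int n \<odot>\<^bsub>N\<^esub> f x" for n
  proof (induction n)
    case (Suc n)
    have "int (Suc n) \<odot>\<^bsub>M\<^esub> x = int n \<odot>\<^bsub>M\<^esub> x \<oplus>\<^bsub>M\<^esub> x"
      using M.smult_l_distr[of "int n" 1 x] M.smult_one[OF x] x by (simp add: algebra_simps)
    moreover have "int (Suc n) \<odot>\<^bsub>N\<^esub> f x = int n \<odot>\<^bsub>N\<^esub> f x \<oplus>\<^bsub>N\<^esub> f x"
      using N.smult_l_distr[of "int n" 1 "f x"] N.smult_one[OF c[OF x]] c[OF x] by (simp add: algebra_simps)
    ultimately show ?case using Suc M.smult_closed[of "int n" x] x by (simp add: assms(4))
  qed (use M.smult_zero_left N.smult_zero_left x c f0 in simp)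
  have fm: "f (\<ominus>\<^bsub>M\<^esub> y) = \<ominus>\<^bsub>N\<^esub> f y" if "y \<in> carrier M" for y
    using add[of "\<ominus>\<^bsub>M\<^esub> y" y] that c f0 by (simp add: M.M.l_neg N.M.minus_equality)
  have neg: "- k = \<ominus>\<^bsub>int_ring\<^esub> k" for k
    by (rule abelian_group.minus_equality[OF ring.is_abelian_group[OF ring_int], symmetric]) auto
  show "f (a \<odot>\<^bsub>M\<^esub> x) = a \<odot>\<^bsub>N\<^esub> f x"
  proof (cases a rule: int_cases2)
    case (nonneg n) then show ?thesis using nn by simp
  next
    case (nonpos n)
    then show ?thesis using nn[of n] x c[OF x] fm[of "int n \<odot>\<^bsub>M\<^esub> x"] M.smult_closed[of "int n" x]
        M.smult_minus_left[of "int n" x] N.smult_minus_left[of "int n" "f x"] neg[of "int n"]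
      by simp
  qed
qed (use c add in auto)


section \<open>Enough injective modules\<close>

text \<open>
  The parameter \<open>z\<close> is the zero of the coefficients.
\<close>

definition single :: "'a \<Rightarrow> 'a \<Rightarrow> 'x \<Rightarrow> 'x \<Rightarrow> 'a" where
  "single z a x = (\<lambda>y. if y = x then a else z)"

text \<open>
  The canonical map from the free module on the elements of \<open>N\<close> onto \<open>N\<close>; again \<open>z\<close> is the zero of the
  coefficients.
\<close>

definition fsupp_eval :: "('a, 'm, 'c) module_scheme \<Rightarrow> 'a \<Rightarrow> ('m \<Rightarrow> 'a) \<Rightarrow> 'm" where
  "fsupp_eval N z f = finsum N (\<lambda>x. f x \<odot>\<^bsub>N\<^esub> x) {x. f x \<noteq> z}"

lemma fsupp_eval:
  assumes N: "lmodule A N"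
  shows fsupp_eval_hom: "fsupp_eval N \<zero>\<^bsub>A\<^esub> \<in> lmodule_hom A (fsupp (carrier N) (regular A)) N"
    and single_closed: "x \<in> carrier N \<Longrightarrow> single \<zero>\<^bsub>A\<^esub> \<one>\<^bsub>A\<^esub> x \<in> carrier (fsupp (carrier N) (regular A))"
    and fsupp_eval_single: "x \<in> carrier N \<Longrightarrow> fsupp_eval N \<zero>\<^bsub>A\<^esub> (single \<zero>\<^bsub>A\<^esub> \<one>\<^bsub>A\<^esub> x) = x"
proof -
  interpret N: lmodule A N by fact
  let ?F = "fsupp (carrier N) (regular A)"
  have sup: "fsupp_eval N \<zero>\<^bsub>A\<^esub> f = finsum N (\<lambda>x. f x \<odot>\<^bsub>N\<^esub> x) S"
    if f: "f \<in> carrier ?F" "finite S" "S \<subseteq> carrier N" "{x. f x \<noteq> \<zero>\<^bsub>A\<^esub>} \<subseteq> S" for f S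
    unfolding fsupp_eval_def using f
    by (intro N.M.add.finprod_mono_neutral_cong_left) (auto simp: fsupp_carrier subset_iff)
  have suppN: "{x. f x \<noteq> \<zero>\<^bsub>A\<^esub>} \<subseteq> carrier N" "finite {x. f x \<noteq> \<zero>\<^bsub>A\<^esub>}" if "f \<in> carrier ?F" for f
    using that by (auto simp: fsupp_carrier)
  interpret F: lmodule A ?F by (intro lmodule_fsupp lmodule_regular N.R.ring_axioms)
  show "fsupp_eval N \<zero>\<^bsub>A\<^esub> \<in> lmodule_hom A ?F N"
  proof (rule lmodule_homI)
    fix f assume f: "f \<in> carrier ?F"
    show "fsupp_eval N \<zero>\<^bsub>A\<^esub> f \<in> carrier N" unfolding fsupp_eval_def
      using f by (intro N.M.finsum_closed) (auto simp: fsupp_carrier)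
  next
    fix f g assume fg: "f \<in> carrier ?F" "g \<in> carrier ?F"
    let ?S = "{x. f x \<noteq> \<zero>\<^bsub>A\<^esub>} \<union> {x. g x \<noteq> \<zero>\<^bsub>A\<^esub>}"
    have S: "finite ?S" "?S \<subseteq> carrier N" using suppN[OF fg(1)] suppN[OF fg(2)] by auto
    have c: "f x \<in> carrier A" "g x \<in> carrier A" for x using fg by (auto simp: fsupp_carrier)
    have "fsupp_eval N \<zero>\<^bsub>A\<^esub> (f \<oplus>\<^bsub>?F\<^esub> g) = finsum N (\<lambda>x. (f \<oplus>\<^bsub>?F\<^esub> g) x \<odot>\<^bsub>N\<^esub> x) ?S"
      by (rule sup[OF F.M.a_closed[OF fg] S]) (use c in auto)
    also have "\<dots> = finsum N (\<lambda>x. f x \<odot>\<^bsub>N\<^esub> x \<oplus>\<^bsub>N\<^esub> g x \<odot>\<^bsub>N\<^esub> x) ?S"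
      using S(2) c by (intro N.M.finsum_cong') (auto simp: N.smult_l_distr subset_iff)
    also have "\<dots> = finsum N (\<lambda>x. f x \<odot>\<^bsub>N\<^esub> x) ?S \<oplus>\<^bsub>N\<^esub> finsum N (\<lambda>x. g x \<odot>\<^bsub>N\<^esub> x) ?S"
      using S(2) c by (intro N.M.finsum_addf) (auto simp: subset_iff)
    also have "\<dots> = fsupp_eval N \<zero>\<^bsub>A\<^esub> f \<oplus>\<^bsub>N\<^esub> fsupp_eval N \<zero>\<^bsub>A\<^esub> g"
      using sup[OF fg(1) S] sup[OF fg(2) S] by auto
    finally show "fsupp_eval N \<zero>\<^bsub>A\<^esub> (f \<oplus>\<^bsub>?F\<^esub> g) = fsupp_eval N \<zero>\<^bsub>A\<^esub> f \<oplus>\<^bsub>N\<^esub> fsupp_eval N \<zero>\<^bsub>A\<^esub> g" .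
  next
    fix a f assume a: "a \<in> carrier A" and f: "f \<in> carrier ?F"
    let ?S = "{x. f x \<noteq> \<zero>\<^bsub>A\<^esub>}"
    note S = suppN[OF f]
    have c: "f x \<in> carrier A" for x using f by (auto simp: fsupp_carrier)
    have h: "(\<lambda>y. a \<odot>\<^bsub>N\<^esub> y) \<in> hom (add_monoid N) (add_monoid N)"
      using a by (auto simp: hom_def N.smult_r_distr)
    have sum: "finsum N (\<lambda>x. a \<odot>\<^bsub>N\<^esub> (f x \<odot>\<^bsub>N\<^esub> x)) T = a \<odot>\<^bsub>N\<^esub> finsum N (\<lambda>x. f x \<odot>\<^bsub>N\<^esub> x) T"
      if "finite T" "T \<subseteq> carrier N" for T
      using that
    proof (induction T)
      case (insert x T)
      then have "(\<lambda>x. f x \<odot>\<^bsub>N\<^esub> x) \<in> T \<rightarrow> carrier N" using c by (auto simp: subset_iff)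
      then show ?case using insert a c
        by (simp add: N.M.finsum_insert N.smult_r_distr subset_iff Pi_def)
    qed (use a in simp)
    have "fsupp_eval N \<zero>\<^bsub>A\<^esub> (a \<odot>\<^bsub>?F\<^esub> f) = finsum N (\<lambda>x. (a \<odot>\<^bsub>?F\<^esub> f) x \<odot>\<^bsub>N\<^esub> x) ?S"
      by (rule sup[OF F.smult_closed[OF a f] S(2,1)]) (use a in auto)
    also have "\<dots> = finsum N (\<lambda>x. a \<odot>\<^bsub>N\<^esub> (f x \<odot>\<^bsub>N\<^esub> x)) ?S"
      using S(1) c a by (intro N.M.finsum_cong') (auto simp: N.smult_assoc1 subset_iff)
    also have "\<dots> = a \<odot>\<^bsub>N\<^esub> fsupp_eval N \<zero>\<^bsub>A\<^esub> f" unfolding fsupp_eval_def by (rule sum[OF S(2,1)])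
    finally show "fsupp_eval N \<zero>\<^bsub>A\<^esub> (a \<odot>\<^bsub>?F\<^esub> f) = a \<odot>\<^bsub>N\<^esub> fsupp_eval N \<zero>\<^bsub>A\<^esub> f" .
  qed
  show s: "single \<zero>\<^bsub>A\<^esub> \<one>\<^bsub>A\<^esub> x \<in> carrier ?F" if "x \<in> carrier N" for x
    using that by (auto simp: fsupp_carrier single_def)
  show "fsupp_eval N \<zero>\<^bsub>A\<^esub> (single \<zero>\<^bsub>A\<^esub> \<one>\<^bsub>A\<^esub> x) = x" if x: "x \<in> carrier N" for x
  proof -
    have "fsupp_eval N \<zero>\<^bsub>A\<^esub> (single \<zero>\<^bsub>A\<^esub> \<one>\<^bsub>A\<^esub> x) = finsum N (\<lambda>y. single \<zero>\<^bsub>A\<^esub> \<one>\<^bsub>A\<^esub> x y \<odot>\<^bsub>N\<^esub> y) {x}"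
      by (rule sup[OF s]) (use x in \<open>auto simp: single_def\<close>)
    then show ?thesis using x by (simp add: single_def)
  qed
qed

definition rat_module :: "(int, rat) module" where
  "rat_module = \<lparr>carrier = UNIV, monoid.mult = undefined, one = undefined, zero = 0, add = (+),
     smult = (\<lambda>k x. of_int k * x)\<rparr>"

lemma rat_module_simps [simp]: "carrier rat_module = UNIV" "\<zero>\<^bsub>rat_module\<^esub> = 0"
  "x \<oplus>\<^bsub>rat_module\<^esub> y = x + y" "k \<odot>\<^bsub>rat_module\<^esub> x = of_int k * x"
  by (auto simp: rat_module_def)

lemma lmodule_rat_module: "lmodule int_ring rat_module"
proof -
  have "abelian_group rat_module"
    by (rule abelian_groupI) (auto intro: exI[of _ "- x" for x])
  then show ?thesis
    by (intro lmodule.intro lmodule_axioms.intro ring_int) (auto simp: algebra_simps)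
qed

text \<open>
  Write \<open>N\<close> as the free abelian group on its elements modulo the relations, and replace integral by rational
  coefficients: the quotient of the rational vector space by the same relations is divisible and contains
  \<open>N\<close>. Its elements are represented by functions of finite support, which bounds its size.
\<close>

lemma divisible_embedding:
  fixes N :: "(int, 'n) module"
  assumes N: "lmodule int_ring N"
  obtains Q :: "(int, 'n \<Rightarrow> rat) module" and j where "lmodule int_ring Q" "divisible Q"
    "j \<in> lmodule_hom int_ring N Q" "inj_on j (carrier N)" "carrier Q \<subseteq> {f. finite {x. f x \<noteq> 0}}"
proof -
  let ?Z = "fsupp (carrier N) (regular int_ring)" and ?Q = "fsupp (carrier N) rat_module"
  interpret N: lmodule int_ring N by fact
  have lZ: "lmodule int_ring ?Z" by (intro lmodule_fsupp lmodule_regular ring_int)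
  have lQ: "lmodule int_ring ?Q" by (intro lmodule_fsupp lmodule_rat_module)
  let ?ev = "fsupp_eval N 0"
  interpret ev: lmodule_homo int_ring ?Z N ?ev
    using fsupp_eval_hom[OF N] by (intro lmodule_homoI lZ N) simp
  define \<iota> :: "('n \<Rightarrow> int) \<Rightarrow> 'n \<Rightarrow> rat" where "\<iota> = (\<lambda>f x. of_int (f x))"
  interpret \<iota>: lmodule_homo int_ring ?Z ?Q \<iota>
    by (intro lmodule_homoI lZ lQ lmodule_homI)
      (auto simp: fsupp_carrier \<iota>_def)
  have \<iota>_inj: "f = g" if "\<iota> f = \<iota> g" for f g using that by (simp add: \<iota>_def fun_eq_iff)
  have "\<exists>(Q :: (int, 'n \<Rightarrow> rat) module) \<pi>. lmodule_homo int_ring ?Q Q \<pi> \<and> \<pi> ` carrier ?Q = carrier Q \<and>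
      lmodule_ker ?Q Q \<pi> = \<iota> ` lmodule_ker ?Z N ?ev \<and> carrier Q \<subseteq> carrier ?Q"
    by (rule quotient_exists[OF lQ \<iota>.submodule_image[OF ev.submodule_ker]]) (intro exI conjI, assumption+)
  then obtain Q :: "(int, 'n \<Rightarrow> rat) module" and \<pi> where
    \<pi>: "lmodule_homo int_ring ?Q Q \<pi>" "\<pi> ` carrier ?Q = carrier Q"
    "lmodule_ker ?Q Q \<pi> = \<iota> ` lmodule_ker ?Z N ?ev" "carrier Q \<subseteq> carrier ?Q" by (elim exE conjE)
  interpret \<pi>: lmodule_homo int_ring ?Q Q \<pi> by fact
  \<comment> \<open>the relations were chosen such that integral combinations are identified exactly when they agree in \<open>N\<close>\<close>
  have ker: "\<pi> (\<iota> f) = \<zero>\<^bsub>Q\<^esub> \<longleftrightarrow> ?ev f = \<zero>\<^bsub>N\<^esub>" if f: "f \<in> carrier ?Z" for f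
  proof -
    have "\<pi> (\<iota> f) = \<zero>\<^bsub>Q\<^esub> \<longleftrightarrow> \<iota> f \<in> lmodule_ker ?Q Q \<pi>" using f by (simp add: lmodule_ker_def)
    also have "\<dots> \<longleftrightarrow> f \<in> lmodule_ker ?Z N ?ev" unfolding \<pi>(3) using \<iota>_inj by blast
    finally show ?thesis using f by (simp add: lmodule_ker_def)
  qed
  have eq: "\<pi> (\<iota> f) = \<pi> (\<iota> g) \<longleftrightarrow> ?ev f = ?ev g" if fg: "f \<in> carrier ?Z" "g \<in> carrier ?Z" for f g
  proof -
    have c: "f \<ominus>\<^bsub>?Z\<^esub> g \<in> carrier ?Z" using fg by simp
    have d: "\<pi> (\<iota> (f \<ominus>\<^bsub>?Z\<^esub> g)) = \<pi> (\<iota> f) \<ominus>\<^bsub>Q\<^esub> \<pi> (\<iota> g)" using fg by (simp only: \<iota>.diff \<pi>.diff \<iota>.closed)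
    have e: "?ev (f \<ominus>\<^bsub>?Z\<^esub> g) = ?ev f \<ominus>\<^bsub>N\<^esub> ?ev g" using fg by (rule ev.diff)
    note cl = \<pi>.closed[OF \<iota>.closed[OF fg(1)]] \<pi>.closed[OF \<iota>.closed[OF fg(2)]]
      ev.closed[OF fg(1)] ev.closed[OF fg(2)]
    show ?thesis using ker[OF c] unfolding d e
      using cl \<pi>.N.M.minus_eq_zeroD N.M.minus_eq_zeroD
      by (metis \<pi>.N.M.r_neg N.M.r_neg a_minus_def)
  qed
  define s where "s = (\<lambda>x::'n. single (0::int) 1 x)"
  have s: "s x \<in> carrier ?Z" "?ev (s x) = x" if "x \<in> carrier N" for x
    using single_closed[OF N that] fsupp_eval_single[OF N that] by (simp_all add: s_def)
  define j where "j = (\<lambda>x. \<pi> (\<iota> (s x)))"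
  have "j \<in> lmodule_hom int_ring N Q"
  proof (rule lmodule_homI)
    show "j x \<in> carrier Q" if "x \<in> carrier N" for x
      unfolding j_def by (intro \<pi>.closed \<iota>.closed s that)
    fix x y assume xy: "x \<in> carrier N" "y \<in> carrier N"
    have "j x \<oplus>\<^bsub>Q\<^esub> j y = \<pi> (\<iota> (s x \<oplus>\<^bsub>?Z\<^esub> s y))"
      unfolding j_def using s xy by (simp only: \<iota>.add \<pi>.add \<iota>.closed)
    also have "\<dots> = j (x \<oplus>\<^bsub>N\<^esub> y)" unfolding j_def
    proof (subst eq)
      show "s x \<oplus>\<^bsub>?Z\<^esub> s y \<in> carrier ?Z" using s xy ev.M.M.a_closed by blast
    qed (use s xy in \<open>simp_all only: ev.add N.M.a_closed\<close>)
    finally show "j (x \<oplus>\<^bsub>N\<^esub> y) = j x \<oplus>\<^bsub>Q\<^esub> j y" by simp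
  next
    fix a x assume ax: "a \<in> carrier int_ring" "x \<in> carrier N"
    have "a \<odot>\<^bsub>Q\<^esub> j x = \<pi> (\<iota> (a \<odot>\<^bsub>?Z\<^esub> s x))"
      unfolding j_def using s ax by (simp only: \<iota>.smult \<pi>.smult \<iota>.closed ev.M.smult_closed UNIV_I int_Zcarr)
    also have "\<dots> = j (a \<odot>\<^bsub>N\<^esub> x)" unfolding j_def
    proof (subst eq)
      show "a \<odot>\<^bsub>?Z\<^esub> s x \<in> carrier ?Z" using s ax ev.M.smult_closed by blast
    qed (use s ax in \<open>simp_all only: ev.smult N.smult_closed UNIV_I int_Zcarr\<close>)
    finally show "j (a \<odot>\<^bsub>N\<^esub> x) = a \<odot>\<^bsub>Q\<^esub> j x" by simp
  qed
  moreover have "inj_on j (carrier N)"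
    unfolding j_def by (rule inj_onI) (use s eq in metis)
  moreover have "divisible Q" unfolding divisible_def
  proof (intro ballI allI impI)
    fix x and n :: int assume x: "x \<in> carrier Q" and n: "n \<noteq> 0"
    obtain f where f: "f \<in> carrier ?Q" "x = \<pi> f" using x \<pi>(2) by blast
    let ?g = "\<lambda>y. f y / of_int n"
    have g: "?g \<in> carrier ?Q" using f(1) n by (auto simp: fsupp_carrier)
    have "f = n \<odot>\<^bsub>?Q\<^esub> ?g" using n by (simp add: fun_eq_iff)
    then have "n \<odot>\<^bsub>Q\<^esub> \<pi> ?g = x" using \<pi>.smult[OF UNIV_I g] f by metis
    then show "\<exists>y\<in>carrier Q. n \<odot>\<^bsub>Q\<^esub> y = x" using g by blast
  qed
  moreover have "carrier Q \<subseteq> {f. finite {x. f x \<noteq> 0}}" using \<pi>(4) by (auto simp: fsupp_carrier)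
  ultimately show ?thesis using \<pi>.N.lmodule_axioms by (intro that)
qed

text \<open>
  The module of additive maps from \<open>A\<close> to \<open>D\<close>, on which \<open>A\<close> acts from the left through right multiplication of
  the arguments. The maps vanish off the carrier of \<open>A\<close>, so that equality of elements is equality of functions.
\<close>

definition coinduced :: "'a ring \<Rightarrow> (int, 'd) module \<Rightarrow> ('a, 'a \<Rightarrow> 'd) module" where
  "coinduced A D = \<lparr>carrier = {h. (\<forall>a\<in>carrier A. h a \<in> carrier D) \<and> (\<forall>a. a \<notin> carrier A \<longrightarrow> h a = \<zero>\<^bsub>D\<^esub>) \<and>
       (\<forall>a\<in>carrier A. \<forall>b\<in>carrier A. h (a \<oplus>\<^bsub>A\<^esub> b) = h a \<oplus>\<^bsub>D\<^esub> h b)},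
     monoid.mult = undefined, one = undefined, zero = (\<lambda>a. \<zero>\<^bsub>D\<^esub>), add = (\<lambda>g h a. g a \<oplus>\<^bsub>D\<^esub> h a),
     smult = (\<lambda>b h a. if a \<in> carrier A then h (a \<otimes>\<^bsub>A\<^esub> b) else \<zero>\<^bsub>D\<^esub>)\<rparr>"

lemma coinduced_simps [simp]:
  "\<zero>\<^bsub>coinduced A D\<^esub> = (\<lambda>a. \<zero>\<^bsub>D\<^esub>)" "g \<oplus>\<^bsub>coinduced A D\<^esub> h = (\<lambda>a. g a \<oplus>\<^bsub>D\<^esub> h a)"
  "b \<odot>\<^bsub>coinduced A D\<^esub> h = (\<lambda>a. if a \<in> carrier A then h (a \<otimes>\<^bsub>A\<^esub> b) else \<zero>\<^bsub>D\<^esub>)"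
  by (auto simp: coinduced_def)

lemma coinduced_carrier:
  "h \<in> carrier (coinduced A D) \<longleftrightarrow> (\<forall>a\<in>carrier A. h a \<in> carrier D) \<and> (\<forall>a. a \<notin> carrier A \<longrightarrow> h a = \<zero>\<^bsub>D\<^esub>) \<and>
       (\<forall>a\<in>carrier A. \<forall>b\<in>carrier A. h (a \<oplus>\<^bsub>A\<^esub> b) = h a \<oplus>\<^bsub>D\<^esub> h b)"
  by (simp add: coinduced_def)

lemma lmodule_coinduced:
  assumes "ring A" "lmodule int_ring D" shows "lmodule A (coinduced A D)"
proof -
  interpret A: ring A by fact
  interpret D: lmodule int_ring D by fact
  have v: "h a \<in> carrier D" if "h \<in> carrier (coinduced A D)" for h a
    using that by (cases "a \<in> carrier A") (auto simp: coinduced_carrier)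
  have "abelian_group (coinduced A D)"
  proof (rule abelian_groupI)
    fix h assume h: "h \<in> carrier (coinduced A D)"
    show "\<exists>y\<in>carrier (coinduced A D). y \<oplus>\<^bsub>coinduced A D\<^esub> h = \<zero>\<^bsub>coinduced A D\<^esub>"
      by (rule bexI[of _ "\<lambda>a. \<ominus>\<^bsub>D\<^esub> h a"])
        (use h v[OF h] in \<open>auto simp: coinduced_carrier D.M.l_neg D.M.minus_add\<close>)
  next
    fix g h assume "g \<in> carrier (coinduced A D)" "h \<in> carrier (coinduced A D)"
    then show "g \<oplus>\<^bsub>coinduced A D\<^esub> h \<in> carrier (coinduced A D)" by (auto simp: coinduced_carrier D.M.a_ac)
  qed (auto simp: v D.M.a_ac, auto simp: coinduced_carrier)
  moreover have "b \<odot>\<^bsub>coinduced A D\<^esub> h \<in> carrier (coinduced A D)" if "b \<in> carrier A" "h \<in> carrier (coinduced A D)" for b h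
    using that by (auto simp: coinduced_carrier A.l_distr)
  ultimately show ?thesis
    by (intro lmodule.intro lmodule_axioms.intro A.ring_axioms)
      (auto simp: A.r_distr A.m_assoc coinduced_carrier fun_eq_iff)
qed

text \<open>
  Evaluation at \<open>1\<close> makes homomorphisms to \<open>coinduced A D\<close> correspond to additive maps to \<open>D\<close>, and
  additive maps to a divisible group extend by Baer's criterion over the integers.
\<close>

lemma coinduced_extend:
  assumes A: "ring A" and D: "lmodule int_ring D" "divisible D"
    and X: "lmodule A X" and Y: "lmodule A Y"
    and f: "f \<in> lmodule_hom A X Y" "inj_on f (carrier X)" and u: "u \<in> lmodule_hom A X (coinduced A D)"
  obtains v where "v \<in> lmodule_hom A Y (coinduced A D)" "\<And>x. x \<in> carrier X \<Longrightarrow> v (f x) = u x"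
proof -
  interpret A: ring A by fact
  interpret X: lmodule A X by fact
  interpret Y: lmodule A Y by fact
  interpret D: lmodule int_ring D by fact
  interpret u: lmodule_homo A X "coinduced A D" u
    by (intro lmodule_homoI X lmodule_coinduced[OF A D(1)] u)
  interpret f: lmodule_homo A X Y f by (intro lmodule_homoI X Y f)
  have f': "f \<in> lmodule_hom int_ring (int_module X) (int_module Y)"
    by (intro additive_imp_int_hom lmodule_int_module[OF X] lmodule_int_module[OF Y]) (auto simp: f.add)
  have uc: "u x a \<in> carrier D" if "x \<in> carrier X" "a \<in> carrier A" for x a
    using u.closed[OF that(1)] that by (simp add: coinduced_carrier)
  have u': "(\<lambda>x. u x \<one>\<^bsub>A\<^esub>) \<in> lmodule_hom int_ring (int_module X) D"
    by (intro additive_imp_int_hom lmodule_int_module[OF X] D) (auto simp: u.add uc)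
  obtain w where w: "w \<in> lmodule_hom int_ring (int_module Y) D"
    and wf: "\<And>x. x \<in> carrier X \<Longrightarrow> w (f x) = u x \<one>\<^bsub>A\<^esub>"
    using baer[OF lmodule_int_module[OF Y] D(1) divisible_imp_extends_from_ideals[OF D] lmodule_int_module[OF X] f' _ u'] f(2)
    by auto
  have wc: "w y \<in> carrier D" if "y \<in> carrier Y" for y using lmodule_hom_closed[OF w] that by simp
  have wa: "w (y \<oplus>\<^bsub>Y\<^esub> y') = w y \<oplus>\<^bsub>D\<^esub> w y'" if "y \<in> carrier Y" "y' \<in> carrier Y" for y y'
    using lmodule_hom_add[OF w, of y y'] that by simp
  define v where "v = (\<lambda>y a. if a \<in> carrier A then w (a \<odot>\<^bsub>Y\<^esub> y) else \<zero>\<^bsub>D\<^esub>)"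
  show ?thesis
  proof
    show "v \<in> lmodule_hom A Y (coinduced A D)"
      by (rule lmodule_homI)
        (auto simp: v_def coinduced_carrier wc wa Y.smult_l_distr Y.smult_r_distr Y.smult_assoc1 fun_eq_iff)
    fix x assume x: "x \<in> carrier X"
    show "v (f x) = u x"
    proof
      fix a show "v (f x) a = u x a"
      proof (cases "a \<in> carrier A")
        case True
        then have "v (f x) a = u (a \<odot>\<^bsub>X\<^esub> x) \<one>\<^bsub>A\<^esub>" using x by (simp add: v_def wf flip: f.smult)
        then show ?thesis using x True by (simp add: u.smult)
      next
        case False
        then show ?thesis using u.closed[OF x] by (simp add: v_def coinduced_carrier)
      qed
    qed
  qed
qed

lemma ex_inj_nat_ring:
  fixes c :: "'a \<Rightarrow> 'b" assumes inf: "infinite (UNIV :: 'b set)" and c: "inj c"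
  shows "\<exists>g :: (nat \<Rightarrow> 'a) \<Rightarrow> 'b set. inj g"
proof -
  obtain b :: "nat \<Rightarrow> 'b" where b: "inj b" using infinite_countable_subset[OF inf] by (elim exE conjE)
  show ?thesis by (rule ex_inj_fun[OF inf b, of "\<lambda>a. {c a}"]) (use c in \<open>auto simp: inj_def\<close>)
qed

lemma injective_lmoduleI:
  fixes I :: "('a, 'u) module"
  assumes "lmodule A I"
    and "\<And>(X :: ('a, 'u) module) (Y :: ('a, 'u) module) f g. \<lbrakk>lmodule A X; lmodule A Y; f \<in> lmodule_hom A X Y;
      inj_on f (carrier X); g \<in> lmodule_hom A X I\<rbrakk> \<Longrightarrow> \<exists>h\<in>lmodule_hom A Y I. \<forall>x\<in>carrier X. h (f x) = g x"
  shows "injective_lmodule A I"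
  using assms unfolding injective_lmodule_def by blast

text \<open>
  The embedding is \<open>x \<mapsto> (a \<mapsto> i (a x))\<close> with \<open>i\<close> the inclusion of \<open>N\<close> in a divisible group \<open>D\<close>. Here \<open>D\<close> is no larger
  than the sets over \<open>'b\<close>, and \<open>A\<close> embeds into \<open>'b\<close>, so the maps from \<open>A\<close> to \<open>D\<close> fit into the same universe.
\<close>

lemma enough_injectives:
  fixes c :: "'a \<Rightarrow> 'b" and N :: "('a, 'b set) module"
  assumes inf: "infinite (UNIV :: 'b set)" and c: "inj c" and N: "lmodule A N"
  obtains I :: "('a, 'b set) module" and e where "injective_lmodule A I" "e \<in> lmodule_hom A N I"
    "inj_on e (carrier N)"
proof -
  interpret N: lmodule A N by fact
  note A = N.R.ring_axioms
  obtain b :: "nat \<Rightarrow> 'b" where b: "inj b" using infinite_countable_subset[OF inf] by (elim exE conjE)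
  have "inj (\<lambda>q::rat. {b (to_nat q)})" by (auto simp: inj_eq[OF b] intro!: injI)
  then obtain g1 :: "('b set \<Rightarrow> rat) \<Rightarrow> 'b set" where g1: "inj_on g1 {f. finite {x. f x \<noteq> 0}}"
    using ex_inj_fsupp[OF inf inj_on_id2[of UNIV], of _ 0] by blast
  obtain Q :: "(int, 'b set \<Rightarrow> rat) module" and j where Q: "lmodule int_ring Q" "divisible Q"
    "j \<in> lmodule_hom int_ring (int_module N) Q" "inj_on j (carrier (int_module N))" "carrier Q \<subseteq> {f. finite {x. f x \<noteq> 0}}"
    by (rule divisible_embedding[OF lmodule_int_module[OF N]])
  have g1Q: "inj_on g1 (carrier Q)" using g1 Q(5) by (rule inj_on_subset)
  define D where "D = transport g1 Q"
  interpret g1: lmodule_homo int_ring Q D g1 unfolding D_def by (rule transport_hom[OF Q(1) g1Q])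
  have D: "lmodule int_ring D" by (rule g1.N.lmodule_axioms)
  have "divisible D" unfolding divisible_def
  proof (intro ballI allI impI)
    fix x and n :: int assume "x \<in> carrier D" and n: "n \<noteq> 0"
    then obtain q where q: "q \<in> carrier Q" "x = g1 q" by (auto simp: D_def)
    then obtain y where "y \<in> carrier Q" "n \<odot>\<^bsub>Q\<^esub> y = q" using Q(2) n unfolding divisible_def by blast
    then show "\<exists>y\<in>carrier D. n \<odot>\<^bsub>D\<^esub> y = x" using q g1.smult[of n y] g1.closed by auto
  qed
  note D = D this
  define i where "i = (\<lambda>x. g1 (j x))"
  have i: "i \<in> lmodule_hom int_ring (int_module N) D" unfolding i_def by (rule lmodule_hom_comp[OF Q(3) g1.hom])
  have ic: "i x \<in> carrier D" if "x \<in> carrier N" for x using lmodule_hom_closed[OF i] that by simp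
  have ia: "i (x \<oplus>\<^bsub>N\<^esub> y) = i x \<oplus>\<^bsub>D\<^esub> i y" if "x \<in> carrier N" "y \<in> carrier N" for x y
    using lmodule_hom_add[OF i, of x y] that by simp
  have ii: "x = y" if "x \<in> carrier N" "y \<in> carrier N" "i x = i y" for x y
  proof -
    have "j x \<in> carrier Q" "j y \<in> carrier Q" using lmodule_hom_closed[OF Q(3)] that by auto
    then have "j x = j y" using inj_onD[OF g1Q] that(3) by (simp add: i_def)
    then show ?thesis using inj_onD[OF Q(4)] that by simp
  qed
  let ?C = "coinduced A D"
  have C: "lmodule A ?C" by (rule lmodule_coinduced[OF A D(1)])
  define k where "k = (\<lambda>x a. if a \<in> carrier A then i (a \<odot>\<^bsub>N\<^esub> x) else \<zero>\<^bsub>D\<^esub>)"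
  have k: "k \<in> lmodule_hom A N ?C"
    by (rule lmodule_homI)
      (auto simp: k_def coinduced_carrier ic ia N.smult_l_distr N.smult_r_distr N.smult_assoc1 fun_eq_iff)
  have kinj: "inj_on k (carrier N)"
  proof (rule inj_onI)
    fix x y assume xy: "x \<in> carrier N" "y \<in> carrier N" "k x = k y"
    show "x = y" using fun_cong[OF xy(3), of "\<one>\<^bsub>A\<^esub>"] xy(1,2) ii by (simp add: k_def)
  qed
  obtain g2 :: "('a \<Rightarrow> 'b set) \<Rightarrow> 'b set" where g2: "inj g2"
    using ex_inj_fun[OF inf c inj_on_id2[of UNIV]] by (elim exE)
  have g2C: "inj_on g2 (carrier ?C)" using g2 by (rule inj_on_subset) simp
  define I where "I = transport g2 ?C"
  let ?h = "inv_into (carrier ?C) g2"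
  interpret g2: lmodule_homo A ?C I g2 unfolding I_def by (rule transport_hom[OF C g2C])
  interpret h: lmodule_homo A I ?C ?h unfolding I_def by (rule transport_hom[OF C g2C])
  have "injective_lmodule A I"
  proof (rule injective_lmoduleI)
    fix X Y :: "('a, 'b set) module" and f g
    assume XY: "lmodule A X" "lmodule A Y" "f \<in> lmodule_hom A X Y" "inj_on f (carrier X)"
      and g: "g \<in> lmodule_hom A X I"
    have "\<exists>v\<in>lmodule_hom A Y ?C. \<forall>x\<in>carrier X. v (f x) = ?h (g x)"
      by (rule coinduced_extend[OF A D XY lmodule_hom_comp[OF g h.hom]]) blast
    then obtain v where v: "v \<in> lmodule_hom A Y ?C" "\<And>x. x \<in> carrier X \<Longrightarrow> v (f x) = ?h (g x)" by blast
    show "\<exists>h\<in>lmodule_hom A Y I. \<forall>x\<in>carrier X. h (f x) = g x"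
    proof (rule bexI[OF _ lmodule_hom_comp[OF v(1) g2.hom]], rule ballI)
      fix x assume x: "x \<in> carrier X"
      have "g x \<in> g2 ` carrier ?C" using lmodule_hom_closed[OF g x] by (simp add: I_def)
      then show "g2 (v (f x)) = g x" using v(2)[OF x] by (simp add: f_inv_into_f)
    qed
  qed (rule g2.N.lmodule_axioms)
  moreover have "(\<lambda>x. g2 (k x)) \<in> lmodule_hom A N I" by (rule lmodule_hom_comp[OF k g2.hom])
  moreover have "inj_on (\<lambda>x. g2 (k x)) (carrier N)"
    using kinj g2 by (auto simp: inj_on_def)
  ultimately show ?thesis by (rule that)
qed

section \<open>Injective dimension\<close>

text \<open>
  The argument of type \<open>itself\<close> fixes the universe in which the resolution lives.
\<close>

definition has_inj_res :: "'a ring \<Rightarrow> ('a, 'm, 'c) module_scheme \<Rightarrow> ('a, 'u) module itself \<Rightarrow> nat \<Rightarrow> bool" where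
  "has_inj_res A N t n \<longleftrightarrow> (\<exists>(I :: nat \<Rightarrow> ('a, 'u) module) d e.
     injective_resolution A N I d e \<and> (\<forall>i>n. carrier (I i) = {\<zero>\<^bsub>I i\<^esub>}))"

lemma zero_injective:
  fixes I :: "('a, 'u) module"
  assumes I: "lmodule A I" and z: "carrier I = {\<zero>\<^bsub>I\<^esub>}" shows "injective_lmodule A I"
proof (rule injective_lmoduleI)
  interpret I: lmodule A I by fact
  fix X Y :: "('a, 'u) module" and f g assume "lmodule A X" "lmodule A Y" "f \<in> lmodule_hom A X Y" and g: "g \<in> lmodule_hom A X I"
  show "\<exists>h\<in>lmodule_hom A Y I. \<forall>x\<in>carrier X. h (f x) = g x"
  proof (rule bexI[of _ "\<lambda>_. \<zero>\<^bsub>I\<^esub>"], rule ballI)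
    show "\<zero>\<^bsub>I\<^esub> = g x" if "x \<in> carrier X" for x using lmodule_hom_closed[OF g that] z by simp
    show "(\<lambda>_. \<zero>\<^bsub>I\<^esub>) \<in> lmodule_hom A Y I" by (rule lmodule_homI) auto
  qed
qed (rule I)

lemma has_inj_res_0:
  fixes I :: "('a, 'u) module"
  assumes I: "injective_lmodule A I" shows "has_inj_res A I TYPE(('a, 'u) module) 0"
proof -
  have lI: "lmodule A I" using I by (simp add: injective_lmodule_def)
  interpret I: lmodule A I by fact
  define Z where "Z = I\<lparr>carrier := {\<zero>\<^bsub>I\<^esub>}\<rparr>"
  have lZ: "lmodule A Z" unfolding Z_def by (rule lmodule_submodule[OF lI submodule_zero[OF lI]])
  then interpret Z: lmodule A Z .
  have Zs: "carrier Z = {\<zero>\<^bsub>I\<^esub>}" "zero Z = zero I" by (simp_all add: Z_def)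
  have injZ: "injective_lmodule A Z" by (rule zero_injective[OF lZ]) (simp add: Zs)
  define J where "J = case_nat I (\<lambda>_. Z)"
  have J: "J 0 = I" "J (Suc i) = Z" for i by (simp_all add: J_def)
  have z: "(\<lambda>_. \<zero>\<^bsub>I\<^esub>) \<in> lmodule_hom A (J i) (J (Suc j))" for i j
    unfolding J by (rule lmodule_homI) (use Z.smult_zero_right Z.M.r_zero Z.M.zero_closed in \<open>auto simp: Zs\<close>)
  have injJ: "injective_lmodule A (J i)" for i using I injZ by (cases i) (auto simp: J)
  have car: "carrier (J (Suc i)) = {\<zero>\<^bsub>I\<^esub>}" "\<zero>\<^bsub>J i\<^esub> = \<zero>\<^bsub>I\<^esub>" for i
    using Zs by (cases i; simp add: J)+
  have ne: "carrier (J i) \<noteq> {}" for i using I.M.zero_closed by (cases i) (auto simp: J Zs)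
  have "injective_resolution A I J (\<lambda>_ _. \<zero>\<^bsub>I\<^esub>) (\<lambda>x. x)"
    unfolding injective_resolution_def
  proof (intro conjI allI)
    show "(\<lambda>x. x) \<in> lmodule_hom A I (J 0)" by (rule lmodule_homI) (auto simp: J)
    show "(\<lambda>x. x) ` carrier I = lmodule_ker (J 0) (J 1) (\<lambda>_. \<zero>\<^bsub>I\<^esub>)"
      by (auto simp: lmodule_ker_def car J(1))
    show "(\<lambda>_. \<zero>\<^bsub>I\<^esub>) ` carrier (J i) = lmodule_ker (J (Suc i)) (J (Suc (Suc i))) (\<lambda>_. \<zero>\<^bsub>I\<^esub>)" for i
      using ne[of i] by (auto simp: lmodule_ker_def car)
  qed (use z injJ in auto)
  moreover have "carrier (J i) = {\<zero>\<^bsub>J i\<^esub>}" if "i > 0" for i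
    using that car by (cases i) auto
  ultimately show ?thesis unfolding has_inj_res_def by blast
qed

lemma has_inj_res_Suc:
  fixes I :: "('a, 'u) module" and C :: "('a, 'u) module"
  assumes ses: "short_exact A N I C \<alpha> \<pi>" and I: "injective_lmodule A I"
    and C: "has_inj_res A C TYPE(('a, 'u) module) n"
  shows "has_inj_res A N TYPE(('a, 'u) module) (Suc n)"
proof -
  interpret short_exact A N I C \<alpha> \<pi> by fact
  obtain J :: "nat \<Rightarrow> ('a, 'u) module" and d e where J: "injective_resolution A C J d e"
    "\<forall>i>n. carrier (J i) = {\<zero>\<^bsub>J i\<^esub>}" using C unfolding has_inj_res_def by blast
  note Jd = J(1)[unfolded injective_resolution_def]
  let ?J = "case_nat I J" and ?d = "case_nat (\<lambda>x. e (\<pi> x)) d"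
  have e: "e \<in> lmodule_hom A C (J 0)" "inj_on e (carrier C)" using Jd by blast+
  have lJ0: "lmodule A (J 0)" using Jd by (auto simp: injective_lmodule_def)
  interpret e: lmodule_homo A C "J 0" e by (intro lmodule_homoI lJ0 e p.N.lmodule_axioms)
  have "injective_resolution A N ?J ?d \<alpha>"
    unfolding injective_resolution_def
  proof (intro conjI allI)
    show "injective_lmodule A (?J i)" for i using I Jd by (cases i) auto
    show "?d i \<in> lmodule_hom A (?J i) (?J (Suc i))" for i
      using Jd lmodule_hom_comp[OF p.hom e(1)] by (cases i) auto
    have "e (\<pi> x) = \<zero>\<^bsub>J 0\<^esub> \<longleftrightarrow> \<pi> x = \<zero>\<^bsub>C\<^esub>" if "x \<in> carrier I" for x
      using e.eq_iff[OF e(2)] that by auto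
    then show "\<alpha> ` carrier N = lmodule_ker (?J 0) (?J 1) (?d 0)"
      unfolding exact by (auto simp: lmodule_ker_def)
    show "?d i ` carrier (?J i) = lmodule_ker (?J (Suc i)) (?J (Suc (Suc i))) (?d (Suc i))" for i
    proof (cases i)
      case 0
      have "(\<lambda>x. e (\<pi> x)) ` carrier I = e ` carrier C" by (simp add: image_image flip: surj)
      then show ?thesis using Jd 0 by simp
    qed (use Jd in simp)
  qed (use i.hom inj in auto)
  moreover have "carrier (?J i) = {\<zero>\<^bsub>?J i\<^esub>}" if "i > Suc n" for i
    using that J(2) by (cases i) auto
  ultimately show ?thesis unfolding has_inj_res_def by blast
qed

text \<open>
  Generators \<open>g\<close> of the ideal \<open>J\<close> form the first matrix, with one column, of a free resolution. The images
  \<open>f (g i)\<close> satisfy all relations between the generators, so they are a cycle; a preimage of it is a single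
  element \<open>z\<close> with \<open>f (g i) = g i z\<close>.
\<close>

lemma ext_vanishes_0_extends_from_ideals:
  assumes A: "ring A" "left_noetherian A" and N: "lmodule A N" and "ext_vanishes A N 0"
  shows "extends_from_ideals A N"
  unfolding extends_from_ideals_def
proof (intro allI impI)
  fix J f assume J: "submodule J A (regular A)" and f: "f \<in> lmodule_hom A ((regular A)\<lparr>carrier := J\<rparr>) N"
  interpret A: ring A by fact
  interpret N: lmodule A N by fact
  have reg: "lmodule A (regular A)" by (rule lmodule_regular[OF A(1)])
  interpret J: lsubmodule A "regular A" J by (rule lsubmoduleI[OF reg J])
  interpret f: lmodule_homo A "(regular A)\<lparr>carrier := J\<rparr>" N f
    by (intro lmodule_homoI J.lmodule_sub N f)
  obtain q g where g: "\<And>i. i < q \<Longrightarrow> g i \<in> J" "J = (\<lambda>a. lin_comb (regular A) q a g) ` vecs A q"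
    using fg_sub_span[OF reg J] A J left_noetherian_iff[OF A(1)] by metis
  have gA: "g i \<in> carrier A" if "i < q" for i using J.sub_closed(1)[OF g(1)[OF that]] by simp
  define E where "E = (\<lambda>i (j::nat). g i)"
  have E: "E \<in> mats A q 1" using gA by (auto simp: E_def)
  obtain k D where D: "free_res A k D" "k 0 = 1" "k 1 = q" "D 0 = E" by (rule free_res_exists[OF A E])
  have ex: "col_exact N 1 q (k 2) E (D 1)"
    using ext_vanishesD[OF assms(4) D(1), of 0] D by (simp add: numeral_2_eq_2)
  have D1: "D 1 \<in> mats A (k 2) q" using free_resD(1)[OF D(1), of 1] D by (simp add: numeral_2_eq_2)
  have fg: "(\<lambda>i. f (g i)) \<in> vecs N q" using g(1) f.closed by auto
  have gJ: "g \<in> vecs ((regular A)\<lparr>carrier := J\<rparr>) q" using g(1) by auto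
  have map: "f (lin_comb (regular A) q a g) = lin_comb N q a (\<lambda>i. f (g i))" if "a \<in> vecs A q" for a
    using f.map_lin_comb[OF that gJ] by simp
  have "lin_comb N q (D 1 i) (\<lambda>i. f (g i)) = \<zero>\<^bsub>N\<^esub>" if i: "i < k 2" for i
  proof -
    have "lin_comb (regular A) q (D 1 i) g = \<zero>\<^bsub>A\<^esub>"
      using free_resD(2)[OF D(1), of 0] i D by (simp add: prod_zero_def numeral_2_eq_2 E_def)
    then show ?thesis using map[OF matsD[OF D1 i]] f.zero by simp
  qed
  then obtain z where z: "z \<in> vecs N 1" "\<And>i. i < q \<Longrightarrow> f (g i) = lin_comb N 1 (E i) z"
    using col_exactD[OF ex fg] by blast
  have z0: "z 0 \<in> carrier N" using z(1) by auto
  have fgz: "f (g i) = g i \<odot>\<^bsub>N\<^esub> z 0" if "i < q" for i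
    using z(2)[OF that] z0 gA[OF that] by (simp add: E_def)
  interpret z: lmodule_homo A "regular A" N "\<lambda>a. a \<odot>\<^bsub>N\<^esub> z 0"
    by (intro lmodule_homoI reg N lmodule_homI)
      (use z0 in \<open>auto simp: N.smult_l_distr N.smult_assoc1\<close>)
  have "f x = x \<odot>\<^bsub>N\<^esub> z 0" if "x \<in> J" for x
  proof -
    obtain a where a: "a \<in> vecs A q" "x = lin_comb (regular A) q a g" using \<open>x \<in> J\<close> g(2) by auto
    have "f x = lin_comb N q a (\<lambda>i. g i \<odot>\<^bsub>N\<^esub> z 0)" unfolding a(2) map[OF a(1)] by (rule lin_comb_cong) (auto simp: fgz)
    also have "\<dots> = x \<odot>\<^bsub>N\<^esub> z 0" unfolding a(2) by (rule z.map_lin_comb[symmetric]) (use a gA in auto)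
    finally show ?thesis .
  qed
  then show "\<exists>z\<in>carrier N. \<forall>x\<in>J. f x = x \<odot>\<^bsub>N\<^esub> z" using z0 by blast
qed

text \<open>
  Embed \<open>N\<close> into an injective module; \<open>ext_vanishes_quot\<close> lowers the bound by one for the cokernel. When the bound
  is \<open>0\<close>, the module itself is injective.
\<close>

lemma ext_vanishes_imp_has_inj_res:
  fixes c :: "'a \<Rightarrow> 'b" and N :: "('a, 'b set) module"
  assumes inf: "infinite (UNIV :: 'b set)" and c: "inj c" and A: "ring A" "left_noetherian A"
    and N: "lmodule A N" and "ext_vanishes A N n"
  shows "has_inj_res A N TYPE(('a, 'b set) module) n"
  using N \<open>ext_vanishes A N n\<close>
proof (induction n arbitrary: N)
  case (0 N)
  have "injective_lmodule A N"
  proof (rule injective_lmoduleI)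
    fix X Y :: "('a, 'b set) module" and f g
    assume X: "lmodule A X" and Y: "lmodule A Y" and f: "f \<in> lmodule_hom A X Y" "inj_on f (carrier X)"
      and g: "g \<in> lmodule_hom A X N"
    show "\<exists>h\<in>lmodule_hom A Y N. \<forall>x\<in>carrier X. h (f x) = g x"
      by (rule baer[OF Y 0(1) ext_vanishes_0_extends_from_ideals[OF A 0] X f g]) blast
  qed (rule 0)
  then show ?case by (rule has_inj_res_0)
next
  case (Suc n N)
  obtain I :: "('a, 'b set) module" and e where I: "injective_lmodule A I" "e \<in> lmodule_hom A N I"
    "inj_on e (carrier N)" by (rule enough_injectives[OF inf c Suc(2)])
  have lI: "lmodule A I" using I by (simp add: injective_lmodule_def)
  interpret e: lmodule_homo A N I e by (intro lmodule_homoI lI Suc I)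
  have "\<exists>(C :: ('a, 'b set) module) \<pi>. lmodule_homo A I C \<pi> \<and> \<pi> ` carrier I = carrier C \<and>
      lmodule_ker I C \<pi> = e ` carrier N"
    by (rule quotient_exists[OF lI e.submodule_image[OF submodule_carrier[OF Suc(2)]]])
      (intro exI conjI, assumption+)
  then obtain C :: "('a, 'b set) module" and \<pi> where C: "lmodule_homo A I C \<pi>"
    "\<pi> ` carrier I = carrier C" "lmodule_ker I C \<pi> = e ` carrier N" by (elim exE conjE)
  have ses: "short_exact A N I C e \<pi>"
    by (intro short_exact.intro short_exact_axioms.intro e.lmodule_homo_axioms C I) (simp add: C)
  interpret \<pi>: lmodule_homo A I C \<pi> by fact
  obtain g :: "(nat \<Rightarrow> 'a) \<Rightarrow> 'b set" where g: "inj g" using ex_inj_nat_ring[OF inf c] by (elim exE)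
  have "ext_vanishes A I n"
    using extends_homs_imp_ext_vanishes[OF A(1) lI injective_imp_extends_homs[OF I(1) g]] by (rule ext_vanishes_mono) simp
  then have "ext_vanishes A C n" using Suc(3) by (rule short_exact.ext_vanishes_quot[OF ses])
  then have "has_inj_res A C TYPE(('a, 'b set) module) n" by (rule Suc.IH[OF \<pi>.N.lmodule_axioms])
  then show ?case by (rule has_inj_res_Suc[OF ses I(1)])
qed

lemma infinite_univ: "infinite (UNIV :: ('a + 'm + nat) set)"
  by (simp add: finite_Plus_UNIV_iff flip: UNIV_Plus_UNIV)

lemma inj_dim_finite_resolution:
  assumes "inj_dim A N < \<infinity>"
  obtains I :: "nat \<Rightarrow> ('a, ('a, 'm) univ) module" and d e n where
    "injective_resolution A (N :: ('a, 'm, 'c) module_scheme) I d e" "\<And>i. i > n \<Longrightarrow> carrier (I i) = {\<zero>\<^bsub>I i\<^esub>}"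
proof -
  let ?S = "{enat n | n. \<exists>(P :: nat \<Rightarrow> ('a, ('a, 'm) univ) module) d e.
       injective_resolution A N P d e \<and> (\<forall>i>n. carrier (P i) = {\<zero>\<^bsub>P i\<^esub>})}"
  have "?S \<noteq> {}"
  proof
    assume "?S = {}"
    then have "inj_dim A N = Inf {}" unfolding inj_dim_def by (rule arg_cong)
    then show False using assms by (simp add: top_enat_def)
  qed
  then show ?thesis using that by blast
qed

lemma proj_dim_finite_resolution:
  assumes "proj_dim A N < \<infinity>"
  obtains I :: "nat \<Rightarrow> ('a, ('a, 'm) univ) module" and d e n where
    "projective_resolution A (N :: ('a, 'm, 'c) module_scheme) I d e" "\<And>i. i > n \<Longrightarrow> carrier (I i) = {\<zero>\<^bsub>I i\<^esub>}"
proof -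
  let ?S = "{enat n | n. \<exists>(P :: nat \<Rightarrow> ('a, ('a, 'm) univ) module) d e.
       projective_resolution A N P d e \<and> (\<forall>i>n. carrier (P i) = {\<zero>\<^bsub>P i\<^esub>})}"
  have "?S \<noteq> {}"
  proof
    assume "?S = {}"
    then have "proj_dim A N = Inf {}" unfolding proj_dim_def by (rule arg_cong)
    then show False using assms by (simp add: top_enat_def)
  qed
  then show ?thesis using that by blast
qed

lemma inj_dim_imp_ext_vanishes:
  assumes N: "lmodule A (N :: ('a, 'm, 'c) module_scheme)" and "inj_dim A N < \<infinity>"
  shows "\<exists>n. ext_vanishes A N n"
proof -
  obtain I :: "nat \<Rightarrow> ('a, ('a, 'm) univ) module" and d e n where
    I: "injective_resolution A N I d e" "\<And>i. i > n \<Longrightarrow> carrier (I i) = {\<zero>\<^bsub>I i\<^esub>}"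
    using inj_dim_finite_resolution[OF assms(2)] by metis
  note R = I(1)[unfolded injective_resolution_def]
  obtain g :: "(nat \<Rightarrow> 'a) \<Rightarrow> ('a, 'm) univ" where g: "inj g"
    using ex_inj_nat_ring[OF infinite_univ inj_Inl] by blast
  have "ext_vanishes A N (Suc n)"
    by (rule finite_coresolution_ext_vanishes[where J = I and e = e and d = d, OF N])
      (use R I(2) injective_imp_extends_homs[OF _ g] in \<open>auto simp: injective_lmodule_def\<close>)
  then show ?thesis by blast
qed

lemma ext_vanishes_imp_inj_dim:
  assumes A: "ring A" "left_noetherian A" and N: "lmodule A (N :: ('a, 'm, 'c) module_scheme)" and n: "ext_vanishes A N n"
  shows "inj_dim A N < \<infinity>"
proof -
  define g :: "'m \<Rightarrow> ('a, 'm) univ" where "g = (\<lambda>x. {Inr (Inl x)})"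
  have g: "inj_on g (carrier N)" by (auto simp: inj_on_def g_def)
  let ?h = "inv_into (carrier N) g"
  interpret g: lmodule_homo A N "transport g N" g by (rule transport_hom[OF N g])
  interpret h: lmodule_homo A "transport g N" N ?h by (rule transport_hom[OF N g])
  have "ext_vanishes A (transport g N) n"
    by (rule ext_vanishes_retract[OF h.lmodule_homo_axioms g.lmodule_homo_axioms _ n]) (simp add: f_inv_into_f)
  then have "has_inj_res A (transport g N) TYPE(('a, ('a, 'm) univ) module) n"
    by (rule ext_vanishes_imp_has_inj_res[OF infinite_univ inj_Inl A g.N.lmodule_axioms])
  then obtain I :: "nat \<Rightarrow> ('a, ('a, 'm) univ) module" and d e where
    I: "injective_resolution A (transport g N) I d e" "\<forall>i>n. carrier (I i) = {\<zero>\<^bsub>I i\<^esub>}"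
    unfolding has_inj_res_def by blast
  have "injective_resolution A N I d (\<lambda>x. e (g x))"
    using I(1) lmodule_hom_comp[OF g.hom, of e] comp_inj_on[OF g, of e] unfolding injective_resolution_def
    by (auto simp: image_image o_def)
  then have "inj_dim A N \<le> enat n" unfolding inj_dim_def using I(2) by (intro Inf_lower) blast
  then show ?thesis by (metis enat_ord_simps(4) le_less_trans infinity_ne_i1 enat_ord_code(4))
qed

section \<open>Flatness of projective modules\<close>

text \<open>
  Where a coordinate of \<open>y\<close> vanishes the zero solution is chosen, so the solution has finite support.
\<close>

lemma col_exact_fsupp:
  assumes V: "lmodule A V" and E: "E \<in> mats A q p" and F: "F \<in> mats A r q" and ex: "col_exact V p q r E F"
  shows "col_exact (fsupp X V) p q r E F"
  unfolding col_exact_def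
proof (intro ballI impI)
  interpret V: lmodule A V by fact
  let ?F = "fsupp X V"
  fix y assume y: "y \<in> vecs ?F q" "\<forall>i<r. lin_comb ?F q (F i) y = \<zero>\<^bsub>?F\<^esub>"
  have ev: "lin_comb ?F m a y x = lin_comb V m a (\<lambda>i. y i x)" for m a y x by (induction m) auto
  have yc: "(\<lambda>i. y i x) \<in> vecs V q" for x using y(1) by (auto simp: fsupp_carrier Pi_def)
  have "\<exists>z. z \<in> vecs V p \<and> (\<forall>i<q. y i x = lin_comb V p (E i) z) \<and> ((\<forall>i<q. y i x = \<zero>\<^bsub>V\<^esub>) \<longrightarrow> z = (\<lambda>_. \<zero>\<^bsub>V\<^esub>))" for x
  proof (cases "\<forall>i<q. y i x = \<zero>\<^bsub>V\<^esub>")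
    case True
    then show ?thesis using matsD[OF E] by (intro exI[of _ "\<lambda>_. \<zero>\<^bsub>V\<^esub>"]) auto
  next
    case False
    have "lin_comb V q (F i) (\<lambda>i. y i x) = \<zero>\<^bsub>V\<^esub>" if "i < r" for i
      using fun_cong[of _ _ x, OF y(2)[rule_format, OF that]] by (simp add: ev)
    then obtain z where "z \<in> vecs V p" "\<And>i. i < q \<Longrightarrow> y i x = lin_comb V p (E i) z" using col_exactD[OF ex yc] by metis
    then show ?thesis using False by blast
  qed
  then obtain z where z: "\<And>x. z x \<in> vecs V p" "\<And>x i. i < q \<Longrightarrow> y i x = lin_comb V p (E i) (z x)"
    "\<And>x. (\<forall>i<q. y i x = \<zero>\<^bsub>V\<^esub>) \<Longrightarrow> z x = (\<lambda>_. \<zero>\<^bsub>V\<^esub>)" by metis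
  have fin: "finite (\<Union>i<q. {x. y i x \<noteq> \<zero>\<^bsub>V\<^esub>})" using y(1) by (auto simp: fsupp_carrier Pi_def)
  have "(\<lambda>j x. z x j) \<in> vecs ?F p"
  proof
    fix j assume j: "j \<in> {..<p}"
    have "{x. z x j \<noteq> \<zero>\<^bsub>V\<^esub>} \<subseteq> (\<Union>i<q. {x. y i x \<noteq> \<zero>\<^bsub>V\<^esub>})" using z(3) by fastforce
    then have "finite {x. z x j \<noteq> \<zero>\<^bsub>V\<^esub>}" using fin finite_subset by blast
    moreover have "z x j = \<zero>\<^bsub>V\<^esub>" if "x \<notin> X" for x
    proof -
      have "\<forall>i<q. y i x = \<zero>\<^bsub>V\<^esub>" using y(1) that by (auto simp: fsupp_carrier Pi_def)
      then show ?thesis using z(3) by simp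
    qed
    ultimately show "(\<lambda>x. z x j) \<in> carrier ?F" using z(1) j by (auto simp: fsupp_carrier)
  qed
  moreover have "y i = lin_comb ?F p (E i) (\<lambda>j x. z x j)" if "i < q" for i
  proof
    fix x
    have "lin_comb ?F p (E i) (\<lambda>j x. z x j) x = lin_comb V p (E i) (z x)"
    proof -
      have "lin_comb ?F m a (\<lambda>j x. z x j) x = lin_comb V m a (z x)" for m a by (induction m) auto
      then show ?thesis .
    qed
    then show "y i x = lin_comb ?F p (E i) (\<lambda>j x. z x j) x" using z(2)[OF that] by simp
  qed
  ultimately show "\<exists>z\<in>vecs ?F p. \<forall>i<q. y i = lin_comb ?F p (E i) z" by (intro bexI[of _ "\<lambda>j x. z x j"]) auto
qed

text \<open>
  A projective module is a direct summand of the free module on its own elements, and on a free module a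
  system of equations is solved coordinate by coordinate.
\<close>

lemma projective_flat:
  fixes c :: "'a \<Rightarrow> 'b" and P :: "('a, 'b set) module"
  assumes inf: "infinite (UNIV :: 'b set)" and c: "inj c" and P: "projective_lmodule A P"
    and E: "E \<in> mats A q p" and F: "F \<in> mats A r q" and ex: "col_exact (regular A) p q r E F"
  shows "col_exact P p q r E F"
proof -
  have lP: "lmodule A P" using P by (simp add: projective_lmodule_def)
  interpret P: lmodule A P by fact
  have A: "ring A" by (rule P.R.ring_axioms)
  let ?F = "fsupp (carrier P) (regular A)" and ?ev = "fsupp_eval P \<zero>\<^bsub>A\<^esub>"
  have lF: "lmodule A ?F" by (intro lmodule_fsupp lmodule_regular A)
  have ev: "?ev \<in> lmodule_hom A ?F P" by (rule fsupp_eval_hom[OF lP])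
  have surj: "?ev ` carrier ?F = carrier P"
  proof
    show "?ev ` carrier ?F \<subseteq> carrier P" using lmodule_hom_closed[OF ev] by blast
    show "carrier P \<subseteq> ?ev ` carrier ?F"
      using single_closed[OF lP] fsupp_eval_single[OF lP] by (metis image_eqI subsetI)
  qed
  have "inj (\<lambda>a. {c a})" using c by (auto simp: inj_def)
  then obtain g :: "('b set \<Rightarrow> 'a) \<Rightarrow> 'b set" where "inj_on g {f. finite {x. f x \<noteq> \<zero>\<^bsub>A\<^esub>}}"
    using ex_inj_fsupp[OF inf inj_on_id2[of UNIV], of _ "\<zero>\<^bsub>A\<^esub>"] by blast
  then have g: "inj_on g (carrier ?F)" by (rule inj_on_subset) (auto simp: fsupp_carrier)
  have idP: "(\<lambda>x. x) \<in> lmodule_hom A P P" by (rule lmodule_homI) auto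
  obtain v where v: "v \<in> lmodule_hom A P ?F" "\<And>x. x \<in> carrier P \<Longrightarrow> ?ev (v x) = x"
    by (rule projective_lift[OF P lF g lP inj_on_id2 ev surj idP]) (rule that)
  show ?thesis
  proof (rule col_exact_retract)
    show "lmodule_homo A P ?F v" by (intro lmodule_homoI lF lP v(1))
    show "lmodule_homo A ?F P ?ev" by (intro lmodule_homoI lF lP ev)
    show "col_exact ?F p q r E F" by (intro col_exact_fsupp[OF lmodule_regular[OF A] E F] ex)
  qed (rule v(2) E F, assumption?)+
qed

lemma col_exact_zero:
  assumes "lmodule A Z" "carrier Z = {\<zero>\<^bsub>Z\<^esub>}" "E \<in> mats A q p"
  shows "col_exact Z p q r E F"
  unfolding col_exact_def
proof (intro ballI impI)
  interpret Z: lmodule A Z by fact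
  fix y assume y: "y \<in> vecs Z q"
  have "y i = lin_comb Z p (E i) (\<lambda>j. \<zero>\<^bsub>Z\<^esub>)" if "i < q" for i
  proof -
    have "y i \<in> carrier Z" using y that by auto
    then have "y i = \<zero>\<^bsub>Z\<^esub>" using assms(2) by simp
    then show ?thesis using matsD[OF assms(3) that] by simp
  qed
  then show "\<exists>z\<in>vecs Z p. \<forall>i<q. y i = lin_comb Z p (E i) z"
    by (intro bexI[of _ "\<lambda>j. \<zero>\<^bsub>Z\<^esub>"]) auto
qed

text \<open>
  Dimension shifting along the projective resolution with syzygies \<open>Z j\<close>: exactness over \<open>Z j\<close> follows from
  exactness over \<open>P (j + 1)\<close> and, one place further along \<open>E\<close>, over \<open>Z (j + 1)\<close>; and \<open>Z n = 0\<close>. Only a finite piece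
  of the sequence \<open>E\<close> enters, so the lemma applies to resolutions read in either direction.
\<close>

lemma finite_projective_col_exact:
  fixes c :: "'a \<Rightarrow> 'b" and P :: "nat \<Rightarrow> ('a, 'b set) module"
  assumes inf: "infinite (UNIV :: 'b set)" and c: "inj c" and N: "lmodule A N"
    and P: "projective_resolution A N P d e" and fin: "\<And>i. i > n \<Longrightarrow> carrier (P i) = {\<zero>\<^bsub>P i\<^esub>}"
    and E: "\<And>j. j \<le> Suc (Suc n) \<Longrightarrow> E j \<in> mats A (k (Suc j)) (k j)"
    and z: "\<And>j. j \<le> Suc n \<Longrightarrow> prod_zero A (k (Suc (Suc j))) (k (Suc j)) (k j) (E (Suc j)) (E j)"
    and ex: "\<And>j. j \<le> n \<Longrightarrow> col_exact_at (regular A) k E j"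
  shows "col_exact N (k 0) (k 1) (k 2) (E 0) (E 1)"
proof -
  note R = P[unfolded projective_resolution_def]
  have lP: "lmodule A (P j)" for j using R by (simp add: projective_lmodule_def)
  have hd: "lmodule_homo A (P (Suc j)) (P j) (d j)" for j
    using R by (intro lmodule_homoI lP) auto
  have he: "lmodule_homo A (P 0) N e"
    using R by (intro lmodule_homoI lP N) auto
  have PE: "col_exact_at (P i) k E j" if "j \<le> n" for i j
    using R that by (intro projective_flat[OF inf c _ E E ex]) auto
  define Z where "Z = (\<lambda>j. (P j)\<lparr>carrier := d j ` carrier (P (Suc j))\<rparr>)"
  have sub: "submodule (d j ` carrier (P (Suc j))) A (P j)" for j
    by (rule lmodule_homo.submodule_image[OF hd submodule_carrier[OF lP]])
  have lZ: "lmodule A (Z j)" for j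
    unfolding Z_def by (rule lmodule_submodule[OF lP sub])
  have cZ: "carrier (Z j) = d j ` carrier (P (Suc j))" for j by (simp add: Z_def)
  have ZP: "carrier (Z j) \<subseteq> carrier (P j)" for j using sub[of j] unfolding cZ submodule_iff[OF lP] by simp
  have dZ: "d j \<in> lmodule_hom A (P (Suc j)) (Z j)" for j
    using R by (auto simp: lmodule_hom_def Z_def)
  have ker: "lmodule_ker (P (Suc j)) (Z j) (d j) = lmodule_ker (P (Suc j)) (P j) (d j)" for j
    by (simp add: Z_def lmodule_ker_def)
  have inc: "(\<lambda>x. x) \<in> lmodule_hom A (Z j) (P j)" for j
    using ZP[of j] by (intro lmodule_homI) (auto simp: Z_def)
  have ses: "short_exact A (Z (Suc j)) (P (Suc j)) (Z j) (\<lambda>x. x) (d j)" for j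
    by (intro short_exactI lP lZ dZ inc)
      (use R in \<open>auto simp: cZ ker\<close>)
  have ses0: "short_exact A (Z 0) (P 0) N (\<lambda>x. x) e"
    by (intro short_exactI lP lZ inc N)
      (use R in \<open>auto simp: cZ\<close>)
  have "col_exact (Z (n - t)) (k (Suc (n - t))) (k (Suc (Suc (n - t)))) (k (Suc (Suc (Suc (n - t)))))
      (E (Suc (n - t))) (E (Suc (Suc (n - t))))" if "t \<le> n" for t using that
  proof (induction t)
    case 0
    have "carrier (Z n) = {\<zero>\<^bsub>Z n\<^esub>}"
      using fin[of "Suc n"] lmodule_homo.zero[OF hd[of n]] by (simp add: cZ) (simp add: Z_def)
    then show ?case using col_exact_zero[OF lZ _ E[of "Suc n"]] by simp
  next
    case (Suc t)
    define j where "j = n - Suc t"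
    have j: "n - t = Suc j" "Suc j \<le> n" using Suc(2) by (auto simp: j_def)
    have IH: "col_exact (Z (Suc j)) (k (Suc (Suc j))) (k (Suc (Suc (Suc j)))) (k (Suc (Suc (Suc (Suc j)))))
      (E (Suc (Suc j))) (E (Suc (Suc (Suc j))))" using Suc j by simp
    show ?case unfolding j_def[symmetric] using j
      by (intro short_exact.col_exact_quot[OF ses E E E z IH PE]) auto
  qed
  from this[of n] have "col_exact (Z 0) (k (Suc 0)) (k (Suc (Suc 0))) (k (Suc (Suc (Suc 0)))) (E (Suc 0)) (E (Suc (Suc 0)))"
    by simp
  then have "col_exact_at N k E 0"
    by (intro short_exact.col_exact_quot[OF ses0 E E E z _ PE]) auto
  then show ?thesis by (simp add: numeral_2_eq_2)
qed

lemma proj_dim_imp_ext_vanishes: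
  assumes N: "lmodule A (N :: ('a, 'm, 'c) module_scheme)" and pd: "proj_dim A N < \<infinity>"
    and n: "ext_vanishes A (regular A) n"
  shows "ext_vanishes A N n"
proof -
  obtain P :: "nat \<Rightarrow> ('a, ('a, 'm) univ) module" and d e m where
    P: "projective_resolution A N P d e" "\<And>i. i > m \<Longrightarrow> carrier (P i) = {\<zero>\<^bsub>P i\<^esub>}"
    using proj_dim_finite_resolution[OF pd] by metis
  show ?thesis unfolding ext_vanishes_def
  proof (intro allI impI)
    fix k D i assume D: "free_res A k D" and i: "n \<le> i"
    have "col_exact N (k (0 + i)) (k (1 + i)) (k (2 + i)) (D (0 + i)) (D (1 + i))"
      by (rule finite_projective_col_exact[OF infinite_univ inj_Inl N P, where E = "\<lambda>j. D (j + i)" and k = "\<lambda>j. k (j + i)"])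
        (use free_resD[OF D] ext_vanishesD[OF n D] i in auto)
    then show "col_exact_at N k D i" by simp
  qed
qed

text \<open>
  Multiplying rows over the right module \<open>N\<close> with the matrices of a free resolution computes \<open>Tor\<close>. The
  transposed matrices over the opposite ring, read in reverse order, are exact on columns over the
  regular module, so \<open>finite_projective_col_exact\<close> applies once \<open>i\<close> exceeds the projective dimension.
\<close>

lemma proj_dim_imp_tor_vanishing:
  assumes A: "ring A" and N: "lmodule (op_ring A) (N :: ('a, 'm, 'c) module_scheme)"
    and pd: "proj_dim (op_ring A) N < \<infinity>"
  shows "\<exists>m. \<forall>k D i. free_res A k D \<longrightarrow> i \<ge> m \<longrightarrow>
    col_exact N (k (Suc (Suc i))) (k (Suc i)) (k i) (transp (D (Suc i))) (transp (D i))"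
proof -
  obtain P :: "nat \<Rightarrow> ('a, ('a, 'm) univ) module" and d e m where
    P: "projective_resolution (op_ring A) N P d e" "\<And>i. i > m \<Longrightarrow> carrier (P i) = {\<zero>\<^bsub>P i\<^esub>}"
    using proj_dim_finite_resolution[OF pd] by metis
  have "col_exact N (k (Suc (Suc i))) (k (Suc i)) (k i) (transp (D (Suc i))) (transp (D i))"
    if D: "free_res A k D" and i: "i \<ge> Suc m" for k D i
  proof -
    have "col_exact N (k (Suc (Suc i) - 0)) (k (Suc (Suc i) - 1)) (k (Suc (Suc i) - 2)) (transp (D (Suc i - 0))) (transp (D (Suc i - 1)))"
    proof (rule finite_projective_col_exact[OF infinite_univ inj_Inl N P,
        where E = "\<lambda>j. transp (D (Suc i - j))" and k = "\<lambda>j. k (Suc (Suc i) - j)"])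
      fix j assume "j \<le> Suc (Suc m)"
      then have "Suc (Suc i) - j = Suc (Suc i - j)" using i by auto
      then show "transp (D (Suc i - j)) \<in> mats (op_ring A) (k (Suc (Suc i) - Suc j)) (k (Suc (Suc i) - j))"
        using transp_mats[OF free_resD(1)[OF D, of "Suc i - j"]] by simp
    next
      fix j assume j: "j \<le> Suc m"
      define l where "l = i - j"
      have l: "Suc i - j = Suc l" "Suc (Suc i) - j = Suc (Suc l)" "i - j = l" using i j by (auto simp: l_def)
      show "prod_zero (op_ring A) (k (Suc (Suc i) - Suc (Suc j))) (k (Suc (Suc i) - Suc j)) (k (Suc (Suc i) - j))
        (transp (D (Suc i - Suc j))) (transp (D (Suc i - j)))"
        using free_resD(2)[OF D, of l] l by (simp add: prod_zero_op)
    next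
      fix j assume j: "j \<le> m"
      define l where "l = i - j"
      have l: "Suc i - j = Suc l" "Suc (Suc i) - j = Suc (Suc l)" "i - j = l" using i j by (auto simp: l_def)
      show "col_exact (regular (op_ring A)) (k (Suc (Suc i) - j)) (k (Suc (Suc i) - Suc j)) (k (Suc (Suc i) - Suc (Suc j)))
        (transp (D (Suc i - j))) (transp (D (Suc i - Suc j)))"
        using free_resD(3)[OF D, of l] l by (simp add: row_exact_def)
    qed auto
    then show ?thesis by (simp add: numeral_2_eq_2)
  qed
  then show ?thesis by blast
qed

section \<open>Finite projective resolutions over Gorenstein rings\<close>

definition has_proj_res :: "'a ring \<Rightarrow> ('a, 'm, 'c) module_scheme \<Rightarrow> ('a, 'u) module itself \<Rightarrow> nat \<Rightarrow> bool" where
  "has_proj_res A N t n \<longleftrightarrow> (\<exists>(P :: nat \<Rightarrow> ('a, 'u) module) d e.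
     projective_resolution A N P d e \<and> (\<forall>i>n. carrier (P i) = {\<zero>\<^bsub>P i\<^esub>}))"

lemma projective_lmoduleI:
  fixes P :: "('a, 'u) module"
  assumes "lmodule A P"
    and "\<And>(Y :: ('a, 'u) module) (Z :: ('a, 'u) module) f g. \<lbrakk>lmodule A Y; lmodule A Z; f \<in> lmodule_hom A Y Z;
      f ` carrier Y = carrier Z; g \<in> lmodule_hom A P Z\<rbrakk> \<Longrightarrow> \<exists>h\<in>lmodule_hom A P Y. \<forall>x\<in>carrier P. f (h x) = g x"
  shows "projective_lmodule A P"
  using assms unfolding projective_lmodule_def by blast

text \<open>
  To lift \<open>u\<close>, lift its values at the images of the unit vectors.
\<close>

lemma retract_free_projective:
  fixes N :: "('a, 'n, 'c) module_scheme" and g :: "'n \<Rightarrow> 'u"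
  assumes N: "lmodule A N" and \<alpha>: "\<alpha> \<in> lmodule_hom A N (free_mod A p)"
    and \<beta>: "\<beta> \<in> lmodule_hom A (free_mod A p) N" and ret: "\<And>x. x \<in> carrier N \<Longrightarrow> \<beta> (\<alpha> x) = x"
    and g: "inj_on g (carrier N)"
  shows "projective_lmodule A (transport g N)"
proof (rule projective_lmoduleI)
  interpret N: lmodule A N by fact
  have A: "ring A" by (rule N.R.ring_axioms)
  let ?T = "transport g N" and ?gi = "inv_into (carrier N) g"
  interpret g: lmodule_homo A N ?T g by (rule transport_hom[OF N g])
  interpret gi: lmodule_homo A ?T N ?gi by (rule transport_hom[OF N g])
  show "lmodule A ?T" by (rule g.N.lmodule_axioms)
  interpret Free: lmodule A "free_mod A p" by (rule lmodule_free_mod[OF A])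
  fix Y Z :: "('a, 'u) module" and f u
  assume Y: "lmodule A Y" and Z: "lmodule A Z" and f: "f \<in> lmodule_hom A Y Z" "f ` carrier Y = carrier Z"
    and u: "u \<in> lmodule_hom A ?T Z"
  interpret f: lmodule_homo A Y Z f by (intro lmodule_homoI Y Z f)
  let ?w = "\<lambda>x. u (g (\<beta> x))"
  have w: "?w \<in> lmodule_hom A (free_mod A p) Z"
    using lmodule_hom_comp[OF lmodule_hom_comp[OF \<beta> g.hom] u] .
  interpret w: lmodule_homo A "free_mod A p" Z ?w
    by (intro lmodule_homoI Free.lmodule_axioms Z w)
  have U: "unit_vec A \<in> vecs (free_mod A p) p" using unit_vec_free_mod[OF A] by auto
  have ey: "\<exists>y. y \<in> carrier Y \<and> f y = ?w (unit_vec A i)" if "i < p" for i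
  proof -
    have "?w (unit_vec A i) \<in> f ` carrier Y" unfolding f(2) using U that by (intro w.closed) auto
    then show ?thesis by auto
  qed
  define y where "y = (\<lambda>i. SOME y. y \<in> carrier Y \<and> f y = ?w (unit_vec A i))"
  have y: "y i \<in> carrier Y \<and> f (y i) = ?w (unit_vec A i)" if "i < p" for i
    unfolding y_def by (rule someI_ex[OF ey[OF that]])
  have yv: "y \<in> vecs Y p" using y by auto
  have "(\<lambda>x. lin_comb Y p (\<alpha> (?gi x)) y) \<in> lmodule_hom A ?T Y"
    using lmodule_hom_comp[OF lmodule_hom_comp[OF gi.hom \<alpha>] lin_comb_hom[OF Y yv]] .
  moreover have "f (lin_comb Y p (\<alpha> (?gi x)) y) = u x" if x: "x \<in> carrier ?T" for x
  proof -
    let ?a = "\<alpha> (?gi x)"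
    have a: "?a \<in> carrier (free_mod A p)" by (rule lmodule_hom_closed[OF \<alpha> gi.closed[OF x]])
    then have av: "?a \<in> vecs A p" by (auto simp: free_mod_carrier)
    have "f (lin_comb Y p ?a y) = lin_comb Z p ?a (\<lambda>i. f (y i))" by (rule f.map_lin_comb[OF av yv])
    also have "\<dots> = lin_comb Z p ?a (\<lambda>i. ?w (unit_vec A i))" by (rule lin_comb_cong) (use y in auto)
    also have "\<dots> = ?w (lin_comb (free_mod A p) p ?a (unit_vec A))" by (rule w.map_lin_comb[symmetric, OF av U])
    also have "\<dots> = u (g (\<beta> ?a))" by (simp add: free_mod_expand[OF A a])
    also have "\<beta> ?a = ?gi x" by (rule ret[OF gi.closed[OF x]])
    also have "g (?gi x) = x" using x by (auto simp: f_inv_into_f)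
    finally show ?thesis .
  qed
  ultimately show "\<exists>h\<in>lmodule_hom A ?T Y. \<forall>x\<in>carrier ?T. f (h x) = u x"
    by (intro bexI[of _ "\<lambda>x. lin_comb Y p (\<alpha> (?gi x)) y"] ballI)
qed

lemma has_proj_res_0:
  fixes N :: "('a, 'n, 'c) module_scheme" and g :: "'n \<Rightarrow> 'u"
  assumes N: "lmodule A N" and g: "inj_on g (carrier N)" and P: "projective_lmodule A (transport g N)"
  shows "has_proj_res A N TYPE(('a, 'u) module) 0"
proof -
  let ?T = "transport g N" and ?gi = "inv_into (carrier N) g"
  interpret g: lmodule_homo A N ?T g by (rule transport_hom[OF N g])
  interpret gi: lmodule_homo A ?T N ?gi by (rule transport_hom[OF N g])
  define z where "z = \<zero>\<^bsub>?T\<^esub>"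
  define Z where "Z = ?T\<lparr>carrier := {z}\<rparr>"
  have lZ: "lmodule A Z" unfolding Z_def z_def
    by (rule lmodule_submodule[OF g.N.lmodule_axioms submodule_zero[OF g.N.lmodule_axioms]])
  then interpret Z: lmodule A Z .
  have Zs: "carrier Z = {z}" "\<zero>\<^bsub>Z\<^esub> = z" by (simp_all add: Z_def z_def)
  have PZ: "projective_lmodule A Z"
  proof (rule projective_lmoduleI[OF lZ])
    fix Y W :: "('a, 'u) module" and f u
    assume YW: "lmodule A Y" "lmodule A W" and f: "f \<in> lmodule_hom A Y W" and u: "u \<in> lmodule_hom A Z W"
    interpret f: lmodule_homo A Y W f by (intro lmodule_homoI YW f)
    interpret u: lmodule_homo A Z W u by (intro lmodule_homoI YW lZ u)
    show "\<exists>h\<in>lmodule_hom A Z Y. \<forall>x\<in>carrier Z. f (h x) = u x"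
    proof (rule bexI[of _ "\<lambda>_. \<zero>\<^bsub>Y\<^esub>"], rule ballI)
      show "f \<zero>\<^bsub>Y\<^esub> = u x" if "x \<in> carrier Z" for x using u.zero that by (simp add: Zs)
      show "(\<lambda>_. \<zero>\<^bsub>Y\<^esub>) \<in> lmodule_hom A Z Y" by (rule lmodule_homI) auto
    qed
  qed
  define J where "J = case_nat ?T (\<lambda>_. Z)"
  have J: "J 0 = ?T" "J (Suc i) = Z" for i by (simp_all add: J_def)
  have zT: "z \<in> carrier ?T" "\<zero>\<^bsub>?T\<^esub> = z" using g.N.M.zero_closed by (simp_all add: z_def)
  have Jz: "\<zero>\<^bsub>J i\<^esub> = z" "z \<in> carrier (J i)" for i using zT by (cases i; simp add: J Zs)+
  have lJ: "lmodule A (J i)" for i using lZ g.N.lmodule_axioms by (cases i) (auto simp: J)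
  have zh: "(\<lambda>_. z) \<in> lmodule_hom A (J i) (J j)" for i j
  proof -
    interpret j: lmodule A "J j" by (rule lJ)
    show ?thesis by (rule lmodule_homI) (use Jz[of j] j.M.r_zero j.smult_zero_right in \<open>auto\<close>)
  qed
  have inj: "?gi x = \<zero>\<^bsub>N\<^esub> \<longleftrightarrow> x = z" if "x \<in> carrier ?T" for x
  proof -
    have "g (?gi x) = x" using that by (auto simp: f_inv_into_f)
    then show ?thesis using gi.zero g.zero zT by metis
  qed
  have "projective_resolution A N J (\<lambda>_ _. z) ?gi"
    unfolding projective_resolution_def
  proof (intro conjI allI)
    show "projective_lmodule A (J i)" for i using P PZ by (cases i) (auto simp: J)
    show "(\<lambda>_. z) \<in> lmodule_hom A (J (Suc i)) (J i)" for i by (rule zh)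
    show "?gi \<in> lmodule_hom A (J 0) N" unfolding J by (rule gi.hom)
    show "?gi ` carrier (J 0) = carrier N" using g by (simp add: J)
    show "(\<lambda>_. z) ` carrier (J 1) = lmodule_ker (J 0) N ?gi"
      using inj zT(1) by (auto simp: J Zs lmodule_ker_def)
    show "(\<lambda>_. z) ` carrier (J (Suc (Suc i))) = lmodule_ker (J (Suc i)) (J i) (\<lambda>_. z)" for i
      using Jz[of i] by (auto simp: J(2) Zs lmodule_ker_def)
  qed
  moreover have "\<forall>i>0. carrier (J i) = {\<zero>\<^bsub>J i\<^esub>}" by (auto simp: J_def Zs split: nat.splits)
  ultimately show ?thesis unfolding has_proj_res_def by blast
qed

lemma has_proj_res_Suc:
  fixes F :: "('a, 'u) module"
  assumes ses: "short_exact A K F N \<alpha> \<pi>" and F: "projective_lmodule A F"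
    and K: "has_proj_res A K TYPE(('a, 'u) module) n"
  shows "has_proj_res A N TYPE(('a, 'u) module) (Suc n)"
proof -
  interpret short_exact A K F N \<alpha> \<pi> by fact
  obtain J :: "nat \<Rightarrow> ('a, 'u) module" and d e where J: "projective_resolution A K J d e"
    "\<forall>i>n. carrier (J i) = {\<zero>\<^bsub>J i\<^esub>}" using K unfolding has_proj_res_def by blast
  note Jd = J(1)[unfolded projective_resolution_def]
  let ?J = "case_nat F J" and ?d = "case_nat (\<lambda>x. \<alpha> (e x)) d"
  have e: "e \<in> lmodule_hom A (J 0) K" "e ` carrier (J 0) = carrier K" using Jd by blast+
  have "projective_resolution A N ?J ?d \<pi>"
    unfolding projective_resolution_def
  proof (intro conjI allI)
    show "projective_lmodule A (?J i)" for i using F Jd by (cases i) auto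
    show "?d i \<in> lmodule_hom A (?J (Suc i)) (?J i)" for i
      using Jd lmodule_hom_comp[OF e(1) i.hom] by (cases i) auto
    have "(\<lambda>x. \<alpha> (e x)) ` carrier (J 0) = \<alpha> ` carrier K" by (simp add: image_image flip: e(2))
    then show "?d 0 ` carrier (?J 1) = lmodule_ker (?J 0) N \<pi>" using exact by simp
    show "?d (Suc i) ` carrier (?J (Suc (Suc i))) = lmodule_ker (?J (Suc i)) (?J i) (?d i)" for i
    proof (cases i)
      case 0
      have "\<alpha> (e x) = \<zero>\<^bsub>F\<^esub> \<longleftrightarrow> e x = \<zero>\<^bsub>K\<^esub>" if "x \<in> carrier (J 0)" for x
        using i.eq_iff[OF inj] lmodule_hom_closed[OF e(1) that] by auto
      then have "lmodule_ker (J 0) F (\<lambda>x. \<alpha> (e x)) = lmodule_ker (J 0) K e" by (auto simp: lmodule_ker_def)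
      then show ?thesis using Jd 0 by simp
    qed (use Jd in simp)
  qed (use p.hom surj in auto)
  moreover have "carrier (?J i) = {\<zero>\<^bsub>?J i\<^esub>}" if "i > Suc n" for i
    using that J(2) by (cases i) auto
  ultimately show ?thesis unfolding has_proj_res_def by blast
qed

lemma has_proj_res_free_Suc:
  fixes g :: "(nat \<Rightarrow> 'a) \<Rightarrow> 'u"
  assumes ses: "short_exact A K (free_mod A p) N \<alpha> \<pi>" and g: "inj g"
    and K: "has_proj_res A K TYPE(('a, 'u) module) n"
  shows "has_proj_res A N TYPE(('a, 'u) module) (Suc n)"
proof -
  interpret short_exact A K "free_mod A p" N \<alpha> \<pi> by fact
  let ?F = "free_mod A p"
  have lF: "lmodule A ?F" by (rule i.N.lmodule_axioms)
  have gF: "inj_on g (carrier ?F)" using g by (rule inj_on_subset) simp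
  let ?gi = "inv_into (carrier ?F) g"
  interpret g: lmodule_homo A ?F "transport g ?F" g by (rule transport_hom[OF lF gF])
  interpret gi: lmodule_homo A "transport g ?F" ?F ?gi by (rule transport_hom[OF lF gF])
  have id: "(\<lambda>x. x) \<in> lmodule_hom A ?F ?F" by (rule lmodule_homI) auto
  have P: "projective_lmodule A (transport g ?F)"
    by (rule retract_free_projective[OF lF id id _ gF]) simp
  have "short_exact A K (transport g ?F) N (\<lambda>x. g (\<alpha> x)) (\<lambda>x. \<pi> (?gi x))"
  proof (intro short_exactI)
    show "(\<lambda>x. g (\<alpha> x)) \<in> lmodule_hom A K (transport g ?F)" by (rule lmodule_hom_comp[OF i.hom g.hom])
    show "(\<lambda>x. \<pi> (?gi x)) \<in> lmodule_hom A (transport g ?F) N" by (rule lmodule_hom_comp[OF gi.hom p.hom])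
    show "inj_on (\<lambda>x. g (\<alpha> x)) (carrier K)" using comp_inj_on[OF inj, of g] g
      by (auto simp: o_def inj_on_def)
    show "(\<lambda>x. \<pi> (?gi x)) ` carrier (transport g ?F) = carrier N"
      using gF by (simp add: image_image flip: surj)
    have "(\<lambda>x. g (\<alpha> x)) ` carrier K = g ` lmodule_ker ?F N \<pi>" by (simp add: image_image flip: exact)
    also have "\<dots> = lmodule_ker (transport g ?F) N (\<lambda>x. \<pi> (?gi x))"
      using gF by (auto simp: lmodule_ker_def)
    finally show "(\<lambda>x. g (\<alpha> x)) ` carrier K = lmodule_ker (transport g ?F) N (\<lambda>x. \<pi> (?gi x))" .
  qed (rule i.M.lmodule_axioms g.N.lmodule_axioms p.N.lmodule_axioms)+
  then show ?thesis by (rule has_proj_res_Suc[OF _ P K])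
qed

text \<open>
  Over a ring of finite left injective dimension every free resolution turns into such a resolution when
  finitely many matrices are dropped. Over a Gorenstein ring the modules that have such a resolution are the
  finitely generated Gorenstein projective ones.
\<close>

definition biexact_res :: "'a ring \<Rightarrow> (nat \<Rightarrow> nat) \<Rightarrow> (nat \<Rightarrow> nat \<Rightarrow> nat \<Rightarrow> 'a) \<Rightarrow> bool" where
  "biexact_res A k D \<longleftrightarrow> free_res A k D \<and> (\<forall>i. col_exact_at (regular A) k D i)"

lemma free_res_Cons:
  assumes "free_res A k D" "E \<in> mats A (k 0) p" "prod_zero A (k 1) (k 0) p (D 0) E" "row_exact A (k 1) (k 0) p (D 0) E"
  shows "free_res A (case_nat p k) (case_nat E D)"
  unfolding free_res_def
proof
  fix n show "case_nat E D n \<in> mats A (case_nat p k (Suc n)) (case_nat p k n) \<and>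
     prod_zero A (case_nat p k (Suc (Suc n))) (case_nat p k (Suc n)) (case_nat p k n) (case_nat E D (Suc n)) (case_nat E D n) \<and>
     row_exact A (case_nat p k (Suc (Suc n))) (case_nat p k (Suc n)) (case_nat p k n) (case_nat E D (Suc n)) (case_nat E D n)"
    using assms free_resD[OF assms(1)] by (cases n) auto
qed

text \<open>
  The columns of the new matrix \<open>B\<close> generate the kernel of \<open>D 0\<close> on columns, so the columns remain exact. That
  the rows remain exact at the old end is the point: reversed and transposed, \<open>D d, \<dots>, D 0, B\<close> is the beginning of
  a free resolution over the opposite ring, and \<open>ext_vanishes\<close> for that ring gives exactness of its columns at
  position \<open>d\<close>, which are the rows in question.
\<close>

lemma biexact_res_prepend:
  assumes A: "ring A" and noeth: "left_noetherian (op_ring A)" and d: "ext_vanishes (op_ring A) (regular (op_ring A)) d"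
    and D: "biexact_res A k D"
  obtains l B where "biexact_res A (case_nat l k) (case_nat B D)"
proof -
  have fD: "free_res A k D" and cD: "\<And>i. col_exact_at (regular A) k D i"
    using D by (auto simp: biexact_res_def)
  have op: "ring (op_ring A)" by (rule ring_op_ring[OF A])
  have t0: "transp (D 0) \<in> mats (op_ring A) (k 0) (k 1)" using transp_mats[OF free_resD(1)[OF fD, of 0]] by simp
  obtain r F where F: "F \<in> mats (op_ring A) r (k 0)" "prod_zero (op_ring A) r (k 0) (k 1) F (transp (D 0))"
    "row_exact (op_ring A) r (k 0) (k 1) F (transp (D 0))" by (rule row_kernel_fg[OF op noeth t0])
  obtain k2 E2 where E2: "free_res (op_ring A) k2 E2" "k2 0 = k 0" "k2 1 = r" "E2 0 = F"
    by (rule free_res_exists[OF op noeth F(1)])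
  \<comment> \<open>prepend the transposes of \<open>D 0, \<dots>, D t\<close> to a resolution that starts with the transpose of the new matrix\<close>
  have ex: "\<exists>k' E. free_res (op_ring A) k' E \<and> k' t = k 1 \<and> k' (Suc t) = k 0 \<and> k' (Suc (Suc t)) = r \<and>
      E t = transp (D 0) \<and> E (Suc t) = F \<and> k' 0 = k (Suc t) \<and> k' 1 = k t \<and> E 0 = transp (D t)" for t
  proof (induction t)
    case 0
    show ?case
      by (intro exI[of _ "case_nat (k 1) k2"] exI[of _ "case_nat (transp (D 0)) E2"] conjI free_res_Cons)
        (use E2 F t0 in simp_all)
  next
    case (Suc t)
    then obtain k' E where E: "free_res (op_ring A) k' E" "k' t = k 1" "k' (Suc t) = k 0" "k' (Suc (Suc t)) = r"
      "E t = transp (D 0)" "E (Suc t) = F" "k' 0 = k (Suc t)" "k' 1 = k t" "E 0 = transp (D t)" by (elim exE conjE)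
    show ?case
    proof (intro exI[of _ "case_nat (k (Suc (Suc t))) k'"] exI[of _ "case_nat (transp (D (Suc t))) E"] conjI free_res_Cons E(1))
      show "transp (D (Suc t)) \<in> mats (op_ring A) (k' 0) (k (Suc (Suc t)))"
        using transp_mats[OF free_resD(1)[OF fD, of "Suc t"]] E(7) by simp
      show "prod_zero (op_ring A) (k' 1) (k' 0) (k (Suc (Suc t))) (E 0) (transp (D (Suc t)))"
        using free_resD(2)[OF fD, of t] by (simp add: prod_zero_op E(7-9) del: One_nat_def)
      show "row_exact (op_ring A) (k' 1) (k' 0) (k (Suc (Suc t))) (E 0) (transp (D (Suc t)))"
        using cD[of t] by (simp add: row_exact_def E(7-9) del: One_nat_def)
    qed (use E in simp_all)
  qed
  obtain k' E where E: "free_res (op_ring A) k' E" "k' d = k 1" "k' (Suc d) = k 0" "k' (Suc (Suc d)) = r"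
      "E d = transp (D 0)" "E (Suc d) = F" using ex[of d] by (elim exE conjE)
  have "col_exact (regular (op_ring A)) (k 1) (k 0) r (transp (D 0)) F" using ext_vanishesD[OF d E(1), of d] E by simp
  then have "row_exact A (k 1) (k 0) r (D 0) (transp F)" by (simp add: row_exact_def)
  moreover have "prod_zero A (k 1) (k 0) r (D 0) (transp F)"
    using F(2) prod_zero_op[of A r "k 0" "k 1" "transp F" "D 0"] by simp
  moreover have "transp F \<in> mats A (k 0) r" using transp_mats[OF F(1)] by simp
  ultimately have "free_res A (case_nat r k) (case_nat (transp F) D)" by (intro free_res_Cons fD)
  moreover have "col_exact (regular A) (case_nat r k i) (case_nat r k (Suc i)) (case_nat r k (Suc (Suc i)))
      (case_nat (transp F) D i) (case_nat (transp F) D (Suc i))" for i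
  proof (cases i)
    case 0
    then show ?thesis using F(3) by (simp add: row_exact_def)
  qed (use cD in simp)
  ultimately show ?thesis using that[of r "transp F"] by (simp add: biexact_res_def)
qed

lemma biexact_res_prepend_many:
  assumes A: "ring A" and noeth: "left_noetherian (op_ring A)" and d: "ext_vanishes (op_ring A) (regular (op_ring A)) d"
    and D: "biexact_res A k D"
  shows "\<exists>k' D'. biexact_res A k' D' \<and> (\<forall>j. k' (s + j) = k j \<and> D' (s + j) = D j)"
proof (induction s)
  case 0 then show ?case using D by (intro exI[of _ k] exI[of _ D]) simp
next
  case (Suc s)
  then obtain k' D' where D': "biexact_res A k' D'" "\<forall>j. k' (s + j) = k j \<and> D' (s + j) = D j" by (elim exE conjE)
  obtain l B where "biexact_res A (case_nat l k') (case_nat B D')" by (rule biexact_res_prepend[OF A noeth d D'(1)])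
  then show ?case using D'(2) by (intro exI[of _ "case_nat l k'"] exI[of _ "case_nat B D'"]) simp
qed

text \<open>
  The resolution \<open>D\<close> of \<open>N\<close> is augmented by the generators \<open>e\<close>, whose relations are generated by the rows of \<open>D 0\<close>.
\<close>

definition presents :: "'a ring \<Rightarrow> ('a, 'm, 'c) module_scheme \<Rightarrow> (nat \<Rightarrow> nat) \<Rightarrow> (nat \<Rightarrow> nat \<Rightarrow> nat \<Rightarrow> 'a) \<Rightarrow> (nat \<Rightarrow> 'm) \<Rightarrow> bool" where
  "presents A N k D e \<longleftrightarrow> free_res A k D \<and> e \<in> vecs N (k 0) \<and> carrier N = (\<lambda>x. lin_comb N (k 0) x e) ` vecs A (k 0) \<and>
     (\<forall>x\<in>vecs A (k 0). lin_comb N (k 0) x e = \<zero>\<^bsub>N\<^esub> \<longleftrightarrow>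
        (\<exists>w\<in>vecs A (k 1). \<forall>i<k 0. x i = lin_comb (regular A) (k 1) w (\<lambda>l. D 0 l i)))"

lemma presentsD:
  assumes "presents A N k D e"
  shows "free_res A k D" "e \<in> vecs N (k 0)" "carrier N = (\<lambda>x. lin_comb N (k 0) x e) ` vecs A (k 0)"
    "x \<in> vecs A (k 0) \<Longrightarrow> lin_comb N (k 0) x e = \<zero>\<^bsub>N\<^esub> \<longleftrightarrow>
        (\<exists>w\<in>vecs A (k 1). \<forall>i<k 0. x i = lin_comb (regular A) (k 1) w (\<lambda>l. D 0 l i))"
  using assms by (auto simp: presents_def)

lemma span_eq_iff:
  assumes A: "ring A" and x: "x \<in> vecs A p" and w: "w \<in> vecs A q" and F: "\<And>i. i < q \<Longrightarrow> F i \<in> carrier (free_mod A p)"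
  shows "cut_vec A p x = lin_comb (free_mod A p) q w F \<longleftrightarrow> (\<forall>i<p. x i = lin_comb (regular A) q w (\<lambda>l. F l i))"
proof -
  have "lin_comb (free_mod A p) q w F = (\<lambda>j. if j < p then lin_comb (regular A) q w (\<lambda>i. F i j) else \<zero>\<^bsub>A\<^esub>)"
    by (rule free_mod_lin_comb_eval[OF A w]) (rule F)
  then show ?thesis by (auto simp: cut_vec_def fun_eq_iff)
qed

lemma presents_surj:
  assumes A: "ring A" and P: "presents A N k D e"
  shows "(\<lambda>x. lin_comb N (k 0) x e) ` carrier (free_mod A (k 0)) = carrier N"
proof -
  have "x \<in> vecs A (k 0)" if "x \<in> carrier (free_mod A (k 0))" for x using that by (auto simp: free_mod_carrier)
  moreover have "lin_comb N (k 0) x e \<in> (\<lambda>x. lin_comb N (k 0) x e) ` carrier (free_mod A (k 0))"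
    if "x \<in> vecs A (k 0)" for x
    using that by (intro image_eqI[of _ _ "cut_vec A (k 0) x"] cut_vec_closed[OF A]) simp_all
  ultimately show ?thesis unfolding presentsD(3)[OF P] by auto
qed

lemma presents_exists:
  assumes A: "ring A" "left_noetherian A" and N: "lmodule A N" and fg: "fg_sub A N (carrier N)"
  obtains k D e where "presents A N k D e"
proof -
  interpret N: lmodule A N by fact
  obtain p e where e: "\<forall>i<p. e i \<in> carrier N" "carrier N = (\<lambda>a. lin_comb N p a e) ` vecs A p"
    using fg_sub_span_ex[OF N submodule_carrier[OF N] fg] by (elim exE conjE)
  have ev: "e \<in> vecs N p" using e(1) by auto
  let ?F = "free_mod A p"
  have lF: "lmodule A ?F" by (rule lmodule_free_mod[OF A(1)])
  interpret h: lmodule_homo A ?F N "\<lambda>x. lin_comb N p x e"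
    by (intro lmodule_homoI lF N lin_comb_hom ev)
  let ?K = "lmodule_ker ?F N (\<lambda>x. lin_comb N p x e)"
  have fK: "fg_sub A ?F ?K" using noetherian_free_mod[OF A] h.submodule_ker unfolding noetherian_lmodule_def by simp
  obtain q F where F: "\<forall>i<q. F i \<in> ?K" "?K = (\<lambda>a. lin_comb ?F q a F) ` vecs A q"
    using fg_sub_span_ex[OF lF h.submodule_ker fK] by (elim exE conjE)
  have FF: "F i \<in> carrier ?F" if "i < q" for i using F(1) that by (simp add: lmodule_ker_def)
  have "F \<in> mats A q p" using FF by (auto simp: free_mod_carrier)
  then obtain k D where D: "free_res A k D" "k 0 = p" "k 1 = q" "D 0 = F" by (rule free_res_exists[OF A])
  have "lin_comb N p x e = \<zero>\<^bsub>N\<^esub> \<longleftrightarrow> (\<exists>w\<in>vecs A q. \<forall>i<p. x i = lin_comb (regular A) q w (\<lambda>l. F l i))"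
    if x: "x \<in> vecs A p" for x
  proof -
    have "lin_comb N p x e = \<zero>\<^bsub>N\<^esub> \<longleftrightarrow> cut_vec A p x \<in> ?K"
      using cut_vec_closed[OF A(1) x] by (simp add: lmodule_ker_def)
    also have "\<dots> \<longleftrightarrow> (\<exists>w\<in>vecs A q. cut_vec A p x = lin_comb ?F q w F)" unfolding F(2) by (simp add: image_iff)
    also have "\<dots> \<longleftrightarrow> (\<exists>w\<in>vecs A q. \<forall>i<p. x i = lin_comb (regular A) q w (\<lambda>l. F l i))"
      by (rule bex_cong[OF refl]) (rule span_eq_iff[OF A(1) x _ FF])
    finally show ?thesis .
  qed
  then have "presents A N k D e" unfolding presents_def using D e(2) ev by simp
  then show ?thesis by (rule that)
qed

lemma presents_syzygy:
  assumes A: "ring A" and N: "lmodule A N" and P: "presents A N k D e"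
  defines "K \<equiv> (free_mod A (k 0))\<lparr>carrier := lmodule_ker (free_mod A (k 0)) N (\<lambda>x. lin_comb N (k 0) x e)\<rparr>"
  shows "short_exact A K (free_mod A (k 0)) N (\<lambda>x. x) (\<lambda>x. lin_comb N (k 0) x e)" (is ?ses)
    and "\<exists>f. presents A K (\<lambda>i. k (Suc i)) (\<lambda>i. D (Suc i)) f"
proof -
  note P' = presentsD[OF P]
  note D = free_resD[OF P'(1)]
  interpret N: lmodule A N by fact
  let ?F = "free_mod A (k 0)" and ?p = "\<lambda>x. lin_comb N (k 0) x e"
  have lF: "lmodule A ?F" by (rule lmodule_free_mod[OF A])
  interpret h: lmodule_homo A ?F N ?p
    by (intro lmodule_homoI lF N lin_comb_hom P')
  have lK: "lmodule A K" unfolding K_def by (rule lmodule_submodule[OF lF h.submodule_ker])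
  show ?ses
  proof (intro short_exactI lF N lK h.hom)
    show "(\<lambda>x. x) \<in> lmodule_hom A K ?F" by (rule lmodule_homI) (auto simp: K_def lmodule_ker_def)
    show "?p ` carrier ?F = carrier N" by (rule presents_surj[OF A P])
  qed (auto simp: K_def)
  define f where "f = (\<lambda>i. cut_vec A (k 0) (D 0 i))"
  have fF: "f i \<in> carrier ?F" if "i < k 1" for i
    unfolding f_def using matsD[OF D(1)[of 0], of i] that by (intro cut_vec_closed[OF A]) simp
  have fD: "f l i = D 0 l i" if "i < k 0" for i l using that by (simp add: f_def cut_vec_def)
  have row: "lin_comb (regular A) q w (\<lambda>l. f l i) = lin_comb (regular A) q w (\<lambda>l. D 0 l i)" if "i < k 0" for q w i
    by (rule lin_comb_cong) (simp_all add: fD[OF that])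
  have ker_iff: "x \<in> carrier K \<longleftrightarrow> (\<exists>w\<in>vecs A (k 1). x = lin_comb ?F (k 1) w f)" if x: "x \<in> carrier ?F" for x
  proof -
    have xv: "x \<in> vecs A (k 0)" using x by (auto simp: free_mod_carrier)
    have xc: "cut_vec A (k 0) x = x" using x by (auto simp: free_mod_carrier cut_vec_def fun_eq_iff)
    have "x \<in> carrier K \<longleftrightarrow> ?p x = \<zero>\<^bsub>N\<^esub>" using x by (simp add: K_def lmodule_ker_def)
    also have "\<dots> \<longleftrightarrow> (\<exists>w\<in>vecs A (k 1). \<forall>i<k 0. x i = lin_comb (regular A) (k 1) w (\<lambda>l. f l i))"
      unfolding P'(4)[OF xv] by (intro bex_cong[OF refl]) (simp add: row)
    also have "\<dots> \<longleftrightarrow> (\<exists>w\<in>vecs A (k 1). x = lin_comb ?F (k 1) w f)"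
      using span_eq_iff[OF A xv _ fF] xc by (intro bex_cong[OF refl]) simp
    finally show ?thesis .
  qed
  have spF: "lin_comb ?F (k 1) w f \<in> carrier ?F" if "w \<in> vecs A (k 1)" for w
    by (rule h.M.lin_comb_closed[OF that]) (use fF in auto)
  have KF: "carrier K \<subseteq> carrier ?F" by (auto simp: K_def lmodule_ker_def)
  have lcK: "lin_comb K m w g = lin_comb ?F m w g" for m w g by (simp add: K_def)
  have "presents A K (\<lambda>i. k (Suc i)) (\<lambda>i. D (Suc i)) f"
    unfolding presents_def
  proof (intro conjI ballI)
    show "free_res A (\<lambda>i. k (Suc i)) (\<lambda>i. D (Suc i))" using free_res_shift[OF P'(1), of 1] by simp
    show "f \<in> vecs K (k (Suc 0))"
    proof
      fix i assume i: "i \<in> {..<k (Suc 0)}"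
      have "f i = lin_comb ?F (k 1) (unit_vec A i) f"
        by (rule h.M.lin_comb_unit_vec[symmetric]) (use i fF in auto)
      then show "f i \<in> carrier K" using ker_iff[OF fF, of i] i by auto
    qed
    show "carrier K = (\<lambda>x. lin_comb K (k (Suc 0)) x f) ` vecs A (k (Suc 0))"
      unfolding lcK using ker_iff KF spF by (auto simp: image_iff)
    fix x assume x: "x \<in> vecs A (k (Suc 0))"
    have "lin_comb K (k (Suc 0)) x f = \<zero>\<^bsub>K\<^esub> \<longleftrightarrow> (\<forall>j<k 0. lin_comb (regular A) (k (Suc 0)) x (\<lambda>i. D 0 i j) = \<zero>\<^bsub>A\<^esub>)"
    proof -
      have "lin_comb K (k (Suc 0)) x f = (\<lambda>j. if j < k 0 then lin_comb (regular A) (k (Suc 0)) x (\<lambda>i. f i j) else \<zero>\<^bsub>A\<^esub>)"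
        unfolding lcK using fF by (intro free_mod_lin_comb_eval[OF A x]) simp
      moreover have "\<zero>\<^bsub>K\<^esub> = (\<lambda>_. \<zero>\<^bsub>A\<^esub>)" by (simp add: K_def)
      ultimately show ?thesis using row by (auto simp: fun_eq_iff)
    qed
    also have "\<dots> \<longleftrightarrow> (\<exists>w\<in>vecs A (k (Suc 1)). \<forall>i<k (Suc 0). x i = lin_comb (regular A) (k (Suc 1)) w (\<lambda>l. D (Suc 0) l i))" (is "?l = ?r")
    proof
      assume ?l then show ?r using D(3)[of 0] x unfolding row_exact_iff by simp
    next
      assume ?r
      then obtain w where w: "w \<in> vecs A (k (Suc 1))" "\<And>i. i < k (Suc 0) \<Longrightarrow> x i = lin_comb (regular A) (k (Suc 1)) w (\<lambda>l. D (Suc 0) l i)"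
        by blast
      show ?l
      proof (intro allI impI)
        fix j assume j: "j < k 0"
        have reg: "lmodule A (regular A)" by (rule lmodule_regular[OF A])
        have col: "(\<lambda>i. D 0 i j) \<in> vecs (regular A) (k (Suc 0))" using mats_col[OF D(1)[of 0] j] by simp
        have D1: "D (Suc 0) \<in> mats A (k (Suc 1)) (k (Suc 0))" using D(1)[of "Suc 0"] by simp
        have "lin_comb (regular A) (k (Suc 0)) x (\<lambda>i. D 0 i j) =
            lin_comb (regular A) (k (Suc 0)) (\<lambda>i. lin_comb (regular A) (k (Suc 1)) w (\<lambda>l. D (Suc 0) l i)) (\<lambda>i. D 0 i j)"
          by (rule lin_comb_cong) (simp_all add: w(2))
        also have "\<dots> = lin_comb (regular A) (k (Suc 1)) w (\<lambda>l. lin_comb (regular A) (k (Suc 0)) (D (Suc 0) l) (\<lambda>i. D 0 i j))"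
          by (rule lin_comb_assoc[OF reg w(1) D1 col, symmetric])
        also have "\<dots> = \<zero>\<^bsub>A\<^esub>"
          using lmodule.lin_comb_zero_right'[OF reg, of "k (Suc 1)" _ w] D(2)[of 0] j w(1)
          by (simp add: prod_zero_def)
        finally show "lin_comb (regular A) (k (Suc 0)) x (\<lambda>i. D 0 i j) = \<zero>\<^bsub>A\<^esub>" .
      qed
    qed
    finally show "lin_comb K (k (Suc 0)) x f = \<zero>\<^bsub>K\<^esub> \<longleftrightarrow>
       (\<exists>w\<in>vecs A (k (Suc 1)). \<forall>i<k (Suc 0). x i = lin_comb (regular A) (k (Suc 1)) w (\<lambda>l. D (Suc 0) l i))" .
  qed
  then show "\<exists>f. presents A K (\<lambda>i. k (Suc i)) (\<lambda>i. D (Suc i)) f" by blast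
qed

text \<open>
  Prepend \<open>m + 1\<close> matrices to the resolution, so that \<open>D 0\<close> moves to a position where \<open>Ext\<close> with values in \<open>N\<close> vanishes.
  The generators \<open>e\<close> are annihilated by \<open>D 0\<close>, hence \<open>e = B z\<close> with \<open>B\<close> the matrix in front of \<open>D 0\<close>. As \<open>D 0\<close> times \<open>B\<close> is
  zero, \<open>x e \<mapsto> x B\<close> is a homomorphism from \<open>N\<close> to a free module, and \<open>w \<mapsto> w z\<close> is a left inverse of it.
\<close>

lemma biexact_res_retract:
  assumes A: "ring A" and noeth: "left_noetherian (op_ring A)" and d: "ext_vanishes (op_ring A) (regular (op_ring A)) d"
    and N: "lmodule A N" and m: "ext_vanishes A N m" and P: "presents A N k D e" and bi: "biexact_res A k D"
  obtains p \<alpha> \<beta> where "\<alpha> \<in> lmodule_hom A N (free_mod A p)" "\<beta> \<in> lmodule_hom A (free_mod A p) N"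
    "\<And>x. x \<in> carrier N \<Longrightarrow> \<beta> (\<alpha> x) = x"
proof -
  note P' = presentsD[OF P]
  interpret N: lmodule A N by fact
  interpret Reg: lmodule A "regular A" by (rule lmodule_regular[OF A])
  obtain k' D' where D': "biexact_res A k' D'" and sh: "\<forall>j. k' (Suc m + j) = k j \<and> D' (Suc m + j) = D j"
    using biexact_res_prepend_many[OF A noeth d bi, of "Suc m"] by (elim exE conjE)
  have f': "free_res A k' D'" using D' by (simp add: biexact_res_def)
  define p where "p = k' m"
  define B where "B = D' m"
  have s: "k' (Suc m) = k 0" "k' (Suc (Suc m)) = k 1" "D' (Suc m) = D 0"
    using sh[rule_format, of 0] sh[rule_format, of 1] by simp_all
  have B: "B \<in> mats A (k 0) p" using free_resD(1)[OF f', of m] by (simp add: s p_def B_def)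
  have DB: "prod_zero A (k 1) (k 0) p (D 0) B" using free_resD(2)[OF f', of m] by (simp add: s p_def B_def)
  have D0: "D 0 \<in> mats A (k 1) (k 0)" using free_resD(1)[OF P'(1), of 0] by simp
  have ex: "col_exact N p (k 0) (k 1) B (D 0)" using ext_vanishesD[OF m f', of m] by (simp add: s p_def B_def)
  have "lin_comb N (k 0) (D 0 i) e = \<zero>\<^bsub>N\<^esub>" if i: "i < k 1" for i
    unfolding P'(4)[OF matsD[OF D0 i]]
  proof (intro bexI[of _ "unit_vec A i"] allI impI)
    fix j assume j: "j < k 0"
    show "D 0 i j = lin_comb (regular A) (k 1) (unit_vec A i) (\<lambda>l. D 0 l j)"
      using Reg.lin_comb_unit_vec[OF i, of "\<lambda>l. D 0 l j"] mats_col[OF D0 j] by simp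
  qed auto
  then obtain z where z: "z \<in> vecs N p" "\<And>i. i < k 0 \<Longrightarrow> e i = lin_comb N p (B i) z"
    using col_exactD[OF ex P'(2)] by blast
  let ?F = "free_mod A (k 0)" and ?G = "free_mod A p"
  define g where "g = (\<lambda>i. cut_vec A p (B i))"
  have g: "g i \<in> carrier ?G" if "i < k 0" for i unfolding g_def by (rule cut_vec_closed[OF A matsD[OF B that]])
  have gv: "g \<in> vecs ?G (k 0)" using g by auto
  interpret G: lmodule A ?G by (rule lmodule_free_mod[OF A])
  interpret \<phi>: lmodule_homo A ?F N "\<lambda>x. lin_comb N (k 0) x e"
    by (intro lmodule_homoI lmodule_free_mod A N lin_comb_hom P')
  interpret \<beta>: lmodule_homo A ?G N "\<lambda>x. lin_comb N p x z"
    by (intro lmodule_homoI lmodule_free_mod A N lin_comb_hom z)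
  have "\<exists>h\<in>lmodule_hom A (N\<lparr>carrier := (\<lambda>x. lin_comb N (k 0) x e) ` carrier ?F\<rparr>) ?G.
      \<forall>x\<in>carrier ?F. h (lin_comb N (k 0) x e) = lin_comb ?G (k 0) x g"
  proof (rule \<phi>.factor_through_image[OF G.lmodule_axioms lin_comb_hom[OF G.lmodule_axioms gv]])
    fix x assume x: "x \<in> carrier ?F" "lin_comb N (k 0) x e = \<zero>\<^bsub>N\<^esub>"
    have xv: "x \<in> vecs A (k 0)" using x(1) by (auto simp: free_mod_carrier)
    obtain w where w: "w \<in> vecs A (k 1)" "\<And>i. i < k 0 \<Longrightarrow> x i = lin_comb (regular A) (k 1) w (\<lambda>l. D 0 l i)"
      using P'(4)[OF xv] x(2) by blast
    have Dg: "lin_comb ?G (k 0) (D 0 l) g = \<zero>\<^bsub>?G\<^esub>" if l: "l < k 1" for l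
    proof -
      have "lin_comb (regular A) (k 0) (D 0 l) (\<lambda>i. g i j) = \<zero>\<^bsub>A\<^esub>" if j: "j < p" for j
      proof -
        have "lin_comb (regular A) (k 0) (D 0 l) (\<lambda>i. g i j) = lin_comb (regular A) (k 0) (D 0 l) (\<lambda>i. B i j)"
          by (rule lin_comb_cong) (use j in \<open>simp_all add: g_def cut_vec_def\<close>)
        then show ?thesis using DB j l by (simp add: prod_zero_def)
      qed
      then show ?thesis using free_mod_lin_comb_eval[OF A matsD[OF D0 l] g] by (simp add: fun_eq_iff)
    qed
    have "lin_comb ?G (k 0) x g = lin_comb ?G (k 0) (\<lambda>i. lin_comb (regular A) (k 1) w (\<lambda>l. D 0 l i)) g"
      by (rule lin_comb_cong) (use w(2) in simp_all)
    also have "\<dots> = lin_comb ?G (k 1) w (\<lambda>l. lin_comb ?G (k 0) (D 0 l) g)"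
      by (rule lin_comb_assoc[OF G.lmodule_axioms w(1) D0 gv, symmetric])
    also have "\<dots> = \<zero>\<^bsub>?G\<^esub>" by (rule G.lin_comb_zero_right'[OF Dg w(1)])
    finally show "lin_comb ?G (k 0) x g = \<zero>\<^bsub>?G\<^esub>" .
  qed
  then obtain h where h: "h \<in> lmodule_hom A N ?G" "\<forall>x\<in>carrier ?F. h (lin_comb N (k 0) x e) = lin_comb ?G (k 0) x g"
    unfolding presents_surj[OF A P] by auto
  have "lin_comb N p (h u) z = u" if u: "u \<in> carrier N" for u
  proof -
    obtain x where x: "x \<in> carrier ?F" "u = lin_comb N (k 0) x e" using u unfolding presents_surj[OF A P, symmetric] by auto
    have xv: "x \<in> vecs A (k 0)" using x(1) by (auto simp: free_mod_carrier)
    have "lin_comb N p (h u) z = lin_comb N p (lin_comb ?G (k 0) x g) z" using h(2) x by simp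
    also have "\<dots> = lin_comb N (k 0) x (\<lambda>i. lin_comb N p (g i) z)" by (rule \<beta>.map_lin_comb[OF xv gv])
    also have "\<dots> = u" unfolding x(2) by (rule lin_comb_cong) (simp_all add: z(2) g_def)
    finally show ?thesis .
  qed
  then show ?thesis using that[OF h(1) \<beta>.hom] by blast
qed

lemma ext_vanishes_free_mod:
  assumes A: "ring A" and "ext_vanishes A (regular A) n" shows "ext_vanishes A (free_mod A p) n"
  unfolding ext_vanishes_def
proof (intro allI impI)
  fix k D i assume D: "free_res A k D" and "n \<le> i"
  then show "col_exact_at (free_mod A p) k D i"
    by (intro col_exact_fsupp[OF lmodule_regular[OF A] free_resD(1)[OF D] free_resD(1)[OF D]] ext_vanishesD[OF assms(2) D])
qed

lemma ext_vanishes_syzygy: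
  assumes "short_exact A K (free_mod A p) N \<alpha> \<pi>" "ring A" "ext_vanishes A (regular A) n" "ext_vanishes A N m"
  shows "ext_vanishes A K (Suc (max n m))"
  by (rule short_exact.ext_vanishes_sub[OF assms(1)])
    (auto intro: ext_vanishes_mono[OF ext_vanishes_free_mod[OF assms(2,3)]] ext_vanishes_mono[OF assms(4)])

text \<open>
  Pass to syzygies until the resolution is exact in rows and columns; that syzygy is projective by
  \<open>biexact_res_retract\<close>. The syzygies inherit \<open>ext_vanishes\<close> since the free modules have it.
\<close>

lemma presents_has_proj_res:
  fixes N :: "('a, nat \<Rightarrow> 'a) module" and g :: "(nat \<Rightarrow> 'a) \<Rightarrow> 'u"
  assumes A: "ring A" and noeth: "left_noetherian (op_ring A)" and d: "ext_vanishes (op_ring A) (regular (op_ring A)) d"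
    and d': "ext_vanishes A (regular A) d'" and g: "inj g"
    and N: "lmodule A N" and m: "ext_vanishes A N m" and P: "presents A N k D e"
    and bi: "biexact_res A (\<lambda>i. k (i + t)) (\<lambda>i. D (i + t))"
  shows "has_proj_res A N TYPE(('a, 'u) module) t"
  using N m P bi
proof (induction t arbitrary: N m k D e)
  case (0 N m k D e)
  have "biexact_res A k D" using 0(4) by simp
  then obtain p \<alpha> \<beta> where r: "\<alpha> \<in> lmodule_hom A N (free_mod A p)" "\<beta> \<in> lmodule_hom A (free_mod A p) N"
    "\<And>x. x \<in> carrier N \<Longrightarrow> \<beta> (\<alpha> x) = x" using biexact_res_retract[OF A noeth d 0(1,2,3)] by metis
  have gN: "inj_on g (carrier N)" using g by (rule inj_on_subset) simp
  show ?case by (rule has_proj_res_0[OF 0(1) gN retract_free_projective[OF 0(1) r gN]])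
next
  case (Suc t N m k D e)
  let ?K = "(free_mod A (k 0))\<lparr>carrier := lmodule_ker (free_mod A (k 0)) N (\<lambda>x. lin_comb N (k 0) x e)\<rparr>"
  note ses = presents_syzygy(1)[OF A Suc(2,4)]
  obtain f where f: "presents A ?K (\<lambda>i. k (Suc i)) (\<lambda>i. D (Suc i)) f"
    using presents_syzygy(2)[OF A Suc(2,4)] by (elim exE)
  interpret s: short_exact A ?K "free_mod A (k 0)" N "\<lambda>x. x" "\<lambda>x. lin_comb N (k 0) x e" by (rule ses)
  have "has_proj_res A ?K TYPE(('a, 'u) module) t"
    by (rule Suc.IH[OF s.i.M.lmodule_axioms ext_vanishes_syzygy[OF ses A d' Suc(3)] f]) (use Suc(5) in simp)
  then show ?case by (rule has_proj_res_free_Suc[OF ses g])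
qed

text \<open>
  A finitely generated module of finite injective dimension over a Gorenstein ring has finite projective
  dimension. The first syzygy is split off by hand because it lives on the type of row vectors, while
  \<open>N\<close> lives on an arbitrary type.
\<close>

theorem ext_vanishes_imp_proj_dim:
  assumes A: "ring A" "left_noetherian A" and noeth: "left_noetherian (op_ring A)"
    and d: "ext_vanishes (op_ring A) (regular (op_ring A)) d" and d': "ext_vanishes A (regular A) d'"
    and N: "lmodule A (N :: ('a, 'm, 'c) module_scheme)" and fg: "fg_sub A N (carrier N)" and m: "ext_vanishes A N m"
  shows "proj_dim A N < \<infinity>"
proof -
  obtain k D e where P: "presents A N k D e" by (rule presents_exists[OF A N fg])
  obtain g :: "(nat \<Rightarrow> 'a) \<Rightarrow> ('a, 'm) univ" where g: "inj g"
    using ex_inj_nat_ring[OF infinite_univ inj_Inl] by (elim exE)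
  let ?K = "(free_mod A (k 0))\<lparr>carrier := lmodule_ker (free_mod A (k 0)) N (\<lambda>x. lin_comb N (k 0) x e)\<rparr>"
  note ses = presents_syzygy(1)[OF A(1) N P]
  obtain f where f: "presents A ?K (\<lambda>i. k (Suc i)) (\<lambda>i. D (Suc i)) f"
    using presents_syzygy(2)[OF A(1) N P] by (elim exE)
  interpret s: short_exact A ?K "free_mod A (k 0)" N "\<lambda>x. x" "\<lambda>x. lin_comb N (k 0) x e" by (rule ses)
  have fr: "free_res A (\<lambda>i. k (Suc (i + d'))) (\<lambda>i. D (Suc (i + d')))"
    using free_res_shift[OF presentsD(1)[OF P], of "Suc d'"] by simp
  have "col_exact (regular A) (k (Suc (i + d'))) (k (Suc (Suc i + d'))) (k (Suc (Suc (Suc i) + d'))) (D (Suc (i + d'))) (D (Suc (Suc i + d')))" for i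
    using ext_vanishesD[OF d' presentsD(1)[OF P], of "Suc (i + d')"] by simp
  then have bi: "biexact_res A (\<lambda>i. k (Suc (i + d'))) (\<lambda>i. D (Suc (i + d')))" unfolding biexact_res_def using fr by blast
  have "has_proj_res A ?K TYPE(('a, ('a, 'm) univ) module) d'"
    by (rule presents_has_proj_res[OF A(1) noeth d d' g s.i.M.lmodule_axioms ext_vanishes_syzygy[OF ses A(1) d' m] f bi])
  then have "has_proj_res A N TYPE(('a, ('a, 'm) univ) module) (Suc d')" by (rule has_proj_res_free_Suc[OF ses g])
  then obtain P :: "nat \<Rightarrow> ('a, ('a, 'm) univ) module" and \<delta> \<epsilon> where
    "projective_resolution A N P \<delta> \<epsilon>" "\<forall>i>Suc d'. carrier (P i) = {\<zero>\<^bsub>P i\<^esub>}"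
    unfolding has_proj_res_def by (elim exE conjE)
  then have "proj_dim A N \<le> enat (Suc d')" unfolding proj_dim_def by (intro Inf_lower) blast
  then show ?thesis by (metis enat_ord_simps(4) le_less_trans infinity_ne_i1 enat_ord_code(4))
qed

section \<open>Triangular matrix rings\<close>

text \<open>
  The triangular matrix ring by its coordinates: \<open>pr t\<close>, \<open>pm t\<close> and \<open>ps t\<close> are the entries of the matrix \<open>t\<close>, and
  \<open>mk\<close> builds a matrix from its entries. The bimodule is given as a left module \<open>L\<close> over \<open>R\<close> and a left module \<open>N\<close> over
  the opposite ring of \<open>S\<close> on the same group. This description does not change when passing to the opposite ring and
  exchanging the two corners, which a concrete ring of triples would do only up to isomorphism.
\<close>

locale tri_ring =
  T?: ring T + RM: lmodule R L + SM: lmodule "op_ring S" N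
  for T :: "'t ring" and R :: "'r ring" and S :: "'s ring"
    and L :: "('r, 'm, 'c) module_scheme" and N :: "('s, 'm, 'd) module_scheme"
    and pr :: "'t \<Rightarrow> 'r" and pm :: "'t \<Rightarrow> 'm" and ps :: "'t \<Rightarrow> 's" and mk :: "'r \<Rightarrow> 'm \<Rightarrow> 's \<Rightarrow> 't" +
  assumes ring_S: "ring S"
    and same_group: "carrier N = carrier L" "zero N = zero L" "add N = add L"
    and bimodule: "\<lbrakk>r \<in> carrier R; x \<in> carrier L; s \<in> carrier S\<rbrakk> \<Longrightarrow> s \<odot>\<^bsub>N\<^esub> (r \<odot>\<^bsub>L\<^esub> x) = r \<odot>\<^bsub>L\<^esub> (s \<odot>\<^bsub>N\<^esub> x)"
    and coord_closed [simp]: "t \<in> carrier T \<Longrightarrow> pr t \<in> carrier R" "t \<in> carrier T \<Longrightarrow> pm t \<in> carrier L"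
      "t \<in> carrier T \<Longrightarrow> ps t \<in> carrier S"
    and mk_closed [simp]: "\<lbrakk>r \<in> carrier R; x \<in> carrier L; s \<in> carrier S\<rbrakk> \<Longrightarrow> mk r x s \<in> carrier T"
    and coord_mk [simp]: "\<lbrakk>r \<in> carrier R; x \<in> carrier L; s \<in> carrier S\<rbrakk> \<Longrightarrow> pr (mk r x s) = r"
      "\<lbrakk>r \<in> carrier R; x \<in> carrier L; s \<in> carrier S\<rbrakk> \<Longrightarrow> pm (mk r x s) = x"
      "\<lbrakk>r \<in> carrier R; x \<in> carrier L; s \<in> carrier S\<rbrakk> \<Longrightarrow> ps (mk r x s) = s"
    and mk_coord: "t \<in> carrier T \<Longrightarrow> mk (pr t) (pm t) (ps t) = t"
    and coord_add [simp]: "\<lbrakk>t \<in> carrier T; u \<in> carrier T\<rbrakk> \<Longrightarrow> pr (t \<oplus>\<^bsub>T\<^esub> u) = pr t \<oplus>\<^bsub>R\<^esub> pr u"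
      "\<lbrakk>t \<in> carrier T; u \<in> carrier T\<rbrakk> \<Longrightarrow> pm (t \<oplus>\<^bsub>T\<^esub> u) = pm t \<oplus>\<^bsub>L\<^esub> pm u"
      "\<lbrakk>t \<in> carrier T; u \<in> carrier T\<rbrakk> \<Longrightarrow> ps (t \<oplus>\<^bsub>T\<^esub> u) = ps t \<oplus>\<^bsub>S\<^esub> ps u"
    and coord_mult [simp]: "\<lbrakk>t \<in> carrier T; u \<in> carrier T\<rbrakk> \<Longrightarrow> pr (t \<otimes>\<^bsub>T\<^esub> u) = pr t \<otimes>\<^bsub>R\<^esub> pr u"
      "\<lbrakk>t \<in> carrier T; u \<in> carrier T\<rbrakk> \<Longrightarrow> pm (t \<otimes>\<^bsub>T\<^esub> u) = pr t \<odot>\<^bsub>L\<^esub> pm u \<oplus>\<^bsub>L\<^esub> ps u \<odot>\<^bsub>N\<^esub> pm t"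
      "\<lbrakk>t \<in> carrier T; u \<in> carrier T\<rbrakk> \<Longrightarrow> ps (t \<otimes>\<^bsub>T\<^esub> u) = ps t \<otimes>\<^bsub>S\<^esub> ps u"
begin

lemma opposite: "tri_ring (op_ring T) (op_ring S) (op_ring R) N L ps pm pr (\<lambda>s x r. mk r x s)"
proof (intro tri_ring.intro tri_ring_axioms.intro)
  show "ring (op_ring T)" by (rule ring_op_ring) (rule T.ring_axioms)
  show "lmodule (op_ring S) N" by (rule SM.lmodule_axioms)
  show "lmodule (op_ring (op_ring R)) L" using RM.lmodule_axioms by simp
  show "ring (op_ring R)" by (rule ring_op_ring) (rule RM.R.ring_axioms)
qed (auto simp: same_group bimodule mk_coord RM.M.a_comm SM.smult_closed[unfolded same_group op_ring_simps])

lemma N_closed [simp]: "s \<in> carrier S \<Longrightarrow> x \<in> carrier L \<Longrightarrow> s \<odot>\<^bsub>N\<^esub> x \<in> carrier L"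
  using SM.smult_closed[of s x] by (simp add: same_group)

lemma N_zero [simp]: "x \<in> carrier L \<Longrightarrow> \<zero>\<^bsub>S\<^esub> \<odot>\<^bsub>N\<^esub> x = \<zero>\<^bsub>L\<^esub>" "s \<in> carrier S \<Longrightarrow> s \<odot>\<^bsub>N\<^esub> \<zero>\<^bsub>L\<^esub> = \<zero>\<^bsub>L\<^esub>"
  using SM.smult_zero_left[of x] SM.smult_zero_right[of s] by (simp_all add: same_group)

lemma S_closed [simp]: "\<zero>\<^bsub>S\<^esub> \<in> carrier S" "\<one>\<^bsub>S\<^esub> \<in> carrier S"
  using ring_S by (simp_all add: ring.ring_simprules)

lemma coord_eqI: "\<lbrakk>t \<in> carrier T; u \<in> carrier T; pr t = pr u; pm t = pm u; ps t = ps u\<rbrakk> \<Longrightarrow> t = u"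
  by (metis mk_coord)

lemma coord_zero [simp]: "pr \<zero>\<^bsub>T\<^esub> = \<zero>\<^bsub>R\<^esub>" "pm \<zero>\<^bsub>T\<^esub> = \<zero>\<^bsub>L\<^esub>" "ps \<zero>\<^bsub>T\<^esub> = \<zero>\<^bsub>S\<^esub>"
proof -
  interpret S: ring S by (rule ring_S)
  show "pr \<zero>\<^bsub>T\<^esub> = \<zero>\<^bsub>R\<^esub>" using coord_add(1)[of "\<zero>\<^bsub>T\<^esub>" "\<zero>\<^bsub>T\<^esub>"] coord_closed(1)[of "\<zero>\<^bsub>T\<^esub>"]
    by (simp add: RM.R.add.r_cancel_one')
  show "pm \<zero>\<^bsub>T\<^esub> = \<zero>\<^bsub>L\<^esub>" using coord_add(2)[of "\<zero>\<^bsub>T\<^esub>" "\<zero>\<^bsub>T\<^esub>"] coord_closed(2)[of "\<zero>\<^bsub>T\<^esub>"]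
    by (simp add: RM.M.add.r_cancel_one')
  show "ps \<zero>\<^bsub>T\<^esub> = \<zero>\<^bsub>S\<^esub>" using coord_add(3)[of "\<zero>\<^bsub>T\<^esub>" "\<zero>\<^bsub>T\<^esub>"] coord_closed(3)[of "\<zero>\<^bsub>T\<^esub>"]
    by (simp add: S.add.r_cancel_one')
qed

lemma eq_zero_iff: "t \<in> carrier T \<Longrightarrow> t = \<zero>\<^bsub>T\<^esub> \<longleftrightarrow> pr t = \<zero>\<^bsub>R\<^esub> \<and> pm t = \<zero>\<^bsub>L\<^esub> \<and> ps t = \<zero>\<^bsub>S\<^esub>"
  using coord_eqI[of t "\<zero>\<^bsub>T\<^esub>"] by auto

lemma coord_minus [simp]:
  assumes "t \<in> carrier T"
  shows "pr (\<ominus>\<^bsub>T\<^esub> t) = \<ominus>\<^bsub>R\<^esub> pr t" "pm (\<ominus>\<^bsub>T\<^esub> t) = \<ominus>\<^bsub>L\<^esub> pm t" "ps (\<ominus>\<^bsub>T\<^esub> t) = \<ominus>\<^bsub>S\<^esub> ps t"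
proof -
  interpret S: ring S by (rule ring_S)
  have "pr (\<ominus>\<^bsub>T\<^esub> t \<oplus>\<^bsub>T\<^esub> t) = \<zero>\<^bsub>R\<^esub>" "pm (\<ominus>\<^bsub>T\<^esub> t \<oplus>\<^bsub>T\<^esub> t) = \<zero>\<^bsub>L\<^esub>" "ps (\<ominus>\<^bsub>T\<^esub> t \<oplus>\<^bsub>T\<^esub> t) = \<zero>\<^bsub>S\<^esub>"
    using assms by (simp_all only: T.l_neg coord_zero)
  then show "pr (\<ominus>\<^bsub>T\<^esub> t) = \<ominus>\<^bsub>R\<^esub> pr t" "pm (\<ominus>\<^bsub>T\<^esub> t) = \<ominus>\<^bsub>L\<^esub> pm t" "ps (\<ominus>\<^bsub>T\<^esub> t) = \<ominus>\<^bsub>S\<^esub> ps t"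
    using assms by (auto simp: RM.R.minus_equality RM.M.minus_equality S.minus_equality)
qed

section \<open>Noetherian triangular rings\<close>

lemma regT: "lmodule T (regular T)" and regR: "lmodule R (regular R)" and regS: "lmodule S (regular S)"
  by (rule lmodule_regular, rule T.ring_axioms RM.R.ring_axioms ring_S)+

text \<open>
  The graded pieces of a left ideal \<open>H\<close> along the chain \<open>M \<subseteq> R \<oplus> M \<subseteq> T\<close> of left ideals.
\<close>

definition S_part where "S_part H = ps ` H"
definition R_part where "R_part H = {r \<in> carrier R. \<exists>x \<in> carrier L. mk r x \<zero>\<^bsub>S\<^esub> \<in> H}"
definition M_part where "M_part H = {x \<in> carrier L. mk \<zero>\<^bsub>R\<^esub> x \<zero>\<^bsub>S\<^esub> \<in> H}"

lemma mk_add: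
  assumes "r \<in> carrier R" "x \<in> carrier L" "s \<in> carrier S" "r' \<in> carrier R" "x' \<in> carrier L" "s' \<in> carrier S"
  shows "mk r x s \<oplus>\<^bsub>T\<^esub> mk r' x' s' = mk (r \<oplus>\<^bsub>R\<^esub> r') (x \<oplus>\<^bsub>L\<^esub> x') (s \<oplus>\<^bsub>S\<^esub> s')"
proof -
  interpret S: ring S by (rule ring_S)
  show ?thesis by (rule coord_eqI) (use assms in simp_all)
qed

lemma mk_mult:
  assumes "t \<in> carrier T" "r \<in> carrier R" "x \<in> carrier L" "s \<in> carrier S"
  shows "t \<otimes>\<^bsub>T\<^esub> mk r x s = mk (pr t \<otimes>\<^bsub>R\<^esub> r) (pr t \<odot>\<^bsub>L\<^esub> x \<oplus>\<^bsub>L\<^esub> s \<odot>\<^bsub>N\<^esub> pm t) (ps t \<otimes>\<^bsub>S\<^esub> s)"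
proof -
  interpret S: ring S by (rule ring_S)
  show ?thesis by (rule coord_eqI) (use assms in simp_all)
qed

lemma mk_zero [simp]: "mk \<zero>\<^bsub>R\<^esub> \<zero>\<^bsub>L\<^esub> \<zero>\<^bsub>S\<^esub> = \<zero>\<^bsub>T\<^esub>"
  by (rule coord_eqI) simp_all

lemma submodule_U:
  assumes H: "submodule H T (regular T)"
  shows "submodule (S_part H) S (regular S)" "submodule (R_part H) R (regular R)" "submodule (M_part H) R L"
proof -
  interpret S: ring S by (rule ring_S)
  have HT: "H \<subseteq> carrier T" and H0: "\<zero>\<^bsub>T\<^esub> \<in> H" and Ha: "\<And>x y. x \<in> H \<Longrightarrow> y \<in> H \<Longrightarrow> x \<oplus>\<^bsub>T\<^esub> y \<in> H"
    and Hm: "\<And>t x. t \<in> carrier T \<Longrightarrow> x \<in> H \<Longrightarrow> t \<otimes>\<^bsub>T\<^esub> x \<in> H"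
    using H unfolding submodule_iff[OF regT] by auto
  show "submodule (S_part H) S (regular S)" unfolding submodule_iff[OF regS]
  proof (intro conjI ballI)
    show "S_part H \<subseteq> carrier (regular S)" using HT by (auto simp: S_part_def)
    show "\<zero>\<^bsub>regular S\<^esub> \<in> S_part H" using imageI[OF H0, of ps] by (simp add: S_part_def)
    fix x assume "x \<in> S_part H"
    then obtain h where h: "h \<in> H" "x = ps h" by (auto simp: S_part_def)
    show "x \<oplus>\<^bsub>regular S\<^esub> y \<in> S_part H" if yU: "y \<in> S_part H" for y
    proof -
      obtain h' where h': "h' \<in> H" "y = ps h'" using yU by (auto simp: S_part_def)
      have "h \<in> carrier T" "h' \<in> carrier T" using h h' HT by blast+
      then have "ps (h \<oplus>\<^bsub>T\<^esub> h') = x \<oplus>\<^bsub>S\<^esub> y" using h h' by simp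
      then show ?thesis using imageI[OF Ha[OF h(1) h'(1)], of ps] by (simp add: S_part_def)
    qed
    show "s \<odot>\<^bsub>regular S\<^esub> x \<in> S_part H" if s: "s \<in> carrier S" for s
    proof -
      have "ps (mk \<zero>\<^bsub>R\<^esub> \<zero>\<^bsub>L\<^esub> s \<otimes>\<^bsub>T\<^esub> h) = s \<otimes>\<^bsub>S\<^esub> x" using h s subsetD[OF HT h(1)] by simp
      then show ?thesis using imageI[OF Hm[OF _ h(1), of "mk \<zero>\<^bsub>R\<^esub> \<zero>\<^bsub>L\<^esub> s"], of ps] s by (simp add: S_part_def)
    qed
  qed
  show "submodule (R_part H) R (regular R)" unfolding submodule_iff[OF regR]
  proof (intro conjI ballI)
    show "R_part H \<subseteq> carrier (regular R)" by (auto simp: R_part_def)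
    show "\<zero>\<^bsub>regular R\<^esub> \<in> R_part H" using H0 by (auto simp: R_part_def intro!: bexI[of _ "\<zero>\<^bsub>L\<^esub>"])
    fix r assume "r \<in> R_part H"
    then obtain x where r: "r \<in> carrier R" "x \<in> carrier L" "mk r x \<zero>\<^bsub>S\<^esub> \<in> H" by (auto simp: R_part_def)
    show "r \<oplus>\<^bsub>regular R\<^esub> r' \<in> R_part H" if rU: "r' \<in> R_part H" for r'
    proof -
      obtain x' where r': "r' \<in> carrier R" "x' \<in> carrier L" "mk r' x' \<zero>\<^bsub>S\<^esub> \<in> H" using rU by (auto simp: R_part_def)
      have "mk (r \<oplus>\<^bsub>R\<^esub> r') (x \<oplus>\<^bsub>L\<^esub> x') \<zero>\<^bsub>S\<^esub> \<in> H" using Ha[OF r(3) r'(3)] r r' by (simp add: mk_add)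
      then show ?thesis using r r' by (auto simp: R_part_def)
    qed
    show "a \<odot>\<^bsub>regular R\<^esub> r \<in> R_part H" if a: "a \<in> carrier R" for a
    proof -
      have "mk (a \<otimes>\<^bsub>R\<^esub> r) (a \<odot>\<^bsub>L\<^esub> x) \<zero>\<^bsub>S\<^esub> \<in> H" using Hm[OF _ r(3), of "mk a \<zero>\<^bsub>L\<^esub> \<zero>\<^bsub>S\<^esub>"] r a by (simp add: mk_mult)
      then show ?thesis using r a by (auto simp: R_part_def)
    qed
  qed
  show "submodule (M_part H) R L" unfolding submodule_iff[OF RM.lmodule_axioms]
  proof (intro conjI ballI)
    show "M_part H \<subseteq> carrier L" by (auto simp: M_part_def)
    show "\<zero>\<^bsub>L\<^esub> \<in> M_part H" using H0 by (simp add: M_part_def)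
    fix x assume "x \<in> M_part H"
    then have x: "x \<in> carrier L" "mk \<zero>\<^bsub>R\<^esub> x \<zero>\<^bsub>S\<^esub> \<in> H" by (auto simp: M_part_def)
    show "x \<oplus>\<^bsub>L\<^esub> y \<in> M_part H" if "y \<in> M_part H" for y
      using Ha[OF x(2), of "mk \<zero>\<^bsub>R\<^esub> y \<zero>\<^bsub>S\<^esub>"] that x by (simp add: M_part_def mk_add)
    show "a \<odot>\<^bsub>L\<^esub> x \<in> M_part H" if a: "a \<in> carrier R" for a
      using Hm[OF _ x(2), of "mk a \<zero>\<^bsub>L\<^esub> \<zero>\<^bsub>S\<^esub>"] x a by (simp add: mk_mult M_part_def)
  qed
qed

text \<open>
  Lifts of generators of the three parts of \<open>K\<close> generate \<open>K\<close>: modulo the submodule that they generate, the entries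
  of an element of \<open>K\<close> are removed one after the other, in the order \<open>S\<close>, \<open>R\<close>, \<open>M\<close>.
\<close>

lemma left_noetherian_triangular:
  assumes "left_noetherian R" "left_noetherian S" "fg_sub R L (carrier L)"
  shows "left_noetherian T"
  unfolding left_noetherian_iff[OF T.ring_axioms]
proof (intro allI impI)
  fix K assume K: "submodule K T (regular T)"
  interpret S: ring S by (rule ring_S)
  interpret K: lsubmodule T "regular T" K by (rule lsubmoduleI[OF regT K])
  note U = submodule_U[OF K]
  have nL: "noetherian_lmodule R L"
    by (rule fg_imp_noetherian[OF RM.R.ring_axioms assms(1) RM.lmodule_axioms assms(3)])
  obtain XS where XS: "finite XS" "XS \<subseteq> S_part K" "\<And>H. submodule H S (regular S) \<Longrightarrow> XS \<subseteq> H \<Longrightarrow> S_part K \<subseteq> H"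
    using assms(2) U(1) unfolding left_noetherian_iff[OF ring_S] fg_sub_def by metis
  obtain XR where XR: "finite XR" "XR \<subseteq> R_part K" "\<And>H. submodule H R (regular R) \<Longrightarrow> XR \<subseteq> H \<Longrightarrow> R_part K \<subseteq> H"
    using assms(1) U(2) unfolding left_noetherian_iff[OF RM.R.ring_axioms] fg_sub_def by metis
  obtain XM where XM: "finite XM" "XM \<subseteq> M_part K" "\<And>H. submodule H R L \<Longrightarrow> XM \<subseteq> H \<Longrightarrow> M_part K \<subseteq> H"
    using nL U(3) unfolding noetherian_lmodule_def fg_sub_def by metis
  obtain YS where YS: "YS \<subseteq> K" "finite YS" "XS = ps ` YS"
    using finite_subset_image[OF XS(1) XS(2)[unfolded S_part_def]] by blast
  have "\<forall>r\<in>XR. \<exists>x\<in>carrier L. mk r x \<zero>\<^bsub>S\<^esub> \<in> K" using XR(2) by (auto simp: R_part_def)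
  then obtain y where y: "\<forall>r\<in>XR. y r \<in> carrier L \<and> mk r (y r) \<zero>\<^bsub>S\<^esub> \<in> K" by metis
  let ?YR = "(\<lambda>r. mk r (y r) \<zero>\<^bsub>S\<^esub>) ` XR" and ?YM = "(\<lambda>x. mk \<zero>\<^bsub>R\<^esub> x \<zero>\<^bsub>S\<^esub>) ` XM"
  show "fg_sub T (regular T) K" unfolding fg_sub_def
  proof (intro exI[of _ "YS \<union> ?YR \<union> ?YM"] conjI allI impI)
    show "finite (YS \<union> ?YR \<union> ?YM)" using YS XR XM by simp
    show "YS \<union> ?YR \<union> ?YM \<subseteq> K" using YS y XM(2) by (auto simp: M_part_def)
    fix H assume H: "submodule H T (regular T)" "YS \<union> ?YR \<union> ?YM \<subseteq> H"
    have HK: "submodule (H \<inter> K) T (regular T)" by (rule submodule_Int[OF regT H(1) K])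
    interpret HK: lsubmodule T "regular T" "H \<inter> K" by (rule lsubmoduleI[OF regT HK])
    note V = submodule_U[OF HK]
    have sub: "YS \<union> ?YR \<union> ?YM \<subseteq> H \<inter> K" using H(2) \<open>YS \<union> ?YR \<union> ?YM \<subseteq> K\<close> by blast
    have "XS \<subseteq> S_part (H \<inter> K)" unfolding YS(3) S_part_def using sub by (intro image_mono) blast
    then have VS: "S_part K \<subseteq> S_part (H \<inter> K)" by (rule XS(3)[OF V(1)])
    have "XR \<subseteq> R_part (H \<inter> K)"
    proof
      fix r assume r: "r \<in> XR"
      then have "mk r (y r) \<zero>\<^bsub>S\<^esub> \<in> H \<inter> K" using sub by blast
      moreover have "r \<in> carrier R" using XR(2) r by (auto simp: R_part_def)
      ultimately show "r \<in> R_part (H \<inter> K)" using y r by (auto simp: R_part_def intro!: bexI[of _ "y r"])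
    qed
    then have VR: "R_part K \<subseteq> R_part (H \<inter> K)" by (rule XR(3)[OF V(2)])
    have "XM \<subseteq> M_part (H \<inter> K)" using sub XM(2) by (auto simp: M_part_def)
    then have VM: "M_part K \<subseteq> M_part (H \<inter> K)" by (rule XM(3)[OF V(3)])
    show "K \<subseteq> H"
    proof
      fix x assume x: "x \<in> K"
      have xT: "x \<in> carrier T" using K.sub_closed(1)[OF x] by simp
      obtain h where h: "h \<in> H \<inter> K" "ps x = ps h" using VS x by (auto simp: S_part_def)
      have hT: "h \<in> carrier T" using HK.sub_closed(1)[OF h(1)] by simp
      define y where "y = x \<oplus>\<^bsub>T\<^esub> \<ominus>\<^bsub>T\<^esub> h"
      have yK: "y \<in> K" using K.sub_closed(3)[OF x] K.minus_closed[of h] h by (simp add: y_def)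
      have yT: "y \<in> carrier T" using xT hT by (simp add: y_def)
      have "ps y = \<zero>\<^bsub>S\<^esub>" using h(2) xT hT by (simp add: y_def S.r_neg)
      then have "mk (pr y) (pm y) \<zero>\<^bsub>S\<^esub> = y" using mk_coord[OF yT] by simp
      then have "pr y \<in> R_part K" using yK yT by (auto simp: R_part_def intro!: bexI[of _ "pm y"])
      then obtain a where a: "a \<in> carrier L" "mk (pr y) a \<zero>\<^bsub>S\<^esub> \<in> H \<inter> K" using VR by (auto simp: R_part_def)
      let ?h = "mk (pr y) a \<zero>\<^bsub>S\<^esub>"
      define z where "z = y \<oplus>\<^bsub>T\<^esub> \<ominus>\<^bsub>T\<^esub> ?h"
      have zT: "z \<in> carrier T" using yT a by (simp add: z_def)
      have zK: "z \<in> K" using K.sub_closed(3)[OF yK] K.minus_closed[of ?h] a by (simp add: z_def)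
      have zeq: "z = mk \<zero>\<^bsub>R\<^esub> (pm z) \<zero>\<^bsub>S\<^esub>"
        by (rule coord_eqI) (use zT yT a \<open>ps y = _\<close> in \<open>simp_all add: z_def RM.R.r_neg S.r_neg\<close>)
      then have "pm z \<in> M_part K" using zK zT by (simp add: M_part_def)
      then have "pm z \<in> M_part (H \<inter> K)" using VM by blast
      then have "mk \<zero>\<^bsub>R\<^esub> (pm z) \<zero>\<^bsub>S\<^esub> \<in> H \<inter> K" by (simp add: M_part_def)
      then have "z \<in> H \<inter> K" using zeq by metis
      have "y = z \<oplus>\<^bsub>T\<^esub> ?h" using yT a by (simp add: z_def T.a_assoc T.l_neg)
      then have "y \<in> H \<inter> K" using HK.sub_closed(3)[OF \<open>z \<in> H \<inter> K\<close> a(2)] by simp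
      moreover have "x = y \<oplus>\<^bsub>T\<^esub> h" using xT hT by (simp add: y_def T.a_assoc T.l_neg)
      ultimately show "x \<in> H" using HK.sub_closed(3)[OF _ h(1), of y] by simp
    qed
  qed
qed

text \<open>
  The bimodule is a left ideal of \<open>T\<close>, on which \<open>T\<close> acts through \<open>R\<close>.
\<close>

lemma fg_of_left_noetherian:
  assumes "left_noetherian T" shows "fg_sub R L (carrier L)"
proof -
  interpret S: ring S by (rule ring_S)
  let ?\<iota> = "\<lambda>x. mk \<zero>\<^bsub>R\<^esub> x \<zero>\<^bsub>S\<^esub>"
  have img: "submodule (?\<iota> ` H) T (regular T)" if H: "submodule H R L" for H
  proof -
    interpret H: lsubmodule R L H by (rule lsubmoduleI[OF RM.lmodule_axioms H])
    show ?thesis unfolding submodule_iff[OF regT]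
    proof (intro conjI ballI)
      show "?\<iota> ` H \<subseteq> carrier (regular T)" using H.sub_closed(1) by auto
      show "\<zero>\<^bsub>regular T\<^esub> \<in> ?\<iota> ` H" using H.sub_closed(2) by (intro image_eqI[of _ _ "\<zero>\<^bsub>L\<^esub>"]) simp_all
    next
      fix u v assume "u \<in> ?\<iota> ` H" "v \<in> ?\<iota> ` H"
      then obtain x y where "x \<in> H" "y \<in> H" "u = ?\<iota> x" "v = ?\<iota> y" by blast
      then show "u \<oplus>\<^bsub>regular T\<^esub> v \<in> ?\<iota> ` H" using H.sub_closed(1,3)
        by (intro image_eqI[of _ _ "x \<oplus>\<^bsub>L\<^esub> y"]) (simp_all add: mk_add)
    next
      fix t u assume t: "t \<in> carrier T" and "u \<in> ?\<iota> ` H"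
      then obtain x where "x \<in> H" "u = ?\<iota> x" by blast
      then show "t \<odot>\<^bsub>regular T\<^esub> u \<in> ?\<iota> ` H" using H.sub_closed(1,4) t
        by (intro image_eqI[of _ _ "pr t \<odot>\<^bsub>L\<^esub> x"]) (simp_all add: mk_mult)
    qed
  qed
  have "fg_sub T (regular T) (?\<iota> ` carrier L)"
    using assms img[OF submodule_carrier[OF RM.lmodule_axioms]] by (simp add: left_noetherian_iff[OF T.ring_axioms])
  then obtain X where X: "finite X" "X \<subseteq> ?\<iota> ` carrier L"
    "\<And>H. submodule H T (regular T) \<Longrightarrow> X \<subseteq> H \<Longrightarrow> ?\<iota> ` carrier L \<subseteq> H" unfolding fg_sub_def by metis
  obtain Y where Y: "Y \<subseteq> carrier L" "finite Y" "X = ?\<iota> ` Y" using finite_subset_image[OF X(1,2)] by metis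
  show ?thesis unfolding fg_sub_def
  proof (intro exI[of _ Y] conjI allI impI)
    fix H assume H: "submodule H R L" "Y \<subseteq> H"
    have HL: "H \<subseteq> carrier L" using H(1) unfolding submodule_iff[OF RM.lmodule_axioms] by simp
    have "?\<iota> ` carrier L \<subseteq> ?\<iota> ` H" using X(3)[OF img[OF H(1)]] H(2) Y(3) by blast
    show "carrier L \<subseteq> H"
    proof
      fix x assume x: "x \<in> carrier L"
      then obtain h where h: "h \<in> H" "?\<iota> x = ?\<iota> h" using \<open>?\<iota> ` carrier L \<subseteq> ?\<iota> ` H\<close> by blast
      have "pm (?\<iota> x) = pm (?\<iota> h)" using h by simp
      then have "x = h" using x h(1) HL by (simp add: subset_iff)
      then show "x \<in> H" using h by simp
    qed
  qed (use Y in auto)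
qed

section \<open>Resolutions over triangular rings\<close>

lemma coord_lin_comb:
  assumes "x \<in> vecs T p" "y \<in> vecs T p"
  shows "pr (lin_comb (regular T) p x y) = lin_comb (regular R) p (\<lambda>i. pr (x i)) (\<lambda>i. pr (y i))" (is ?a)
    and "pm (lin_comb (regular T) p x y) = lin_comb L p (\<lambda>i. pr (x i)) (\<lambda>i. pm (y i)) \<oplus>\<^bsub>L\<^esub> lin_comb N p (\<lambda>i. ps (y i)) (\<lambda>i. pm (x i))" (is ?b)
    and "ps (lin_comb (regular T) p x y) = lin_comb (regular S) p (\<lambda>i. ps (x i)) (\<lambda>i. ps (y i))" (is ?c)
proof -
  have "?a \<and> ?b \<and> ?c" using assms
  proof (induction p)
    case 0 show ?case by (simp add: same_group)
  next
    case (Suc p)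
    have v: "x \<in> vecs T p" "y \<in> vecs T p" "x p \<in> carrier T" "y p \<in> carrier T" using Suc.prems by (auto simp: vecs_Suc)
    have c: "lin_comb (regular T) p x y \<in> carrier T" by (rule lin_comb_regular_closed[OF T.ring_axioms v(1,2)])
    have c1: "lin_comb L p (\<lambda>i. pr (x i)) (\<lambda>i. pm (y i)) \<in> carrier L" using v by (intro RM.lin_comb_closed) (auto simp: Pi_def)
    have "lin_comb N p (\<lambda>i. ps (y i)) (\<lambda>i. pm (x i)) \<in> carrier N" using v by (intro SM.lin_comb_closed) (auto simp: same_group Pi_def)
    then have c2: "lin_comb N p (\<lambda>i. ps (y i)) (\<lambda>i. pm (x i)) \<in> carrier L" by (simp add: same_group)
    show ?case using Suc.IH[OF v(1,2)] v c c1 c2 by (simp add: same_group RM.M.a_ac)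
  qed
  then show ?a ?b ?c by blast+
qed

lemma N_lin_comb_smult:
  assumes "r \<in> carrier R" "s \<in> vecs S p" "y \<in> vecs L p"
  shows "lin_comb N p s (\<lambda>i. r \<odot>\<^bsub>L\<^esub> y i) = r \<odot>\<^bsub>L\<^esub> lin_comb N p s y"
  using assms(2,3)
proof (induction p)
  case (Suc p)
  have v: "s \<in> vecs S p" "y \<in> vecs L p" "s p \<in> carrier S" "y p \<in> carrier L" using Suc.prems by (auto simp: vecs_Suc)
  have "lin_comb N p s y \<in> carrier N" using v by (intro SM.lin_comb_closed) (auto simp: same_group Pi_def)
  then show ?case using Suc.IH[OF v(1,2)] v assms(1) by (simp add: same_group bimodule RM.smult_r_distr)
qed (use assms in \<open>simp add: same_group\<close>)

text \<open>
  A row over \<open>R\<close> times a matrix over the bimodule times a column over \<open>S\<close>; the two bracketings agree because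
  the two actions commute.
\<close>

lemma lin_comb_interchange:
  assumes "x \<in> vecs R q" "s \<in> vecs S p" "Y \<in> {..<q} \<rightarrow> {..<p} \<rightarrow> carrier L"
  shows "lin_comb N p s (\<lambda>b. lin_comb L q x (\<lambda>a. Y a b)) = lin_comb L q x (\<lambda>a. lin_comb N p s (Y a))"
  using assms(1,3)
proof (induction q)
  case 0
  then show ?case using SM.lin_comb_zero_right[of s p] assms(2) by (simp add: same_group)
next
  case (Suc q)
  have v: "x \<in> vecs R q" "Y \<in> {..<q} \<rightarrow> {..<p} \<rightarrow> carrier L" "x q \<in> carrier R" "Y q \<in> vecs L p"
    using Suc.prems by (auto simp: vecs_Suc Pi_def)
  have u: "(\<lambda>b. lin_comb L q x (\<lambda>a. Y a b)) \<in> vecs N p" using v by (auto simp: same_group Pi_def intro!: RM.lin_comb_closed)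
  have w: "(\<lambda>b. x q \<odot>\<^bsub>L\<^esub> Y q b) \<in> vecs N p" using v by (auto simp: same_group Pi_def)
  have "lin_comb N p s (\<lambda>b. lin_comb L q x (\<lambda>a. Y a b) \<oplus>\<^bsub>N\<^esub> x q \<odot>\<^bsub>L\<^esub> Y q b) =
      lin_comb N p s (\<lambda>b. lin_comb L q x (\<lambda>a. Y a b)) \<oplus>\<^bsub>N\<^esub> lin_comb N p s (\<lambda>b. x q \<odot>\<^bsub>L\<^esub> Y q b)"
    using assms(2) u w by (intro SM.lin_comb_add_right) auto
  then show ?case using Suc.IH[OF v(1,2)] N_lin_comb_smult[OF v(3) assms(2) v(4)] by (simp add: same_group)
qed

lemma N_lin_comb_closed: "s \<in> vecs S p \<Longrightarrow> y \<in> vecs L p \<Longrightarrow> lin_comb N p s y \<in> carrier L"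
  using SM.lin_comb_closed[of s p y] by (simp add: same_group)

lemma prod_zero_coord:
  assumes F: "F \<in> mats T r q" and E: "E \<in> mats T q p" and z: "prod_zero T r q p F E" and a: "a < r" and c: "c < p"
  shows "lin_comb (regular R) q (\<lambda>b. pr (F a b)) (\<lambda>b. pr (E b c)) = \<zero>\<^bsub>R\<^esub>"
    "lin_comb L q (\<lambda>b. pr (F a b)) (\<lambda>b. pm (E b c)) \<oplus>\<^bsub>L\<^esub> lin_comb N q (\<lambda>b. ps (E b c)) (\<lambda>b. pm (F a b)) = \<zero>\<^bsub>L\<^esub>"
    "lin_comb (regular S) q (\<lambda>b. ps (F a b)) (\<lambda>b. ps (E b c)) = \<zero>\<^bsub>S\<^esub>"
proof -
  have eq: "lin_comb (regular T) q (F a) (\<lambda>b. E b c) = \<zero>\<^bsub>T\<^esub>" using z a c by (simp add: prod_zero_def)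
  note l = coord_lin_comb[OF matsD[OF F a] mats_col[OF E c], unfolded eq coord_zero]
  show "lin_comb (regular R) q (\<lambda>b. pr (F a b)) (\<lambda>b. pr (E b c)) = \<zero>\<^bsub>R\<^esub>"
    "lin_comb L q (\<lambda>b. pr (F a b)) (\<lambda>b. pm (E b c)) \<oplus>\<^bsub>L\<^esub> lin_comb N q (\<lambda>b. ps (E b c)) (\<lambda>b. pm (F a b)) = \<zero>\<^bsub>L\<^esub>"
    "lin_comb (regular S) q (\<lambda>b. ps (F a b)) (\<lambda>b. ps (E b c)) = \<zero>\<^bsub>S\<^esub>" using l by simp_all
qed

lemma mat_coord:
  assumes "E \<in> mats T q p"
  shows "(\<lambda>i j. pr (E i j)) \<in> mats R q p" "(\<lambda>i j. ps (E i j)) \<in> mats S q p" "(\<lambda>i j. pm (E i j)) \<in> {..<q} \<rightarrow> {..<p} \<rightarrow> carrier L"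
  using assms by (auto simp: Pi_def)

text \<open>
  Rows with entries in the lower right corner are stable under multiplication with matrices over \<open>T\<close> from the
  right, so exactness over \<open>T\<close> restricts to them.
\<close>

lemma free_res_S:
  assumes D: "free_res T k D" shows "free_res S k (\<lambda>n i j. ps (D n i j))"
  unfolding free_res_def
proof (intro allI conjI)
  fix n
  interpret S: ring S by (rule ring_S)
  note D1 = free_resD(1)[OF D, of n] and D2 = free_resD(1)[OF D, of "Suc n"] and Dz = free_resD(2)[OF D, of n] and Dx = free_resD(3)[OF D, of n]
  show "(\<lambda>i j. ps (D n i j)) \<in> mats S (k (Suc n)) (k n)" by (rule mat_coord[OF D1])
  show "prod_zero S (k (Suc (Suc n))) (k (Suc n)) (k n) (\<lambda>i j. ps (D (Suc n) i j)) (\<lambda>i j. ps (D n i j))"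
    unfolding prod_zero_def using prod_zero_coord(3)[OF D2 D1 Dz] by simp
  show "row_exact S (k (Suc (Suc n))) (k (Suc n)) (k n) (\<lambda>i j. ps (D (Suc n) i j)) (\<lambda>i j. ps (D n i j))"
    unfolding row_exact_iff
  proof (intro ballI impI)
    let ?q = "k (Suc n)" and ?r = "k (Suc (Suc n))"
    fix x assume x: "x \<in> vecs S ?q" "\<forall>j<k n. lin_comb (regular S) ?q x (\<lambda>i. ps (D n i j)) = \<zero>\<^bsub>S\<^esub>"
    define u where "u = (\<lambda>i. mk \<zero>\<^bsub>R\<^esub> \<zero>\<^bsub>L\<^esub> (x i))"
    have u: "u \<in> vecs T ?q" using x by (auto simp: u_def Pi_def)
    have "lin_comb (regular T) ?q u (\<lambda>i. D n i j) = \<zero>\<^bsub>T\<^esub>" if j: "j < k n" for j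
    proof -
      have col: "(\<lambda>i. D n i j) \<in> vecs T ?q" by (rule mats_col[OF D1 j])
      have "lin_comb (regular R) ?q (\<lambda>i. pr (u i)) (\<lambda>i. pr (D n i j)) = \<zero>\<^bsub>R\<^esub>"
        using lmodule.lin_comb_zero_left'[OF regR, of ?q "\<lambda>i. pr (u i)" "\<lambda>i. pr (D n i j)"] x col by (auto simp: u_def Pi_def)
      moreover have "lin_comb L ?q (\<lambda>i. pr (u i)) (\<lambda>i. pm (D n i j)) = \<zero>\<^bsub>L\<^esub>"
        by (rule RM.lin_comb_zero_left') (use x col in \<open>auto simp: u_def Pi_def\<close>)
      moreover have "lin_comb N ?q (\<lambda>i. ps (D n i j)) (\<lambda>i. pm (u i)) = \<zero>\<^bsub>L\<^esub>"
        using SM.lin_comb_zero_right'[of ?q "\<lambda>i. pm (u i)" "\<lambda>i. ps (D n i j)"] x col by (auto simp: u_def same_group Pi_def)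
      moreover have "lin_comb (regular S) ?q (\<lambda>i. ps (u i)) (\<lambda>i. ps (D n i j)) = lin_comb (regular S) ?q x (\<lambda>i. ps (D n i j))"
        by (rule lin_comb_cong) (use x in \<open>auto simp: u_def Pi_def\<close>)
      ultimately show ?thesis
        using coord_lin_comb[OF u col] x(2) j lin_comb_regular_closed[OF T.ring_axioms u col] by (simp add: eq_zero_iff)
    qed
    then obtain w where w: "w \<in> vecs T ?r" "\<And>i. i < ?q \<Longrightarrow> u i = lin_comb (regular T) ?r w (\<lambda>l. D (Suc n) l i)"
      using row_exactD[OF Dx u] by blast
    have "x i = lin_comb (regular S) ?r (\<lambda>l. ps (w l)) (\<lambda>l. ps (D (Suc n) l i))" if i: "i < ?q" for i
    proof -
      have "x i = ps (u i)" using x i by (auto simp: u_def Pi_def)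
      then show ?thesis using w(2)[OF i] coord_lin_comb(3)[OF w(1) mats_col[OF D2 i]] by simp
    qed
    moreover have "(\<lambda>l. ps (w l)) \<in> vecs S ?r" using w by (auto simp: Pi_def)
    ultimately show "\<exists>w\<in>vecs S ?r. \<forall>i<?q. x i = lin_comb (regular S) ?r w (\<lambda>l. ps (D (Suc n) l i))"
      by (intro bexI[of _ "\<lambda>l. ps (w l)"]) auto
  qed
qed

text \<open>
  A row \<open>x\<close> over \<open>R\<close> that is annihilated by the \<open>R\<close>-part of \<open>D i\<close> has to be completed by a row \<open>w\<close> over the bimodule to a row
  over \<open>T\<close> that is annihilated by \<open>D i\<close>; then exactness over \<open>T\<close> applies. The required equation expresses \<open>x\<close> times the \<open>M\<close>-part of
  \<open>D i\<close> as an image under the \<open>S\<close>-part of \<open>D i\<close>. It is solvable since the left-hand side is a cycle and \<open>Tor\<close> vanishes.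
\<close>

lemma free_res_R:
  assumes D: "free_res T k D"
    and tor: "\<And>i. i \<ge> m \<Longrightarrow> col_exact N (k (Suc (Suc i))) (k (Suc i)) (k i) (transp (\<lambda>a b. ps (D (Suc i) a b))) (transp (\<lambda>a b. ps (D i a b)))"
  shows "free_res R (\<lambda>i. k (i + Suc m)) (\<lambda>n i j. pr (D (n + Suc m) i j))"
  unfolding free_res_def
proof (intro allI conjI)
  fix n'
  define n where "n = n' + m"
  interpret S: ring S by (rule ring_S)
  note D0 = free_resD(1)[OF D, of n] and D1 = free_resD(1)[OF D, of "Suc n"] and D2 = free_resD(1)[OF D, of "Suc (Suc n)"]
    and Dz0 = free_resD(2)[OF D, of n] and Dz = free_resD(2)[OF D, of "Suc n"] and Dx = free_resD(3)[OF D, of "Suc n"]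
  let ?p = "k (Suc n)" and ?q = "k (Suc (Suc n))" and ?r = "k (Suc (Suc (Suc n)))"
  have s: "n' + Suc m = Suc n" "Suc n' + Suc m = Suc (Suc n)" "Suc (Suc n') + Suc m = Suc (Suc (Suc n))" by (auto simp: n_def)
  show "(\<lambda>i j. pr (D (n' + Suc m) i j)) \<in> mats R (k (Suc n' + Suc m)) (k (n' + Suc m))"
    unfolding s by (rule mat_coord[OF D1])
  show "prod_zero R (k (Suc (Suc n') + Suc m)) (k (Suc n' + Suc m)) (k (n' + Suc m))
     (\<lambda>i j. pr (D (Suc n' + Suc m) i j)) (\<lambda>i j. pr (D (n' + Suc m) i j))"
    unfolding prod_zero_def s using prod_zero_coord(1)[OF D2 D1 Dz] by simp
  show "row_exact R (k (Suc (Suc n') + Suc m)) (k (Suc n' + Suc m)) (k (n' + Suc m))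
     (\<lambda>i j. pr (D (Suc n' + Suc m) i j)) (\<lambda>i j. pr (D (n' + Suc m) i j))"
    unfolding row_exact_iff s
  proof (intro ballI impI)
    fix x assume x: "x \<in> vecs R ?q" "\<forall>j<?p. lin_comb (regular R) ?q x (\<lambda>i. pr (D (Suc n) i j)) = \<zero>\<^bsub>R\<^esub>"
    let ?E = "D (Suc n)"
    \<comment> \<open>the product of \<open>x\<close> with the bimodule part of \<open>D (n + 1)\<close>\<close>
    define v where "v = (\<lambda>b. lin_comb L ?q x (\<lambda>a. pm (?E a b)))"
    have vL: "v b \<in> carrier L" if "b < ?p" for b unfolding v_def
      by (rule RM.lin_comb_closed[OF x(1)]) (use mats_col[OF D1 that] in \<open>auto simp: Pi_def\<close>)
    have v: "v \<in> vecs N ?p" using vL by (simp add: same_group)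
    \<comment> \<open>\<open>v\<close> is a cycle: its image is minus \<open>x DR DM\<close>, and \<open>x DR = 0\<close>\<close>
    have "lin_comb N ?p (transp (\<lambda>a b. ps (D n a b)) c) v = \<zero>\<^bsub>N\<^esub>" if c: "c < k n" for c
    proof -
      let ?s = "\<lambda>b. ps (D n b c)"
      have sv: "?s \<in> vecs S ?p" using mats_col[OF D0 c] by (auto simp: Pi_def)
      have pmE: "(\<lambda>a b. pm (?E a b)) \<in> {..<?q} \<rightarrow> {..<?p} \<rightarrow> carrier L" by (rule mat_coord[OF D1])
      have dm: "(\<lambda>b. pm (D n b c)) \<in> vecs L ?p" using mats_col[OF D0 c] by (auto simp: Pi_def)
      have prE: "(\<lambda>a b. pr (?E a b)) \<in> mats R ?q ?p" by (rule mat_coord[OF D1])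
      have g: "(\<lambda>a. lin_comb L ?p (\<lambda>b. pr (?E a b)) (\<lambda>b. pm (D n b c))) \<in> vecs L ?q"
        using matsD[OF prE] dm by (auto simp: Pi_def)
      have "lin_comb N ?p ?s v = lin_comb L ?q x (\<lambda>a. lin_comb N ?p ?s (\<lambda>b. pm (?E a b)))"
        unfolding v_def by (rule lin_comb_interchange[OF x(1) sv pmE])
      also have "\<dots> = lin_comb L ?q x (\<lambda>a. \<ominus>\<^bsub>L\<^esub> lin_comb L ?p (\<lambda>b. pr (?E a b)) (\<lambda>b. pm (D n b c)))"
      proof (rule lin_comb_cong[OF refl])
        fix a assume a: "a < ?q"
        have "lin_comb L ?p (\<lambda>b. pr (?E a b)) (\<lambda>b. pm (D n b c)) \<oplus>\<^bsub>L\<^esub> lin_comb N ?p ?s (\<lambda>b. pm (?E a b)) = \<zero>\<^bsub>L\<^esub>"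
          by (rule prod_zero_coord(2)[OF D1 D0 Dz0 a c])
        moreover have "lin_comb L ?p (\<lambda>b. pr (?E a b)) (\<lambda>b. pm (D n b c)) \<in> carrier L" using g a by auto
        moreover have "lin_comb N ?p ?s (\<lambda>b. pm (?E a b)) \<in> carrier L"
          by (rule N_lin_comb_closed[OF sv]) (use matsD[OF D1 a] in \<open>auto simp: Pi_def\<close>)
        ultimately show "lin_comb N ?p ?s (\<lambda>b. pm (?E a b)) = \<ominus>\<^bsub>L\<^esub> lin_comb L ?p (\<lambda>b. pr (?E a b)) (\<lambda>b. pm (D n b c))"
          by (metis RM.M.a_comm RM.M.minus_equality)
      qed
      also have "\<dots> = \<ominus>\<^bsub>L\<^esub> lin_comb L ?q x (\<lambda>a. lin_comb L ?p (\<lambda>b. pr (?E a b)) (\<lambda>b. pm (D n b c)))"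
        by (rule RM.lin_comb_minus_right[OF x(1) g])
      also have "lin_comb L ?q x (\<lambda>a. lin_comb L ?p (\<lambda>b. pr (?E a b)) (\<lambda>b. pm (D n b c))) =
          lin_comb L ?p (\<lambda>j. lin_comb (regular R) ?q x (\<lambda>i. pr (?E i j))) (\<lambda>b. pm (D n b c))"
        by (rule lin_comb_assoc[OF RM.lmodule_axioms x(1) prE dm])
      also have "\<dots> = \<zero>\<^bsub>L\<^esub>" by (rule RM.lin_comb_zero_left') (use x(2) dm in auto)
      finally show ?thesis by (simp add: transp_def same_group)
    qed
    then obtain w where w: "w \<in> vecs N ?q" "\<And>b. b < ?p \<Longrightarrow> v b = lin_comb N ?q (transp (\<lambda>a b. ps (?E a b)) b) w"
      using col_exactD[OF tor[of n] v] by (auto simp: n_def)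
    have wL: "w \<in> vecs L ?q" using w(1) by (simp add: same_group)
    define u where "u = (\<lambda>a. mk (x a) (\<ominus>\<^bsub>L\<^esub> w a) \<zero>\<^bsub>S\<^esub>)"
    have u: "u \<in> vecs T ?q" using x wL by (auto simp: u_def Pi_def)
    have pu: "pr (u a) = x a" "pm (u a) = \<ominus>\<^bsub>N\<^esub> w a" "ps (u a) = \<zero>\<^bsub>S\<^esub>" if "a < ?q" for a
    proof -
      have "\<ominus>\<^bsub>N\<^esub> w a = \<ominus>\<^bsub>L\<^esub> w a" by (simp add: a_inv_def m_inv_def same_group)
      then show "pr (u a) = x a" "pm (u a) = \<ominus>\<^bsub>N\<^esub> w a" "ps (u a) = \<zero>\<^bsub>S\<^esub>"
        using x(1) wL that by (auto simp: u_def Pi_def)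
    qed
    have "lin_comb (regular T) ?q u (\<lambda>i. ?E i j) = \<zero>\<^bsub>T\<^esub>" if j: "j < ?p" for j
    proof -
      have col: "(\<lambda>i. ?E i j) \<in> vecs T ?q" by (rule mats_col[OF D1 j])
      have "lin_comb (regular R) ?q (\<lambda>i. pr (u i)) (\<lambda>i. pr (?E i j)) = lin_comb (regular R) ?q x (\<lambda>i. pr (?E i j))"
        by (rule lin_comb_cong) (auto simp: pu)
      moreover have "lin_comb L ?q (\<lambda>i. pr (u i)) (\<lambda>i. pm (?E i j)) = v j"
        unfolding v_def by (rule lin_comb_cong) (auto simp: pu)
      moreover have "lin_comb N ?q (\<lambda>i. ps (?E i j)) (\<lambda>i. pm (u i)) = \<ominus>\<^bsub>L\<^esub> v j"
      proof -
        have "lin_comb N ?q (\<lambda>i. ps (?E i j)) (\<lambda>i. pm (u i)) = lin_comb N ?q (\<lambda>i. ps (?E i j)) (\<lambda>i. \<ominus>\<^bsub>N\<^esub> w i)"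
          by (rule lin_comb_cong) (auto simp: pu)
        also have "\<dots> = \<ominus>\<^bsub>N\<^esub> lin_comb N ?q (\<lambda>i. ps (?E i j)) w"
          by (rule SM.lin_comb_minus_right[OF _ w(1)]) (use col in \<open>auto simp: Pi_def\<close>)
        also have "\<dots> = \<ominus>\<^bsub>L\<^esub> v j" unfolding w(2)[OF j] by (simp add: transp_def a_inv_def m_inv_def same_group)
        finally show ?thesis .
      qed
      moreover have "lin_comb (regular S) ?q (\<lambda>i. ps (u i)) (\<lambda>i. ps (?E i j)) = \<zero>\<^bsub>S\<^esub>"
        using lmodule.lin_comb_zero_left'[OF regS, of ?q "\<lambda>i. ps (u i)" "\<lambda>i. ps (?E i j)"] pu(3) col by (auto simp: Pi_def)
      ultimately show ?thesis
        using coord_lin_comb[OF u col] x(2) j vL[OF j] lin_comb_regular_closed[OF T.ring_axioms u col]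
        by (simp add: eq_zero_iff RM.M.r_neg)
    qed
    then obtain t where t: "t \<in> vecs T ?r" "\<And>i. i < ?q \<Longrightarrow> u i = lin_comb (regular T) ?r t (\<lambda>l. D (Suc (Suc n)) l i)"
      using row_exactD[OF Dx u] by blast
    have "x i = lin_comb (regular R) ?r (\<lambda>l. pr (t l)) (\<lambda>l. pr (D (Suc (Suc n)) l i))" if i: "i < ?q" for i
      using pu(1)[OF i] t(2)[OF i] coord_lin_comb(1)[OF t(1) mats_col[OF D2 i]] by simp
    moreover have "(\<lambda>l. pr (t l)) \<in> vecs R ?r" using t by (auto simp: Pi_def)
    ultimately show "\<exists>w\<in>vecs R ?r. \<forall>i<?q. x i = lin_comb (regular R) ?r w (\<lambda>l. pr (D (Suc (Suc n)) l i))"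
      by (intro bexI[of _ "\<lambda>l. pr (t l)"]) auto
  qed
qed

text \<open>
  The equation \<open>y = D i z\<close> is solved by coordinates. Those in \<open>S\<close> and \<open>R\<close> only involve the resolutions over these rings.
  The coordinate in the bimodule asks for \<open>zM\<close> with \<open>DR zM = v\<close>, where \<open>v\<close> is \<open>pm y\<close> minus the contribution \<open>g\<close> of \<open>zS\<close>;
  this \<open>v\<close> is a cycle because \<open>y\<close> is one and consecutive matrices have product \<open>0\<close>.
\<close>

lemma ext_vanishes_triangular:
  assumes R: "ext_vanishes R (regular R) c1" and S: "ext_vanishes S (regular S) c2" and L: "ext_vanishes R L c3"
    and tor: "\<And>k D i. free_res S k D \<Longrightarrow> i \<ge> m \<Longrightarrow> col_exact N (k (Suc (Suc i))) (k (Suc i)) (k i) (transp (D (Suc i))) (transp (D i))"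
  shows "ext_vanishes T (regular T) (Suc m + c1 + c2 + c3)"
  unfolding ext_vanishes_def
proof (intro allI impI)
  fix k D i assume D: "free_res T k D" and i: "Suc m + c1 + c2 + c3 \<le> i"
  interpret S: ring S by (rule ring_S)
  note DS = free_res_S[OF D]
  have DR: "free_res R (\<lambda>i. k (i + Suc m)) (\<lambda>n i j. pr (D (n + Suc m) i j))"
    by (rule free_res_R[OF D tor[OF DS]])
  \<comment> \<open>the resolution over \<open>R\<close> consists of the matrices of \<open>D\<close> from position \<open>m + 1\<close> on\<close>
  define n where "n = i - Suc m"
  have n: "n + Suc m = i" "Suc n + Suc m = Suc i" "Suc (Suc n) + Suc m = Suc (Suc i)" "c1 \<le> n" "c3 \<le> n" "c2 \<le> i"
    using i by (auto simp: n_def)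
  let ?p = "k i" and ?q = "k (Suc i)" and ?r = "k (Suc (Suc i))" and ?E = "D i" and ?F = "D (Suc i)"
  note E = free_resD(1)[OF D, of i] and F = free_resD(1)[OF D, of "Suc i"] and z = free_resD(2)[OF D, of i]
  note cR = ext_vanishesD[OF R DR n(4), unfolded n] and cL = ext_vanishesD[OF L DR n(5), unfolded n] and cS = ext_vanishesD[OF S DS n(6)]
  show "col_exact (regular T) ?p ?q ?r ?E ?F" unfolding col_exact_def
  proof (intro ballI impI)
    fix y assume y': "y \<in> vecs (regular T) ?q" "\<forall>a<?r. lin_comb (regular T) ?q (?F a) y = \<zero>\<^bsub>regular T\<^esub>"
    then have y: "y \<in> vecs T ?q" "\<And>a. a < ?r \<Longrightarrow> lin_comb (regular T) ?q (?F a) y = \<zero>\<^bsub>T\<^esub>" by auto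
    have yR: "(\<lambda>b. pr (y b)) \<in> vecs (regular R) ?q" and yS: "(\<lambda>b. ps (y b)) \<in> vecs (regular S) ?q"
      and yM: "(\<lambda>b. pm (y b)) \<in> vecs L ?q" using y(1) by (auto simp: Pi_def)
    have eqs: "lin_comb (regular R) ?q (\<lambda>b. pr (?F a b)) (\<lambda>b. pr (y b)) = \<zero>\<^bsub>regular R\<^esub>"
       "lin_comb L ?q (\<lambda>b. pr (?F a b)) (\<lambda>b. pm (y b)) \<oplus>\<^bsub>L\<^esub> lin_comb N ?q (\<lambda>b. ps (y b)) (\<lambda>b. pm (?F a b)) = \<zero>\<^bsub>L\<^esub>"
       "lin_comb (regular S) ?q (\<lambda>b. ps (?F a b)) (\<lambda>b. ps (y b)) = \<zero>\<^bsub>regular S\<^esub>" if a: "a < ?r" for a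
      using coord_lin_comb[OF matsD[OF F a] y(1), unfolded y(2)[OF a] coord_zero] by simp_all
    obtain zR where zR: "zR \<in> vecs R ?p" "\<And>b. b < ?q \<Longrightarrow> pr (y b) = lin_comb (regular R) ?p (\<lambda>c. pr (?E b c)) zR"
      using col_exactD[OF cR yR eqs(1)] by auto
    obtain zS where zS: "zS \<in> vecs S ?p" "\<And>b. b < ?q \<Longrightarrow> ps (y b) = lin_comb (regular S) ?p (\<lambda>c. ps (?E b c)) zS"
      using col_exactD[OF cS yS eqs(3)] by auto
    define g where "g = (\<lambda>b. lin_comb N ?p zS (\<lambda>c. pm (?E b c)))"
    have g: "g \<in> vecs L ?q" unfolding g_def using zS(1) matsD[OF E] by (auto intro!: N_lin_comb_closed simp: Pi_def)
    define v where "v = (\<lambda>b. pm (y b) \<ominus>\<^bsub>L\<^esub> g b)"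
    have v: "v \<in> vecs L ?q" using yM g by (auto simp: v_def Pi_def)
    have "lin_comb L ?q (\<lambda>b. pr (?F a b)) v = \<zero>\<^bsub>L\<^esub>" if a: "a < ?r" for a
    proof -
      let ?x = "\<lambda>b. pr (?F a b)"
      have x: "?x \<in> vecs R ?q" using matsD[OF F a] by (auto simp: Pi_def)
      have Fm: "(\<lambda>b. pm (?F a b)) \<in> vecs L ?q" using matsD[OF F a] by (auto simp: Pi_def)
      have Y: "(\<lambda>b c. pm (?E b c)) \<in> {..<?q} \<rightarrow> {..<?p} \<rightarrow> carrier L" by (rule mat_coord[OF E])
      have h: "(\<lambda>c. lin_comb N ?q (\<lambda>b. ps (?E b c)) (\<lambda>b. pm (?F a b))) \<in> vecs N ?p"
        using mats_col[OF E] Fm by (auto simp: same_group Pi_def intro!: N_lin_comb_closed)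
      have yS': "(\<lambda>b. ps (y b)) \<in> vecs S ?q" using y(1) by (auto simp: Pi_def)
      have "lin_comb L ?q ?x g = lin_comb N ?p zS (\<lambda>c. lin_comb L ?q ?x (\<lambda>b. pm (?E b c)))"
        unfolding g_def by (rule lin_comb_interchange[OF x zS(1) Y, symmetric])
      also have "\<dots> = lin_comb N ?p zS (\<lambda>c. \<ominus>\<^bsub>N\<^esub> lin_comb N ?q (\<lambda>b. ps (?E b c)) (\<lambda>b. pm (?F a b)))"
      proof (rule lin_comb_cong[OF refl])
        fix c assume c: "c < ?p"
        have "lin_comb L ?q ?x (\<lambda>b. pm (?E b c)) \<oplus>\<^bsub>L\<^esub> lin_comb N ?q (\<lambda>b. ps (?E b c)) (\<lambda>b. pm (?F a b)) = \<zero>\<^bsub>L\<^esub>"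
          by (rule prod_zero_coord(2)[OF F E z a c])
        moreover have "lin_comb L ?q ?x (\<lambda>b. pm (?E b c)) \<in> carrier L" using mats_col[OF E c] by (intro RM.lin_comb_closed[OF x]) (auto simp: Pi_def)
        moreover have "lin_comb N ?q (\<lambda>b. ps (?E b c)) (\<lambda>b. pm (?F a b)) \<in> carrier L" using h c by (auto simp: same_group)
        ultimately have "lin_comb L ?q ?x (\<lambda>b. pm (?E b c)) = \<ominus>\<^bsub>L\<^esub> lin_comb N ?q (\<lambda>b. ps (?E b c)) (\<lambda>b. pm (?F a b))"
          by (metis RM.M.minus_equality)
        then show "lin_comb L ?q ?x (\<lambda>b. pm (?E b c)) = \<ominus>\<^bsub>N\<^esub> lin_comb N ?q (\<lambda>b. ps (?E b c)) (\<lambda>b. pm (?F a b))"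
          by (simp add: a_inv_def m_inv_def same_group)
      qed
      also have "\<dots> = \<ominus>\<^bsub>N\<^esub> lin_comb N ?p zS (\<lambda>c. lin_comb N ?q (\<lambda>b. ps (?E b c)) (\<lambda>b. pm (?F a b)))"
        by (rule SM.lin_comb_minus_right[OF _ h]) (use zS(1) in simp)
      also have "lin_comb N ?p zS (\<lambda>c. lin_comb N ?q (\<lambda>b. ps (?E b c)) (\<lambda>b. pm (?F a b))) =
          lin_comb N ?q (\<lambda>b. lin_comb (regular (op_ring S)) ?p zS (\<lambda>c. ps (?E b c))) (\<lambda>b. pm (?F a b))"
        by (rule lin_comb_assoc[OF SM.lmodule_axioms]) (use zS(1) Fm E in \<open>auto simp: same_group Pi_def\<close>)
      also have "\<dots> = lin_comb N ?q (\<lambda>b. ps (y b)) (\<lambda>b. pm (?F a b))"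
        by (rule lin_comb_cong) (simp_all add: zS(2) lin_comb_op)
      finally have gx: "lin_comb L ?q ?x g = \<ominus>\<^bsub>L\<^esub> lin_comb N ?q (\<lambda>b. ps (y b)) (\<lambda>b. pm (?F a b))"
        by (simp add: a_inv_def m_inv_def same_group)
      have "lin_comb L ?q ?x v = lin_comb L ?q ?x (\<lambda>b. pm (y b)) \<ominus>\<^bsub>L\<^esub> lin_comb L ?q ?x g"
        unfolding v_def by (rule RM.lin_comb_diff_right[OF x yM g])
      then show ?thesis using eqs(2)[OF a] N_lin_comb_closed[OF yS' Fm] by (simp add: gx a_minus_def)
    qed
    then obtain zM where zM: "zM \<in> vecs L ?p" "\<And>b. b < ?q \<Longrightarrow> v b = lin_comb L ?p (\<lambda>c. pr (?E b c)) zM"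
      using col_exactD[OF cL v] by auto
    define zz where "zz = (\<lambda>c. mk (zR c) (zM c) (zS c))"
    have zz: "zz \<in> vecs T ?p" using zR zM zS by (auto simp: zz_def Pi_def)
    have pz: "pr (zz c) = zR c" "pm (zz c) = zM c" "ps (zz c) = zS c" if "c < ?p" for c
      using zR(1) zM(1) zS(1) that by (auto simp: zz_def Pi_def)
    have "y b = lin_comb (regular T) ?p (?E b) zz" if b: "b < ?q" for b
    proof (rule coord_eqI)
      show "y b \<in> carrier T" using y(1) b by auto
      show "lin_comb (regular T) ?p (?E b) zz \<in> carrier T" by (rule lin_comb_regular_closed[OF T.ring_axioms matsD[OF E b] zz])
      note cl = coord_lin_comb[OF matsD[OF E b] zz]
      have "lin_comb (regular R) ?p (\<lambda>c. pr (?E b c)) (\<lambda>c. pr (zz c)) = lin_comb (regular R) ?p (\<lambda>c. pr (?E b c)) zR"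
        by (rule lin_comb_cong) (simp_all add: pz)
      then show "pr (y b) = pr (lin_comb (regular T) ?p (?E b) zz)" using cl zR(2)[OF b] by simp
      have "lin_comb (regular S) ?p (\<lambda>c. ps (?E b c)) (\<lambda>c. ps (zz c)) = lin_comb (regular S) ?p (\<lambda>c. ps (?E b c)) zS"
        by (rule lin_comb_cong) (simp_all add: pz)
      then show "ps (y b) = ps (lin_comb (regular T) ?p (?E b) zz)" using cl zS(2)[OF b] by simp
      have "lin_comb L ?p (\<lambda>c. pr (?E b c)) (\<lambda>c. pm (zz c)) = v b"
        unfolding zM(2)[OF b] by (rule lin_comb_cong) (simp_all add: pz)
      moreover have "lin_comb N ?p (\<lambda>c. ps (zz c)) (\<lambda>c. pm (?E b c)) = g b"
        unfolding g_def by (rule lin_comb_cong) (simp_all add: pz)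
      ultimately have "pm (lin_comb (regular T) ?p (?E b) zz) = (pm (y b) \<ominus>\<^bsub>L\<^esub> g b) \<oplus>\<^bsub>L\<^esub> g b" using cl by (simp add: v_def)
      moreover have "pm (y b) \<in> carrier L" "g b \<in> carrier L" using yM g b by auto
      ultimately show "pm (y b) = pm (lin_comb (regular T) ?p (?E b) zz)"
        by (simp add: a_minus_def RM.M.a_assoc RM.M.l_neg)
    qed
    then show "\<exists>z\<in>vecs (regular T) ?p. \<forall>b<?q. y b = lin_comb (regular T) ?p (?E b) z" using zz by auto
  qed
qed


section \<open>Restriction to the upper left corner\<close>

text \<open>
  The diagonal idempotent of the upper left corner.
\<close>

definition unit1 where "unit1 = mk \<one>\<^bsub>R\<^esub> \<zero>\<^bsub>L\<^esub> \<zero>\<^bsub>S\<^esub>"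

text \<open>
  The \<open>R\<close>-module \<open>unit1 J\<close>. Its elements are the fixed points of \<open>unit1\<close>, as it is idempotent.
\<close>

definition corner :: "('t, 'x) module \<Rightarrow> ('r, 'x) module" where
  "corner J = \<lparr>carrier = {x \<in> carrier J. unit1 \<odot>\<^bsub>J\<^esub> x = x}, monoid.mult = undefined, one = undefined,
     zero = \<zero>\<^bsub>J\<^esub>, add = add J, smult = (\<lambda>r x. mk r \<zero>\<^bsub>L\<^esub> \<zero>\<^bsub>S\<^esub> \<odot>\<^bsub>J\<^esub> x)\<rparr>"

lemma corner_simps [simp]:
  "x \<in> carrier (corner J) \<longleftrightarrow> x \<in> carrier J \<and> unit1 \<odot>\<^bsub>J\<^esub> x = x" "\<zero>\<^bsub>corner J\<^esub> = \<zero>\<^bsub>J\<^esub>"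
  "add (corner J) = add J" "r \<odot>\<^bsub>corner J\<^esub> x = mk r \<zero>\<^bsub>L\<^esub> \<zero>\<^bsub>S\<^esub> \<odot>\<^bsub>J\<^esub> x"
  by (auto simp: corner_def)

lemma unit1_closed [simp]: "unit1 \<in> carrier T" by (simp add: unit1_def)

lemma mult_unit1: "t \<in> carrier T \<Longrightarrow> t \<otimes>\<^bsub>T\<^esub> unit1 = mk (pr t) \<zero>\<^bsub>L\<^esub> \<zero>\<^bsub>S\<^esub>"
proof -
  interpret S: ring S by (rule ring_S)
  show "t \<in> carrier T \<Longrightarrow> t \<otimes>\<^bsub>T\<^esub> unit1 = mk (pr t) \<zero>\<^bsub>L\<^esub> \<zero>\<^bsub>S\<^esub>" by (simp add: unit1_def mk_mult)
qed

lemma unit1_mult: "r \<in> carrier R \<Longrightarrow> unit1 \<otimes>\<^bsub>T\<^esub> mk r \<zero>\<^bsub>L\<^esub> \<zero>\<^bsub>S\<^esub> = mk r \<zero>\<^bsub>L\<^esub> \<zero>\<^bsub>S\<^esub>"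
proof -
  interpret S: ring S by (rule ring_S)
  show "r \<in> carrier R \<Longrightarrow> unit1 \<otimes>\<^bsub>T\<^esub> mk r \<zero>\<^bsub>L\<^esub> \<zero>\<^bsub>S\<^esub> = mk r \<zero>\<^bsub>L\<^esub> \<zero>\<^bsub>S\<^esub>" by (simp add: unit1_def mk_mult)
qed

text \<open>
  On \<open>unit1 J\<close> the ring \<open>T\<close> acts through its upper left corner, because \<open>t unit1\<close> has no entries outside of it.
\<close>

lemma mk_smult_fixed:
  assumes "lmodule T J" "x \<in> carrier J" "unit1 \<odot>\<^bsub>J\<^esub> x = x" "t \<in> carrier T"
  shows "t \<odot>\<^bsub>J\<^esub> x = mk (pr t) \<zero>\<^bsub>L\<^esub> \<zero>\<^bsub>S\<^esub> \<odot>\<^bsub>J\<^esub> x"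
proof -
  interpret J: lmodule T J by fact
  have "t \<odot>\<^bsub>J\<^esub> x = t \<odot>\<^bsub>J\<^esub> (unit1 \<odot>\<^bsub>J\<^esub> x)" using assms(3) by simp
  also have "\<dots> = (t \<otimes>\<^bsub>T\<^esub> unit1) \<odot>\<^bsub>J\<^esub> x" using assms by (simp add: J.smult_assoc1)
  finally show ?thesis using assms(4) by (simp add: mult_unit1)
qed

lemma lmodule_corner:
  assumes J: "lmodule T J" shows "lmodule R (corner J)"
proof -
  interpret J: lmodule T J by fact
  interpret S: ring S by (rule ring_S)
  have "abelian_group (corner J)"
    by (rule abelian_groupI)
      (auto simp: J.M.a_ac J.smult_r_distr J.smult_minus_right intro!: exI[of _ "\<ominus>\<^bsub>J\<^esub> x" for x] J.M.r_neg)
  moreover have "mk r \<zero>\<^bsub>L\<^esub> \<zero>\<^bsub>S\<^esub> \<odot>\<^bsub>J\<^esub> x \<in> carrier (corner J)" if "r \<in> carrier R" "x \<in> carrier J" for r x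
    using that by (simp add: unit1_mult flip: J.smult_assoc1)
  moreover have "mk \<one>\<^bsub>R\<^esub> \<zero>\<^bsub>L\<^esub> \<zero>\<^bsub>S\<^esub> \<odot>\<^bsub>J\<^esub> x = x" if "x \<in> carrier (corner J)" for x
    using that by (simp add: unit1_def)
  ultimately show ?thesis
    by (intro lmodule.intro lmodule_axioms.intro RM.R.ring_axioms)
      (simp_all add: J.smult_r_distr mk_mult mk_add flip: J.smult_l_distr J.smult_assoc1)
qed

text \<open>
  Row vectors over \<open>R\<close> are row vectors over \<open>T\<close> with entries in the upper left corner. There an \<open>R\<close>-submodule is a
  \<open>T\<close>-submodule and an \<open>R\<close>-homomorphism to \<open>unit1 J\<close> is a \<open>T\<close>-homomorphism, so it extends over \<open>T\<close>.
\<close>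

lemma extends_homs_corner:
  assumes J: "lmodule T J" and ext: "extends_homs T J" shows "extends_homs R (corner J)"
  unfolding extends_homs_def
proof (intro allI impI)
  fix p K f assume K: "submodule K R (free_mod R p)"
    and f: "f \<in> lmodule_hom R ((free_mod R p)\<lparr>carrier := K\<rparr>) (corner J)"
  interpret J: lmodule T J by fact
  interpret S: ring S by (rule ring_S)
  have lF: "lmodule R (free_mod R p)" by (rule lmodule_free_mod[OF RM.R.ring_axioms])
  have lFT: "lmodule T (free_mod T p)" by (rule lmodule_free_mod[OF T.ring_axioms])
  interpret K: lsubmodule R "free_mod R p" K by (rule lsubmoduleI[OF lF K])
  have Kv: "x i \<in> carrier R" "i \<ge> p \<Longrightarrow> x i = \<zero>\<^bsub>R\<^esub>" if "x \<in> K" for x i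
    using K.sub_closed(1)[OF that] by (auto simp: free_mod_carrier)
  define \<iota> where "\<iota> = (\<lambda>x (i::nat). mk (x i) \<zero>\<^bsub>L\<^esub> \<zero>\<^bsub>S\<^esub>)"
  define \<kappa> where "\<kappa> = (\<lambda>u (i::nat). pr (u i))"
  have \<kappa>\<iota>: "\<kappa> (\<iota> x) = x" if "x \<in> K" for x using Kv[OF that] by (simp add: \<kappa>_def \<iota>_def)
  have \<iota>F: "\<iota> x \<in> carrier (free_mod T p)" if "x \<in> K" for x
    using Kv[OF that] by (simp add: \<iota>_def free_mod_carrier)
  have \<iota>add: "\<iota> (x \<oplus>\<^bsub>free_mod R p\<^esub> y) = \<iota> x \<oplus>\<^bsub>free_mod T p\<^esub> \<iota> y" if "x \<in> K" "y \<in> K" for x y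
    using Kv[OF that(1)] Kv[OF that(2)] by (simp add: \<iota>_def mk_add)
  have \<iota>smult: "t \<odot>\<^bsub>free_mod T p\<^esub> \<iota> x = \<iota> (pr t \<odot>\<^bsub>free_mod R p\<^esub> x)" if "x \<in> K" "t \<in> carrier T" for x t
    using Kv[OF that(1)] that(2) by (simp add: \<iota>_def mk_mult)
  have sub: "submodule (\<iota> ` K) T (free_mod T p)" unfolding submodule_iff[OF lFT]
  proof (intro conjI ballI)
    show "\<iota> ` K \<subseteq> carrier (free_mod T p)" using \<iota>F by blast
    show "\<zero>\<^bsub>free_mod T p\<^esub> \<in> \<iota> ` K" using K.sub_closed(2) by (intro image_eqI[of _ _ "\<zero>\<^bsub>free_mod R p\<^esub>"]) (simp_all add: \<iota>_def)
  next
    fix u v assume "u \<in> \<iota> ` K" "v \<in> \<iota> ` K"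
    then obtain x y where xy: "x \<in> K" "y \<in> K" "u = \<iota> x" "v = \<iota> y" by blast
    show "u \<oplus>\<^bsub>free_mod T p\<^esub> v \<in> \<iota> ` K" unfolding xy \<iota>add[OF xy(1,2), symmetric]
      by (rule imageI[OF K.sub_closed(3)[OF xy(1,2)]])
  next
    fix t u assume t: "t \<in> carrier T" and "u \<in> \<iota> ` K"
    then obtain x where x: "x \<in> K" "u = \<iota> x" by blast
    show "t \<odot>\<^bsub>free_mod T p\<^esub> u \<in> \<iota> ` K" unfolding x(2) \<iota>smult[OF x(1) t]
      by (rule imageI[OF K.sub_closed(4)[OF coord_closed(1)[OF t] x(1)]])
  qed
  have fJ: "f x \<in> carrier J" "unit1 \<odot>\<^bsub>J\<^esub> f x = f x" if "x \<in> K" for x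
    using lmodule_hom_closed[OF f, of x] that by simp_all
  have fadd: "f (x \<oplus>\<^bsub>free_mod R p\<^esub> y) = f x \<oplus>\<^bsub>J\<^esub> f y" if "x \<in> K" "y \<in> K" for x y
    using lmodule_hom_add[OF f, of x y] that by simp
  have fsmult: "f (r \<odot>\<^bsub>free_mod R p\<^esub> x) = mk r \<zero>\<^bsub>L\<^esub> \<zero>\<^bsub>S\<^esub> \<odot>\<^bsub>J\<^esub> f x" if "r \<in> carrier R" "x \<in> K" for r x
    using lmodule_hom_smult[OF f, of r x] that by simp
  have fT: "(\<lambda>u. f (\<kappa> u)) \<in> lmodule_hom T ((free_mod T p)\<lparr>carrier := \<iota> ` K\<rparr>) J"
  proof (rule lmodule_homI)
    show "f (\<kappa> u) \<in> carrier J" if "u \<in> carrier ((free_mod T p)\<lparr>carrier := \<iota> ` K\<rparr>)" for u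
    proof -
      from that have "u \<in> \<iota> ` K" by simp
      then obtain x where "x \<in> K" "u = \<iota> x" by (rule imageE)
      then show ?thesis using fJ(1) by (simp add: \<kappa>\<iota>)
    qed
  next
    fix u v assume "u \<in> carrier ((free_mod T p)\<lparr>carrier := \<iota> ` K\<rparr>)" "v \<in> carrier ((free_mod T p)\<lparr>carrier := \<iota> ` K\<rparr>)"
    then obtain x y where xy: "x \<in> K" "y \<in> K" "u = \<iota> x" "v = \<iota> y" by auto
    have "f (\<kappa> (u \<oplus>\<^bsub>free_mod T p\<^esub> v)) = f x \<oplus>\<^bsub>J\<^esub> f y"
      unfolding xy \<iota>add[OF xy(1,2), symmetric] \<kappa>\<iota>[OF K.sub_closed(3)[OF xy(1,2)]] by (rule fadd[OF xy(1,2)])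
    then show "f (\<kappa> (u \<oplus>\<^bsub>(free_mod T p)\<lparr>carrier := \<iota> ` K\<rparr>\<^esub> v)) = f (\<kappa> u) \<oplus>\<^bsub>J\<^esub> f (\<kappa> v)"
      using xy by (simp add: \<kappa>\<iota>)
  next
    fix t u assume t: "t \<in> carrier T" and "u \<in> carrier ((free_mod T p)\<lparr>carrier := \<iota> ` K\<rparr>)"
    then obtain x where x: "x \<in> K" "u = \<iota> x" by auto
    have "f (\<kappa> (t \<odot>\<^bsub>free_mod T p\<^esub> u)) = mk (pr t) \<zero>\<^bsub>L\<^esub> \<zero>\<^bsub>S\<^esub> \<odot>\<^bsub>J\<^esub> f x"
      unfolding x(2) \<iota>smult[OF x(1) t] \<kappa>\<iota>[OF K.sub_closed(4)[OF coord_closed(1)[OF t] x(1)]]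
      by (rule fsmult[OF coord_closed(1)[OF t] x(1)])
    also have "\<dots> = t \<odot>\<^bsub>J\<^esub> f x" by (rule mk_smult_fixed[OF J fJ[OF x(1)] t, symmetric])
    finally show "f (\<kappa> (t \<odot>\<^bsub>(free_mod T p)\<lparr>carrier := \<iota> ` K\<rparr>\<^esub> u)) = t \<odot>\<^bsub>J\<^esub> f (\<kappa> u)"
      using x by (simp add: \<kappa>\<iota>)
  qed
  obtain z where z: "z \<in> vecs J p" "\<forall>u\<in>\<iota> ` K. f (\<kappa> u) = lin_comb J p u z"
    using ext[unfolded extends_homs_def, rule_format, OF sub fT] by (elim bexE)
  show "\<exists>z\<in>vecs (corner J) p. \<forall>x\<in>K. f x = lin_comb (corner J) p x z"
  proof (intro bexI[of _ "\<lambda>i. unit1 \<odot>\<^bsub>J\<^esub> z i"] ballI)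
    have "unit1 \<otimes>\<^bsub>T\<^esub> unit1 = unit1" using unit1_mult[of "\<one>\<^bsub>R\<^esub>"] by (simp add: unit1_def)
    then show "(\<lambda>i. unit1 \<odot>\<^bsub>J\<^esub> z i) \<in> vecs (corner J) p"
      using z(1) by (auto simp: Pi_def J.smult_assoc1[symmetric])
    fix x assume x: "x \<in> K"
    have "lin_comb (corner J) m x (\<lambda>i. unit1 \<odot>\<^bsub>J\<^esub> z i) = lin_comb J m (\<iota> x) z" if "m \<le> p" for m
      using that
    proof (induction m)
      case (Suc m)
      have "mk (x m) \<zero>\<^bsub>L\<^esub> \<zero>\<^bsub>S\<^esub> \<odot>\<^bsub>J\<^esub> (unit1 \<odot>\<^bsub>J\<^esub> z m) = (mk (x m) \<zero>\<^bsub>L\<^esub> \<zero>\<^bsub>S\<^esub> \<otimes>\<^bsub>T\<^esub> unit1) \<odot>\<^bsub>J\<^esub> z m"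
        using Kv[OF x] z(1) Suc(2) by (subst J.smult_assoc1) (auto simp: Pi_def)
      also have "\<dots> = \<iota> x m \<odot>\<^bsub>J\<^esub> z m" using Kv[OF x] by (simp add: mult_unit1 \<iota>_def)
      finally show ?case using Suc by simp
    qed simp
    then show "f x = lin_comb (corner J) p x (\<lambda>i. unit1 \<odot>\<^bsub>J\<^esub> z i)" using z(2) x \<kappa>\<iota>[OF x] by auto
  qed
qed

text \<open>
  Multiplication with \<open>unit1\<close> is exact, so it turns an injective resolution of the regular module of \<open>T\<close> into a finite
  coresolution over \<open>R\<close> whose terms extend homomorphisms. It resolves the first row of the matrix ring, of which
  the bimodule is a direct summand.
\<close>

lemma ext_vanishes_of_inj_dim_triangular:
  assumes "inj_dim T (regular T) < \<infinity>" shows "\<exists>n. ext_vanishes R L n"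
proof -
  interpret S: ring S by (rule ring_S)
  obtain I :: "nat \<Rightarrow> ('t, ('t, 't) univ) module" and d e n where
    I: "injective_resolution T (regular T) I d e" "\<And>i. i > n \<Longrightarrow> carrier (I i) = {\<zero>\<^bsub>I i\<^esub>}"
    using inj_dim_finite_resolution[OF assms] by metis
  note Q = I(1)[unfolded injective_resolution_def]
  have lI: "lmodule T (I j)" for j using Q by (simp add: injective_lmodule_def)
  obtain g :: "(nat \<Rightarrow> 't) \<Rightarrow> ('t, 't) univ" where g: "inj g"
    using ex_inj_nat_ring[OF infinite_univ inj_Inl] by (elim exE)
  have hI: "extends_homs T (I j)" for j using Q by (intro injective_imp_extends_homs[OF _ g]) simp
  have hom: "f \<in> lmodule_hom R (corner X) (corner Y)"
    if f: "f \<in> lmodule_hom T X Y" for f and X :: "('t, 'x) module" and Y :: "('t, 'y) module"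
  proof (rule lmodule_homI)
    show "f x \<in> carrier (corner Y)" if "x \<in> carrier (corner X)" for x
      using that lmodule_hom_closed[OF f, of x] lmodule_hom_smult[OF f unit1_closed, of x] by simp
  qed (use lmodule_hom_add[OF f] lmodule_hom_smult[OF f] in simp_all)
  have ex: "f ` carrier (corner X) = lmodule_ker (corner Y) (corner Z) h"
    if f: "f \<in> lmodule_hom T X Y" and h: "h \<in> lmodule_hom T Y Z" and X: "lmodule T X"
      and eq: "f ` carrier X = lmodule_ker Y Z h"
    for f h and X :: "('t, 'x) module" and Y :: "('t, 'y) module" and Z :: "('t, 'z) module"
  proof (intro equalityI subsetI)
    interpret X: lmodule T X by fact
    show "y \<in> lmodule_ker (corner Y) (corner Z) h" if y: "y \<in> f ` carrier (corner X)" for y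
    proof -
      obtain x where x: "x \<in> carrier (corner X)" "y = f x" using y by blast
      have "f x \<in> lmodule_ker Y Z h" unfolding eq[symmetric] using x by simp
      then show ?thesis using lmodule_hom_closed[OF hom[OF f] x(1)] x(2) by (simp add: lmodule_ker_def)
    qed
    show "y \<in> f ` carrier (corner X)" if y: "y \<in> lmodule_ker (corner Y) (corner Z) h" for y
    proof -
      have "y \<in> lmodule_ker Y Z h" using y by (simp add: lmodule_ker_def)
      then obtain x where x: "x \<in> carrier X" "y = f x" unfolding eq[symmetric] by blast
      have "unit1 \<odot>\<^bsub>Y\<^esub> y = y" using y by (simp add: lmodule_ker_def)
      then have "y = f (unit1 \<odot>\<^bsub>X\<^esub> x)" using lmodule_hom_smult[OF f unit1_closed x(1)] x(2) by simp
      moreover have "unit1 \<otimes>\<^bsub>T\<^esub> unit1 = unit1" using unit1_mult[of "\<one>\<^bsub>R\<^esub>"] by (simp add: unit1_def)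
      ultimately show ?thesis using x(1)
        by (intro image_eqI[of _ _ "unit1 \<odot>\<^bsub>X\<^esub> x"]) (simp_all flip: X.smult_assoc1)
    qed
  qed
  have e: "e \<in> lmodule_hom T (regular T) (I 0)" and d: "\<And>j. d j \<in> lmodule_hom T (I j) (I (Suc j))" using Q by blast+
  have "ext_vanishes R (corner (regular T)) (Suc n)"
  proof (rule finite_coresolution_ext_vanishes[where J = "\<lambda>j. corner (I j)" and e = e and d = d])
    show "lmodule R (corner (regular T))" by (rule lmodule_corner[OF regT])
    show "lmodule R (corner (I j))" for j by (rule lmodule_corner[OF lI])
    show "extends_homs R (corner (I j))" for j by (rule extends_homs_corner[OF lI hI])
    show "e \<in> lmodule_hom R (corner (regular T)) (corner (I 0))" by (rule hom[OF e])
    show "d j \<in> lmodule_hom R (corner (I j)) (corner (I (Suc j)))" for j by (rule hom[OF d])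
    show "inj_on e (carrier (corner (regular T)))" using Q by (auto simp: inj_on_def)
    show "e ` carrier (corner (regular T)) = lmodule_ker (corner (I 0)) (corner (I 1)) (d 0)"
      by (rule ex[OF e _ regT]) (use Q d[of 0] in simp_all)
    show "d j ` carrier (corner (I j)) = lmodule_ker (corner (I (Suc j))) (corner (I (Suc (Suc j)))) (d (Suc j))" for j
      by (rule ex[OF d d lI]) (use Q in simp)
    show "carrier (corner (I j)) = {\<zero>\<^bsub>corner (I j)\<^esub>}" if "n < j" for j
    proof -
      interpret Ij: lmodule T "I j" by (rule lI)
      have "carrier (corner (I j)) = {x \<in> carrier (I j). unit1 \<odot>\<^bsub>I j\<^esub> x = x}" by (simp add: corner_def)
      then show ?thesis unfolding I(2)[OF that] using Ij.smult_zero_right[OF unit1_closed] by auto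
    qed
  qed
  moreover have "lmodule_homo R L (corner (regular T)) (\<lambda>x. mk \<zero>\<^bsub>R\<^esub> x \<zero>\<^bsub>S\<^esub>)"
    by (intro lmodule_homoI lmodule_corner[OF regT] RM.lmodule_axioms lmodule_homI)
      (simp_all add: mk_add mk_mult unit1_def)
  moreover have "lmodule_homo R (corner (regular T)) L pm"
    by (intro lmodule_homoI lmodule_corner[OF regT] RM.lmodule_axioms lmodule_homI)
      simp_all
  ultimately have "ext_vanishes R L (Suc n)" by (intro ext_vanishes_retract[of R L "corner (regular T)" "\<lambda>x. mk \<zero>\<^bsub>R\<^esub> x \<zero>\<^bsub>S\<^esub>" pm]) simp_all
  then show ?thesis by blast
qed

end

section \<open>The Gorenstein criterion\<close>

lemma gorensteinD:
  assumes "gorenstein A"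
  shows "ring A" "left_noetherian A" "left_noetherian (op_ring A)"
    "\<exists>n. ext_vanishes A (regular A) n" "\<exists>n. ext_vanishes (op_ring A) (regular (op_ring A)) n"
  using assms inj_dim_imp_ext_vanishes[OF lmodule_regular, of A] inj_dim_imp_ext_vanishes[OF lmodule_regular[OF ring_op_ring], of A]
  by (auto simp: gorenstein_def)

lemma tri_ring_triangular_ring:
  assumes R: "ring R" and S: "ring S" and M: "is_bimodule R S M"
  shows "tri_ring (triangular_ring R S M) R S M (right_module M) fst (\<lambda>t. fst (snd t)) (\<lambda>t. snd (snd t)) (\<lambda>r x s. (r, x, s))"
proof (intro tri_ring.intro tri_ring_axioms.intro)
  show "ring (triangular_ring R S M)" by (rule ring_triangular_ring[OF R S M])
  show "lmodule R M" "lmodule (op_ring S) (right_module M)" using M by (simp_all add: is_bimodule_def)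
qed (use M S in \<open>auto simp: triangular_ring_def right_module_def is_bimodule_def\<close>)

context tri_ring
begin

text \<open>
  Each side of the theorem consists of conditions on left modules for \<open>T\<close> and for its opposite ring. For \<open>T\<close> itself,
  the right module structure of the bimodule enters through the vanishing of \<open>Tor\<close>.
\<close>

lemma left_conditions_sufficient:
  assumes R: "gorenstein R" and S: "gorenstein S" and fg: "fg_lmodule R L"
    and pdL: "proj_dim R L < \<infinity>" and pdN: "proj_dim (op_ring S) N < \<infinity>"
  shows "left_noetherian T" "inj_dim T (regular T) < \<infinity>"
proof -
  note R' = gorensteinD[OF R] and S' = gorensteinD[OF S]
  have "fg_sub R L (carrier L)" using fg by (simp add: fg_lmodule_iff[OF RM.lmodule_axioms])
  then show nT: "left_noetherian T" by (rule left_noetherian_triangular[OF R'(2) S'(2)])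
  obtain c1 c2 where c: "ext_vanishes R (regular R) c1" "ext_vanishes S (regular S) c2" using R'(4) S'(4) by blast
  have c3: "ext_vanishes R L c1" by (rule proj_dim_imp_ext_vanishes[OF RM.lmodule_axioms pdL c(1)])
  obtain m where "\<forall>k D i. free_res S k D \<longrightarrow> i \<ge> m \<longrightarrow> col_exact N (k (Suc (Suc i))) (k (Suc i)) (k i) (transp (D (Suc i))) (transp (D i))"
    using proj_dim_imp_tor_vanishing[OF ring_S SM.lmodule_axioms pdN] by (elim exE)
  then have "ext_vanishes T (regular T) (Suc m + c1 + c2 + c1)"
    by (intro ext_vanishes_triangular[OF c c3]) simp
  then show "inj_dim T (regular T) < \<infinity>" by (rule ext_vanishes_imp_inj_dim[OF T.ring_axioms nT regT])
qed

lemma left_conditions_necessary: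
  assumes R: "gorenstein R" and nT: "left_noetherian T" and iT: "inj_dim T (regular T) < \<infinity>"
  shows "fg_lmodule R L" "proj_dim R L < \<infinity>"
proof -
  note R' = gorensteinD[OF R]
  have fg: "fg_sub R L (carrier L)" by (rule fg_of_left_noetherian[OF nT])
  then show "fg_lmodule R L" by (simp add: fg_lmodule_iff[OF RM.lmodule_axioms])
  obtain c c' m where "ext_vanishes R (regular R) c" "ext_vanishes (op_ring R) (regular (op_ring R)) c'" "ext_vanishes R L m"
    using R'(4,5) ext_vanishes_of_inj_dim_triangular[OF iT] by blast
  then show "proj_dim R L < \<infinity>" by (intro ext_vanishes_imp_proj_dim[OF R'(1-3) _ _ RM.lmodule_axioms fg])
qed

end

lemma gorenstein_op_ring: "gorenstein A \<Longrightarrow> gorenstein (op_ring A)"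
  by (simp add: gorenstein_def ring_op_ring)

theorem theorem3p3:
  fixes R :: "'r ring" and S :: "'s ring" and M :: "('r, 'm, 's) bimodule"
  assumes "gorenstein R" and "gorenstein S" and "is_bimodule R S M"
  shows "gorenstein (triangular_ring R S M) \<longleftrightarrow>
    fg_lmodule R M \<and> fg_lmodule (op_ring S) (right_module M) \<and>
    proj_dim R M < \<infinity> \<and> proj_dim (op_ring S) (right_module M) < \<infinity>"
proof -
  let ?T = "triangular_ring R S M"
  interpret l: tri_ring ?T R S M "right_module M" fst "\<lambda>t. fst (snd t)" "\<lambda>t. snd (snd t)" "\<lambda>r x s. (r, x, s)"
    by (rule tri_ring_triangular_ring[OF gorensteinD(1)[OF assms(1)] gorensteinD(1)[OF assms(2)] assms(3)])
  interpret r: tri_ring "op_ring ?T" "op_ring S" "op_ring R" "right_module M" M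
    "\<lambda>t. snd (snd t)" "\<lambda>t. fst (snd t)" fst "\<lambda>s x r. (r, x, s)"
    by (rule l.opposite)
  note op = gorenstein_op_ring[OF assms(1)] gorenstein_op_ring[OF assms(2)]
  show ?thesis
  proof
    assume "gorenstein ?T"
    then show "fg_lmodule R M \<and> fg_lmodule (op_ring S) (right_module M) \<and>
        proj_dim R M < \<infinity> \<and> proj_dim (op_ring S) (right_module M) < \<infinity>"
      using l.left_conditions_necessary[OF assms(1)] r.left_conditions_necessary[OF op(2)]
      by (auto simp: gorenstein_def)
  next
    assume "fg_lmodule R M \<and> fg_lmodule (op_ring S) (right_module M) \<and>
        proj_dim R M < \<infinity> \<and> proj_dim (op_ring S) (right_module M) < \<infinity>"
    then show "gorenstein ?T"
      using l.left_conditions_sufficient[OF assms(1,2)] r.left_conditions_sufficient[OF op(2,1)] l.T.ring_axioms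
      by (simp add: gorenstein_def)
  qed
qed

end
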